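(* Let $\Pi$ be a line-parallelism of $\Sigma_\eta$ comprising the Desarguesian spread $\mathcal{D}_\eta$ and $q^2+q$ Hall spreads, which are obtained by switching the $q^2+q$ reguli of $\mathcal{D}_\eta$ through the line $r_{U_1}\cap\Sigma_\eta$; that is, for each regulus $\mathcal{R}\subset\mathcal{D}_\eta$ containing $r_{U_1}\cap\Sigma_\eta$, $\Pi$ contains exactly one Hall spread of the form $(\mathcal{S}\setminus\mathcal{R})\cup\mathcal{R}^{o}$, where $\mathcal{S}$ is a Desarguesian line-spread of $\Sigma_\eta$ containing $\mathcal{R}$ and $\mathcal{R}^{o}$ is the regulus opposite to $\mathcal{R}$. If $\Pi$ is left invariant by $E$, then there exists a good set $\mathcal{P}$ such that $\Pi=\Pi_{\mathcal{P}}$.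
   Context: Throughout, $q\ge 3$ is a prime power. Points of $\mathrm{PG}(3,q^2)$ have homogeneous coordinates $(x_1,x_2,x_3,x_4)$; $U_i$ is the point with $1$ in position $i$ and $0$ elsewhere; $t_1=\langle U_1,U_2\rangle$, $t_2=\langle U_3,U_4\rangle$, $r_{U_1}=\langle U_1,U_3\rangle$. Let $\Lambda\subset\mathbb{F}_{q^2}\setminus\{0\}$ be a fixed set of $q-1$ elements with pairwise distinct norms $\alpha^{q+1}$. For $\alpha\in\Lambda$, $\tau_\alpha:(x_1,x_2,x_3,x_4)\mapsto(x_3^q,x_4^q,\alpha^{q+1}x_1^q,\alpha^{q+1}x_2^q)$ is an involution whose set of fixed points is the Baer subgeometry $\Sigma_\alpha=\{(x,y,\alpha x^q,\alpha y^q): x,y\in\mathbb{F}_{q^2},(x,y)\neq(0,0)\}\simeq\mathrm{PG}(3,q)$. Let $\mathcal{U}=\{u\in\mathbb{F}_{q^2}:u^{q+1}=1\}$ and let $\eta$ be the unique element of $\mathcal{U}\cap\Lambda$. $E$ is the group of projectivities given (acting on column vectors on the left) by the matrices $\begin{pmatrix}1&b&0&0\\0&1&0&0\\0&0&1&b^q\\0&0&0&1\end{pmatrix}$, $b\in\mathbb{F}_{q^2}$. A set $A=\{a_1,\dots,a_t\}\subset\mathbb{F}_q\setminus\{0\}$ is fixed as follows. If $q$ is even, $t=(q-2)/2$ and $\{1\}\cup A\cup A^{-1}=\mathbb{F}_q\setminus\{0\}$ is a partition. If $q$ is odd, $t=(q-3)/2$, $\{\pm1\}\cup A\cup A^{-1}=\mathbb{F}_q\setminus\{0\}$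 is a partition, and $-a\notin A$ for every $a\in A$. Put $\mathcal{I}=\{\alpha\in\Lambda:\alpha^{q+1}\in A\}$ if $q$ is even and $\mathcal{I}=\{\alpha\in\Lambda:\alpha^{q+1}\in A\cup\{-1\}\}$ if $q$ is odd. For $P\in t_1$ let $r_P=\langle P,P^{\tau_\eta}\rangle$. $\mathcal{D}_\eta=\{r_P\cap\Sigma_\eta:P\in t_1\}$ is a Desarguesian line-spread of $\Sigma_\eta$. If $\ell$ is a line of $\mathrm{PG}(3,q^2)$ with $\ell,\ell^{\tau_\eta}$ skew, $\mathcal{S}_\ell=\{\langle P,P^{\tau_\eta}\rangle\cap\Sigma_\eta:P\in\ell\}$. For $\alpha\in\mathcal{I}$, $u,v\in\mathcal{U}$: $P_{\alpha u}=(1,0,\alpha u,0)$; $\pi_{\alpha v}$ is the plane $X_4=\alpha vX_2$ (it contains $r_{U_1}$ and meets $\Sigma_\alpha$ in a Baer subplane); $p(P_{\alpha u},\pi_{\alpha v})$ is the set of the $q+1$ lines of $\pi_{\alpha v}$ through $P_{\alpha u}$ meeting $\pi_{\alpha v}\cap\Sigma_\alpha$ in a Baer subline (one is $r_{U_1}$). For each $\ell\ne r_{U_1}$ in such a set, $\mathcal{R}_\ell:=\mathcal{D}_\eta\cap\mathcal{S}_\ell$ is a regulus through $r_{U_1}\cap\Sigma_\eta$ and $\mathcal{R}_\ell^{o}$ is its opposite. A good set is a set $\mathcal{P}$ of $q+1$ pairs $(P_{\alpha_iu_i},\pi_{\alpha_iv_i})$, $\alpha_i\in\mathcal{I}$,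 $u_i,v_i\in\mathcal{U}$, such that any two members with $(\alpha_i,u_i,v_i)\ne(\alpha_j,u_j,v_j)$ satisfy $u_iv_j-v_iu_j\neq0$ and $\alpha_iu_i(\alpha_jv_j)^q-(\alpha_iv_i)^q\alpha_ju_j\neq0$. Then $\mathcal{L}_{\mathcal{P}}$ is the set of lines $\ne r_{U_1}$ lying in some $p(P_{\alpha_iu_i},\pi_{\alpha_iv_i})$ with $(P_{\alpha_iu_i},\pi_{\alpha_iv_i})\in\mathcal{P}$, and $\Pi_{\mathcal{P}}=\{(\mathcal{S}_\ell\setminus\mathcal{R}_\ell)\cup\mathcal{R}_\ell^{o}:\ell\in\mathcal{L}_{\mathcal{P}}\}\cup\{\mathcal{D}_\eta\}$. *)

theory Defs
  imports
    "HOL-Analysis.Analysis"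
    "HOL-Library.Disjoint_Sets"
    "HOL-Number_Theory.Prime_Powers"
begin

section \<open>The projective space PG(3,F)\<close>

text \<open>
  A point of PG(3,F) is a one-dimensional subspace of \<open>F ^ 4\<close>, i.e. a set of vectors. Lines,
  planes and Baer subgeometries are sets of points, so \<open>r \<inter> \<Sigma>\<close> is literally an intersection. In
  the theorem F is a finite field \<open>'a\<close> with \<open>CARD('a) = q ^ 2\<close>.
\<close>

type_synonym 'a point = "('a ^ 4) set"

definition pt :: "'a::field \<Rightarrow> 'a \<Rightarrow> 'a \<Rightarrow> 'a \<Rightarrow> 'a point" where
  "pt a b c d = vec.span {vector [a, b, c, d]}"

definition points :: "'a::field point set" where
  "points = {vec.span {x} | x. x \<noteq> 0}"

definition join :: "'a::field point \<Rightarrow> 'a point \<Rightarrow> 'a point set" where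
  "join P Q = {R \<in> points. R \<subseteq> vec.span (P \<union> Q)}"

definition lines :: "'a::field point set set" where
  "lines = {join P Q | P Q. P \<in> points \<and> Q \<in> points \<and> P \<noteq> Q}"

definition U1 :: "'a::field point" where "U1 = pt 1 0 0 0"
definition U2 :: "'a::field point" where "U2 = pt 0 1 0 0"
definition U3 :: "'a::field point" where "U3 = pt 0 0 1 0"

definition t1 :: "'a::field point set" where "t1 = join U1 U2"
definition rU1 :: "'a::field point set" where "rU1 = join U1 U3"

section \<open>Lines, reguli, spreads and parallelisms of a subgeometry\<close>

text \<open>The lines of a (Baer) subgeometry, given as its set \<open>B\<close> of points.\<close>

definition sublines :: "'a::field point set \<Rightarrow> 'a point set set" where
  "sublines B = {join P Q \<inter> B | P Q. P \<in> B \<and> Q \<in> B \<and> P \<noteq> Q}"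

text \<open>
  The lines of \<open>B\<close> meeting all members of \<open>R\<close> in a point of \<open>B\<close>. If \<open>R\<close> is a regulus, this is
  its opposite regulus.
\<close>

definition transversals :: "'a::field point set \<Rightarrow> 'a point set set \<Rightarrow> 'a point set set" where
  "transversals B R = {m \<in> sublines B. \<forall>l\<in>R. m \<inter> l \<noteq> {}}"

abbreviation opposite :: "'a::field point set \<Rightarrow> 'a point set set \<Rightarrow> 'a point set set" where
  "opposite \<equiv> transversals"

text \<open>A regulus is the set of all lines meeting three given pairwise skew lines.\<close>

definition regulus :: "'a::field point set \<Rightarrow> 'a point set set \<Rightarrow> bool" where
  "regulus B R \<longleftrightarrow> (\<exists>l1\<in>sublines B. \<exists>l2\<in>sublines B. \<exists>l3\<in>sublines B.
     l1 \<inter> l2 = {} \<and> l1 \<inter> l3 = {} \<and> l2 \<inter> l3 = {} \<and> R = transversals B {l1, l2, l3})"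

definition line_spread :: "'a::field point set \<Rightarrow> 'a point set set \<Rightarrow> bool" where
  "line_spread B S \<longleftrightarrow> S \<subseteq> sublines B \<and> partition_on B S"

text \<open>
  A line-spread is Desarguesian (regular) if it contains the regulus determined by any three of
  its lines. For \<open>q > 2\<close> these are the spreads whose translation plane is Desarguesian.
\<close>

definition desarguesian :: "'a::field point set \<Rightarrow> 'a point set set \<Rightarrow> bool" where
  "desarguesian B S \<longleftrightarrow> line_spread B S \<and>
     (\<forall>R l1 l2 l3. regulus B R \<and> l1 \<in> S \<and> l2 \<in> S \<and> l3 \<in> S \<and>
        l1 \<noteq> l2 \<and> l1 \<noteq> l3 \<and> l2 \<noteq> l3 \<and> {l1, l2, l3} \<subseteq> R \<longrightarrow> R \<subseteq> S)"

definition line_parallelism :: "'a::field point set \<Rightarrow> 'a point set set set \<Rightarrow> bool" where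
  "line_parallelism B \<P> \<longleftrightarrow> (\<forall>S\<in>\<P>. line_spread B S) \<and> partition_on (sublines B) \<P>"

definition switch ::
    "'a::field point set \<Rightarrow> 'a point set set \<Rightarrow> 'a point set set \<Rightarrow> 'a point set set" where
  "switch B S R = (S - R) \<union> opposite B R"

text \<open>
  \<open>H\<close> is a Hall spread obtained from some Desarguesian spread (not a fixed one) by switching its
  regulus \<open>R\<close>.
\<close>

definition hall_by_switching ::
    "'a::field point set \<Rightarrow> 'a point set set \<Rightarrow> 'a point set set \<Rightarrow> bool" where
  "hall_by_switching B R H \<longleftrightarrow> (\<exists>S. desarguesian B S \<and> R \<subseteq> S \<and> H = switch B S R)"

section \<open>The sets of scalars\<close>

definition norm_transversal :: "nat \<Rightarrow> 'a::field set \<Rightarrow> bool" where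
  "norm_transversal q \<Lambda> \<longleftrightarrow> 0 \<notin> \<Lambda> \<and> card \<Lambda> = q - 1 \<and> inj_on (\<lambda>\<alpha>. \<alpha> ^ (q + 1)) \<Lambda>"

definition units1 :: "nat \<Rightarrow> 'a::field set" where
  "units1 q = {u. u ^ (q + 1) = 1}"

text \<open>
  The nonzero elements of \<open>F_q\<close>, as a subset of \<open>F_{q^2}\<close>. The cells \<open>A\<close> and \<open>A\<^sup>-\<^sup>1\<close> of the
  partitions below are empty when \<open>q = 3\<close>, so \<open>partition_on\<close> (which forbids empty cells) is
  not used.
\<close>

definition Fq_star :: "nat \<Rightarrow> 'a::field set" where
  "Fq_star q = {x. x ^ q = x \<and> x \<noteq> 0}"

definition half_system :: "nat \<Rightarrow> 'a::field set \<Rightarrow> bool" where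
  "half_system q A \<longleftrightarrow> finite A \<and>
     (if even q then
        card A = (q - 2) div 2 \<and>
        {1} \<union> A \<union> inverse ` A = Fq_star q \<and>
        {1} \<inter> A = {} \<and> {1} \<inter> inverse ` A = {} \<and> A \<inter> inverse ` A = {}
      else
        card A = (q - 3) div 2 \<and>
        {1, -1} \<union> A \<union> inverse ` A = Fq_star q \<and>
        {1, -1} \<inter> A = {} \<and> {1, -1} \<inter> inverse ` A = {} \<and> A \<inter> inverse ` A = {} \<and>
        (\<forall>a\<in>A. - a \<notin> A))"

definition index_set :: "nat \<Rightarrow> 'a::field set \<Rightarrow> 'a set \<Rightarrow> 'a set" where
  "index_set q \<Lambda> A =
     {\<alpha> \<in> \<Lambda>. \<alpha> ^ (q + 1) \<in> (if even q then A else A \<union> {-1})}"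

section \<open>Baer subgeometries and the spreads they carry\<close>

definition tau :: "nat \<Rightarrow> 'a::field \<Rightarrow> 'a point \<Rightarrow> 'a point" where
  "tau q \<alpha> P =
     (\<lambda>x. vector [(x $ 3) ^ q, (x $ 4) ^ q,
                  \<alpha> ^ (q + 1) * (x $ 1) ^ q, \<alpha> ^ (q + 1) * (x $ 2) ^ q]) ` P"

definition baer :: "nat \<Rightarrow> 'a::field \<Rightarrow> 'a point set" where
  "baer q \<alpha> = {pt x y (\<alpha> * x ^ q) (\<alpha> * y ^ q) | x y. (x, y) \<noteq> (0, 0)}"

definition line_spread_of :: "nat \<Rightarrow> 'a::field \<Rightarrow> 'a point set \<Rightarrow> 'a point set set" where
  "line_spread_of q \<eta> l = {join P (tau q \<eta> P) \<inter> baer q \<eta> | P. P \<in> l}"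

definition D_spread :: "nat \<Rightarrow> 'a::field \<Rightarrow> 'a point set set" where
  "D_spread q \<eta> = line_spread_of q \<eta> t1"

definition E_group :: "nat \<Rightarrow> ('a::field point \<Rightarrow> 'a point) set" where
  "E_group q = {(\<lambda>P. (\<lambda>x. (vector
       [vector [1, b, 0, 0],
        vector [0, 1, 0, 0],
        vector [0, 0, 1, b ^ q],
        vector [0, 0, 0, 1]] :: 'a ^ 4 ^ 4) *v x) ` P) | b. True}"

section \<open>Good sets and the associated families of spreads\<close>

text \<open>The point \<open>P_x\<close> and the plane \<open>\<pi>_y\<close> are used with \<open>x = \<alpha> * u\<close> and \<open>y = \<alpha> * v\<close>.\<close>

definition Ppt :: "'a::field \<Rightarrow> 'a point" where
  "Ppt x = pt 1 0 x 0"

definition plane :: "'a::field \<Rightarrow> 'a point set" where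
  "plane y = {R \<in> points. \<forall>x\<in>R. x $ 4 = y * x $ 2}"

definition pencil :: "nat \<Rightarrow> 'a::field \<Rightarrow> 'a \<Rightarrow> 'a \<Rightarrow> 'a point set set" where
  "pencil q \<alpha> u v =
     {l \<in> lines. l \<subseteq> plane (\<alpha> * v) \<and> Ppt (\<alpha> * u) \<in> l \<and>
        l \<inter> (plane (\<alpha> * v) \<inter> baer q \<alpha>) \<in> sublines (plane (\<alpha> * v) \<inter> baer q \<alpha>)}"

definition good_set ::
    "nat \<Rightarrow> 'a::field set \<Rightarrow> 'a set \<Rightarrow> ('a point \<times> 'a point set) set \<Rightarrow> bool" where
  "good_set q \<Lambda> A \<P> \<longleftrightarrow> card \<P> = q + 1 \<and>
     (\<exists>T \<subseteq> index_set q \<Lambda> A \<times> units1 q \<times> units1 q.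
        \<P> = (\<lambda>(\<alpha>, u, v). (Ppt (\<alpha> * u), plane (\<alpha> * v))) ` T \<and>
        (\<forall>(\<alpha>, u, v)\<in>T. \<forall>(\<beta>, w, z)\<in>T. (\<alpha>, u, v) \<noteq> (\<beta>, w, z) \<longrightarrow>
           u * z - v * w \<noteq> 0 \<and>
           \<alpha> * u * (\<beta> * z) ^ q - (\<alpha> * v) ^ q * (\<beta> * w) \<noteq> 0))"

definition L_lines ::
    "nat \<Rightarrow> 'a::field set \<Rightarrow> 'a set \<Rightarrow> ('a point \<times> 'a point set) set \<Rightarrow> 'a point set set" where
  "L_lines q \<Lambda> A \<P> =
     {l. l \<noteq> rU1 \<and>
        (\<exists>\<alpha>\<in>index_set q \<Lambda> A. \<exists>u\<in>units1 q. \<exists>v\<in>units1 q.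
           (Ppt (\<alpha> * u), plane (\<alpha> * v)) \<in> \<P> \<and> l \<in> pencil q \<alpha> u v)}"

definition R_reg :: "nat \<Rightarrow> 'a::field \<Rightarrow> 'a point set \<Rightarrow> 'a point set set" where
  "R_reg q \<eta> l = D_spread q \<eta> \<inter> line_spread_of q \<eta> l"

definition Pi_family ::
    "nat \<Rightarrow> 'a::field set \<Rightarrow> 'a set \<Rightarrow> 'a \<Rightarrow> ('a point \<times> 'a point set) set
       \<Rightarrow> 'a point set set set" where
  "Pi_family q \<Lambda> A \<eta> \<P> =
     {switch (baer q \<eta>) (line_spread_of q \<eta> l) (R_reg q \<eta> l) | l. l \<in> L_lines q \<Lambda> A \<P>}
     \<union> {D_spread q \<eta>}"

end

theory Submission
  imports Defs
begin

text \<open>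
  In the coordinates \<open>(x, y)\<close> of \<open>B = baer q \<eta>\<close>, points of \<open>B\<close> are vectors of \<open>K \<times> K\<close> up to scalars in the
  fixed field \<open>F\<close> of \<open>cj x = x ^ q\<close>, and the lines skew to the special line \<open>y = 0\<close> are the graphs
  \<open>x = m y + n cj y\<close>. The given spread consists of the graphs with \<open>n = 0\<close>, and its reguli through the special
  line are the affine \<open>F\<close>-lines \<open>c + F d\<close> of slopes. A regular spread is closed under reguli through its
  lines, so one containing such a regulus is an affine plane of graphs
  \<open>(c + d (t + s \<mu>), d s \<nu>)\<close> with \<open>s, t \<in> F\<close>, where \<open>(t + \<mu>) y + \<nu> cj y\<close> has no nontrivial zero. Solving an
  irreducible quadratic over \<open>F\<close> brings \<open>(\<mu>, \<nu>)\<close> into the form produced by a line of a pencil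
  \<open>p(P, \<pi>)\<close> for an \<open>\<alpha>\<close> of norm \<open>k\<close>, determined up to \<open>k \<mapsto> 1/k\<close>. Invariance under \<open>E\<close> makes the data depend
  only on the direction \<open>d\<close>, that is, on \<open>cj d / d\<close>; disjointness of the spreads then gives the conditions
  for a good set.
\<close>

section \<open>The field with \<open>q\<^sup>2\<close> elements\<close>

text \<open>The entries of a triple \<open>(\<alpha>, u, v)\<close> record three data of a direction
  \<open>d\<close>: the norm of \<open>\<alpha>\<close> is the \<open>k\<close> of the normal form;
  \<open>v\<close> is forced by \<open>\<kappa> = \<eta> * cj \<alpha> * cj v\<close>, where
  \<open>\<kappa>\<close> is an element of norm \<open>k\<close> read off from the spread; and
  \<open>u / v = cj d / d\<close>. By Hilbert 90 the quotients \<open>cj d / d\<close> fill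
  \<open>U\<close>, and two directions share one exactly when they differ by a factor in F: this is
  the origin of the number q + 1 of pairs. E acts on graphs by adding a constant to
  \<open>m\<close>, hence transitively on the reguli of one direction.

  The value k = 1 has to be avoided: for \<open>\<alpha>\<close> of norm 1 the point
  \<open>Ppt (\<alpha> * u)\<close> is fixed by \<open>tau\<close>, and 1 - k is the determinant of
  the elimination that produces the graphs. Since k and 1/k describe the same spreads, one member of
  each pair is enough, while -1, its own inverse, has to be added for odd q.\<close>

locale quadratic_field =
  fixes q :: nat and ty :: "'a::{field,finite} itself"
  assumes q_primepow: "primepow q" and q_ge3: "q \<ge> 3" and card_K: "CARD('a) = q ^ 2"
begin

definition cj :: "'a \<Rightarrow> 'a" where "cj x = x ^ q"

definition F :: "'a set" where "F = {x. cj x = x}"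

text \<open>Translation by 1 permutes the field and so preserves the sum of its elements; hence the
  characteristic divides the order.\<close>

lemma q_power_CHAR: "prime CHAR('a)" "\<exists>k>0. q = CHAR('a) ^ k"
proof -
  obtain p k where p: "prime p" "k > 0" "q = p ^ k"
    using q_primepow by (auto simp: primepow_def)
  have "(\<Sum>x\<in>UNIV. x) = (\<Sum>x\<in>UNIV. x + (1::'a))"
    by (rule sum.reindex_bij_witness[of _ "\<lambda>x. x + 1" "\<lambda>x. x - 1"]) auto
  then have "of_nat CARD('a) = (0::'a)" by (simp add: sum.distrib)
  then have "CHAR('a) dvd CARD('a)" by (simp only: of_nat_eq_0_iff_char_dvd)
  moreover show "prime CHAR('a)"
    by (intro prime_CHAR_semidom finite_imp_CHAR_pos) auto
  ultimately have "CHAR('a) = p"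
    using p by (metis card_K prime_dvd_power primes_dvd_imp_eq)
  then show "\<exists>k>0. q = CHAR('a) ^ k" using p by auto
qed

lemma two_eq_0_iff: "(2::'a) = 0 \<longleftrightarrow> even q"
proof -
  obtain k where k: "k > 0" "q = CHAR('a) ^ k" using q_power_CHAR by blast
  have "(2::'a) = 0 \<longleftrightarrow> CHAR('a) dvd 2"
    by (metis of_nat_eq_0_iff_char_dvd of_nat_numeral)
  also have "\<dots> \<longleftrightarrow> CHAR('a) = 2"
    using primes_dvd_imp_eq[OF q_power_CHAR(1) two_is_prime_nat] by auto
  also have "\<dots> \<longleftrightarrow> even q"
    using k q_power_CHAR(1) by (metis dvd_refl even_power primes_dvd_imp_eq two_is_prime_nat)
  finally show ?thesis .
qed

lemma cj_add [simp]: "cj (x + y) = cj x + cj y"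
  unfolding cj_def using q_power_CHAR by (auto intro: freshmans_dream')

lemma power_card: "(x :: 'a) ^ CARD('a) = x"
proof (cases "x = 0")
  case False
  have "(\<Prod>y\<in>UNIV-{0}. y) = (\<Prod>y\<in>UNIV-{0}. x * y)"
    by (rule prod.reindex_bij_witness[of _ "\<lambda>y. x * y" "\<lambda>y. y / x"]) (use False in auto)
  also have "\<dots> = x ^ (CARD('a) - 1) * (\<Prod>y\<in>UNIV-{0}. y)"
    by (simp add: prod.distrib)
  finally have "x ^ (CARD('a) - 1) = 1" by simp
  then show ?thesis
    by (metis One_nat_def Suc_pred finite_UNIV_card_ge_0 finite_class.finite_UNIV mult.right_neutral
        power_Suc)
qed (use q_ge3 in \<open>simp add: card_K\<close>)

lemma cj_mult [simp]: "cj (x * y) = cj x * cj y"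
  by (simp add: cj_def power_mult_distrib)

lemma cj_cj [simp]: "cj (cj x) = x"
proof -
  have "x ^ CARD('a) = x" by (rule power_card)
  then show ?thesis by (simp add: cj_def card_K power_mult[symmetric] power2_eq_square)
qed

lemma cj_0 [simp]: "cj 0 = 0" using q_ge3 by (simp add: cj_def)
lemma cj_1 [simp]: "cj 1 = 1" by (simp add: cj_def)

lemma cj_minus [simp]: "cj (- x) = - cj x"
  using cj_add[of x "- x"] by (simp del: cj_add add: eq_neg_iff_add_eq_0 add.commute)

lemma cj_diff [simp]: "cj (x - y) = cj x - cj y"
  using cj_add[of x "- y"] by (simp del: cj_add)

lemma cj_inverse [simp]: "cj (inverse x) = inverse (cj x)"
  by (simp add: cj_def power_inverse)

lemma cj_divide [simp]: "cj (x / y) = cj x / cj y"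
  by (simp add: divide_inverse)

lemma cj_eq_iff [simp]: "cj x = cj y \<longleftrightarrow> x = y"
  by (metis cj_cj)

lemma cj_eq_0_iff [simp]: "cj x = 0 \<longleftrightarrow> x = 0"
  by (metis cj_cj cj_0)

lemma norm_conv: "x ^ (q + 1) = x * cj x"
  by (simp add: cj_def)

lemma in_F: "x \<in> F \<longleftrightarrow> cj x = x" by (simp add: F_def)

lemma F_closed [simp]:
  "0 \<in> F" "1 \<in> F"
  "x \<in> F \<Longrightarrow> y \<in> F \<Longrightarrow> x + y \<in> F"
  "x \<in> F \<Longrightarrow> y \<in> F \<Longrightarrow> x - y \<in> F"
  "x \<in> F \<Longrightarrow> y \<in> F \<Longrightarrow> x * y \<in> F"
  "x \<in> F \<Longrightarrow> y \<in> F \<Longrightarrow> x / y \<in> F"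
  "x \<in> F \<Longrightarrow> - x \<in> F"
  "x \<in> F \<Longrightarrow> inverse x \<in> F"
  by (auto simp: F_def)

lemma norm_in_F [simp]: "x * cj x \<in> F" "cj x * x \<in> F" "x + cj x \<in> F" "cj x + x \<in> F"
  by (auto simp: F_def)

section \<open>Counting the fixed field and the elements of norm 1\<close>

lemma card_le_fibres:
  assumes "finite Z" "\<And>y. y \<in> f ` Z \<Longrightarrow> card {x \<in> Z. f x = y} \<le> n"
  shows "card Z \<le> n * card (f ` Z)"
proof -
  have "Z = (\<Union>y\<in>f ` Z. {x \<in> Z. f x = y})" by auto
  then have "card Z \<le> (\<Sum>y\<in>f ` Z. card {x \<in> Z. f x = y})"
    using card_UN_le[of "f ` Z" "\<lambda>y. {x \<in> Z. f x = y}"] assms(1) by auto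
  also have "\<dots> \<le> (\<Sum>y\<in>f ` Z. n)" using assms(2) by (rule sum_mono)
  finally show ?thesis by (simp add: mult.commute)
qed

text \<open>The first bound serves for the fixed elements of \<open>cj\<close>, the second for
  \<open>U\<close> and for the fibres of the norm and of \<open>cj x / x\<close>.\<close>

lemma card_roots_le:
  fixes c a :: 'a
  assumes "n > 0"
  shows "card {x. x ^ (n + 1) = a * x} \<le> n + 1" "card {x. x ^ n = a} \<le> n"
proof -
  let ?p = "monom 1 (n + 1) - monom a 1 :: 'a poly"
  have c: "coeff ?p (n + 1) = 1" using assms by simp
  have d: "degree ?p \<le> n + 1"
    by (rule degree_diff_le) (auto simp: degree_monom_eq intro: order.trans[OF degree_monom_le])
  have "?p \<noteq> 0" using c by (metis coeff_0 zero_neq_one)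
  then have "card {x. poly ?p x = 0} \<le> degree ?p" by (rule card_poly_roots_bound)
  then show "card {x. x ^ (n + 1) = a * x} \<le> n + 1" using d by (simp add: poly_monom)
  let ?p = "monom 1 n - monom a 0 :: 'a poly"
  have c: "coeff ?p n = 1" using assms by simp
  have d: "degree ?p \<le> n"
    by (rule degree_diff_le) (auto simp: degree_monom_eq intro: order.trans[OF degree_monom_le])
  have "?p \<noteq> 0" using c by (metis coeff_0 zero_neq_one)
  then have "card {x. poly ?p x = 0} \<le> degree ?p" by (rule card_poly_roots_bound)
  then show "card {x. x ^ n = a} \<le> n" using d by (simp add: poly_monom)
qed

abbreviation "U \<equiv> units1 q :: 'a set"

lemma in_U: "u \<in> U \<longleftrightarrow> u * cj u = 1"
  unfolding units1_def norm_conv by simp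

lemma card_units: "card (UNIV - {0::'a}) = q ^ 2 - 1"
  by (simp add: card_K card_Diff_subset)

lemma q2_minus_1: "q ^ 2 - 1 = (q - 1) * (q + 1)"
  by (simp add: power2_eq_square algebra_simps)

text \<open>Above, F is bounded as the root set of X^q - X. Below, the norm sends the q^2 - 1
  nonzero elements into \<open>F - {0}\<close> with fibres of at most q + 1 elements.\<close>

lemma card_F: "card F = q"
proof (rule antisym)
  have "F = {x. x ^ (q - 1 + 1) = 1 * x}" using q_ge3 by (auto simp: F_def cj_def)
  then show "card F \<le> q" using card_roots_le(1)[of "q - 1" 1] q_ge3 by simp
  let ?f = "\<lambda>x::'a. x * cj x"
  have "card (UNIV - {0::'a}) \<le> (q + 1) * card (?f ` (UNIV - {0}))"
  proof (rule card_le_fibres)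
    fix y :: 'a
    have "card {x \<in> UNIV - {0}. ?f x = y} \<le> card {x. x ^ (q + 1) = y}"
      by (rule card_mono) (auto simp: cj_def)
    then show "card {x \<in> UNIV - {0}. ?f x = y} \<le> q + 1"
      using card_roots_le(2)[of "q + 1" y] by simp
  qed simp
  also have "\<dots> \<le> (q + 1) * card (F - {0})"
    by (intro mult_left_mono card_mono) auto
  finally have "(q + 1) * (q - 1) \<le> (q + 1) * card (F - {0})"
    by (simp only: card_units q2_minus_1 mult.commute[of "q - 1"])
  then have "q - 1 \<le> card (F - {0})" by (simp only: mult_le_cancel1)
  then show "q \<le> card F" using card_Diff_singleton[of 0 F] q_ge3 by simp
qed

text \<open>The map \<open>cj x / x\<close> sends the nonzero elements into \<open>U\<close> with
  fibres of at most q - 1 elements, so its image has at least q + 1 elements, while \<open>U\<close>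
  has at most that many. Equality gives the order and surjectivity at once.\<close>

lemma card_U: "card U = q + 1" and hilbert90: "u \<in> U \<Longrightarrow> \<exists>x. x \<noteq> 0 \<and> cj x = u * x"
proof -
  let ?f = "\<lambda>x::'a. cj x / x"
  have le: "card U \<le> q + 1" using card_roots_le(2)[of "q + 1" 1] by (simp add: units1_def)
  have "card (UNIV - {0::'a}) \<le> (q - 1) * card (?f ` (UNIV - {0}))"
  proof (rule card_le_fibres)
    fix y :: 'a
    have "cj x / x = x ^ (q - 1)" if "x \<noteq> 0" for x :: 'a
      using that q_ge3 by (simp add: cj_def power_diff)
    then have "card {x \<in> UNIV - {0}. ?f x = y} \<le> card {x. x ^ (q - 1) = y}"
      by (intro card_mono) auto
    then show "card {x \<in> UNIV - {0}. ?f x = y} \<le> q - 1"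
      using card_roots_le(2)[of "q - 1" y] q_ge3 by simp
  qed simp
  then have "(q - 1) * (q + 1) \<le> (q - 1) * card (?f ` (UNIV - {0}))"
    by (simp only: card_units q2_minus_1)
  then have ge: "q + 1 \<le> card (?f ` (UNIV - {0}))"
    using q_ge3 by (simp only: mult_le_cancel1)
  have "cj x / x \<in> U" if "x \<noteq> 0" for x :: 'a using that by (simp add: in_U)
  then have sub: "?f ` (UNIV - {0}) \<subseteq> U" by blast
  then have "card (?f ` (UNIV - {0})) \<le> card U" by (intro card_mono) auto
  with le ge show "card U = q + 1" by simp
  have "?f ` (UNIV - {0}) = U" using sub le ge by (intro card_seteq) auto
  then obtain x where "u = cj x / x" "x \<noteq> 0" if "u \<in> U" using that by blast
  then show "\<exists>x. x \<noteq> 0 \<and> cj x = u * x" if "u \<in> U"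
    using that by (metis nonzero_divide_eq_eq)
qed

lemma ex_not_in_F: "\<exists>w. w \<notin> F"
proof (rule ccontr)
  assume "\<nexists>w. w \<notin> F"
  then have "F = UNIV" by auto
  then have "q = q ^ 2" using card_F card_K by simp
  then show False using q_ge3 by (simp add: power2_eq_square)
qed

lemma ex_F_not_01: "\<exists>t\<in>F. t \<noteq> 0 \<and> t \<noteq> 1"
proof (rule ccontr)
  assume "\<not> ?thesis"
  then have "F \<subseteq> {0, 1}" by auto
  then have "card F \<le> card {0, 1 :: 'a}" by (intro card_mono) auto
  then show False using q_ge3 card_F by simp
qed

section \<open>Linear algebra of the field over F\<close>

lemma anti_ratio_in_F:
  assumes "cj x = - x" "cj y = - y"
  shows "x / y \<in> F"
  using assms by (simp add: in_F)

text \<open>Here and below, \<open>x * cj y \<noteq> y * cj x\<close> expresses independence over F: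
  the difference of the two sides is the determinant of z = a x + b y together with its conjugate.
  In Cramer's rule all determinants change sign under \<open>cj\<close>, so their quotients lie in
  F.\<close>

lemma coordinates:
  assumes "x * cj y \<noteq> y * cj x"
  shows "\<exists>a\<in>F. \<exists>b\<in>F. z = a * x + b * y"
proof (intro bexI)
  let ?d = "x * cj y - y * cj x"
  have "?d * z = (z * cj y - y * cj z) * x + (x * cj z - z * cj x) * y"
    by (simp add: algebra_simps)
  then have "?d * z / ?d = (z * cj y - y * cj z) / ?d * x + (x * cj z - z * cj x) / ?d * y"
    by (simp add: add_divide_distrib)
  then show "z = (z * cj y - y * cj z) / ?d * x + (x * cj z - z * cj x) / ?d * y"
    using assms by simp
qed (auto intro!: anti_ratio_in_F)

lemma dependent_imp_ratio:
  assumes "x * cj y = y * cj x" "y \<noteq> 0"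
  shows "x / y \<in> F"
  using assms by (auto simp: in_F divide_simps mult.commute)

lemma ratio_imp_dependent:
  assumes "t \<in> F" shows "t * y * cj y = y * cj (t * y)" 
  using assms by (simp add: in_F)

lemma unique_coordinates:
  assumes "x * cj y \<noteq> y * cj x" "a * x + b * y = a' * x + b' * y"
    "a \<in> F" "b \<in> F" "a' \<in> F" "b' \<in> F"
  shows "a = a'" "b = b'"
proof -
  have e: "(a - a') * x = (b' - b) * y" using assms(2) by (simp add: algebra_simps)
  have f: "(a - a') * cj x = (b' - b) * cj y"
    using arg_cong[OF e, of cj] assms(3-) by (simp add: in_F)
  have "(a - a') * (x * cj y - y * cj x) = ((a - a') * x) * cj y - y * ((a - a') * cj x)"
    by (simp add: algebra_simps)
  also have "\<dots> = 0" unfolding e f by simp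
  finally show "a = a'" using assms(1) by simp
  have "(b' - b) * (x * cj y - y * cj x) = x * ((b' - b) * cj y) - ((b' - b) * y) * cj x"
    by (simp add: algebra_simps)
  also have "\<dots> = 0" unfolding e[symmetric] f[symmetric] by simp
  finally show "b = b'" using assms(1) by simp
qed

text \<open>
  Counting: \<open>z \<mapsto> z (a - z)\<close> maps the set of all \<open>z\<close> that lie in \<open>F\<close> or have trace \<open>a\<close> into \<open>F\<close>
  with fibres \<open>{z, a - z}\<close>, and that set is too large for a value to be missed.
\<close>

lemma irreducible_quadratic_splits:
  assumes "a \<in> F" "b \<in> F" "\<And>x. x \<in> F \<Longrightarrow> x * (a - x) \<noteq> b"
  shows "\<exists>z. z \<notin> F \<and> z + cj z = a \<and> z * cj z = b"
proof -
  define f where "f z = z * (a - z)" for z :: 'a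
  define T where "T = {z. z + cj z = a}"
  obtain w where w: "w \<notin> F" using ex_not_in_F by blast
  define e where "e = w - cj w"
  have e: "e \<noteq> 0" "cj e = - e" using w by (auto simp: e_def in_F)
  \<comment> \<open>\<open>z0\<close> has trace a; adding F-multiples of \<open>e\<close>, which has
    trace 0, gives q elements of \<open>T\<close>.\<close>
  define z0 where "z0 = - a * cj w / e"
  have "cj z0 = a * w / e" using e(2) assms(1) by (simp add: z0_def in_F)
  then have "z0 + cj z0 = a * e / e"
    by (simp add: z0_def e_def right_diff_distrib flip: diff_divide_distrib add_divide_distrib)
  then have z0: "z0 + cj z0 = a" using e(1) by simp
  have "(\<lambda>t. z0 + t * e) ` F \<subseteq> T"
  proof clarify
    fix t assume "t \<in> F"
    then have "z0 + t * e + cj (z0 + t * e) = z0 + cj z0" using e by (simp add: in_F)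
    then show "z0 + t * e \<in> T" using z0 by (simp add: T_def)
  qed
  then have "card ((\<lambda>t. z0 + t * e) ` F) \<le> card T" by (intro card_mono) auto
  moreover have "inj_on (\<lambda>t. z0 + t * e) F" using e by (auto simp: inj_on_def)
  ultimately have cT: "q \<le> card T" by (simp add: card_image card_F)
  have f_eq: "f z = f z' \<longleftrightarrow> z' = z \<or> z' = a - z" for z z'
  proof -
    have "f z = f z' \<longleftrightarrow> (z - z') * (z' - (a - z)) = 0" by (auto simp: f_def algebra_simps)
    then show ?thesis by auto
  qed
  have f_F: "f ` (F \<union> T) \<subseteq> F"
  proof -
    have "f z \<in> F" if "z \<in> T" for z
    proof -
      have "a - z = cj z" using that by (auto simp: T_def)
      then show ?thesis by (simp add: f_def)
    qed
    then show ?thesis using assms(1) by (auto simp: f_def)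
  qed
  have "f ` (F \<union> T) = F"
  \<comment> \<open>If 2 = 0 and a = 0, then \<open>T\<close> is F itself and the union is no larger
    than F; but then the fibres {z, -z} of \<open>f\<close> are single points.\<close>
  proof (cases "(2::'a) = 0 \<and> a = 0")
    case True
    have "inj_on f F"
    proof (rule inj_onI)
      fix x y assume "f x = f y"
      then have "y = x \<or> y = - x" using f_eq True by auto
      moreover have "- x = x" using True mult_2[of x] by (simp add: minus_unique)
      ultimately show "x = y" by auto
    qed
    then have "card (f ` F) = q" by (simp add: card_image card_F)
    moreover have "card (f ` F) \<le> card (f ` (F \<union> T))" by (intro card_mono) auto
    ultimately show ?thesis using f_F card_F by (intro card_seteq) auto
  next
    case False
    have "F \<inter> T \<subseteq> {a / 2}"
    proof
      fix z assume "z \<in> F \<inter> T"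
      then have "a = z * 2" unfolding mult_2_right by (auto simp: T_def in_F)
      moreover from this have "(2::'a) \<noteq> 0" using False by auto
      ultimately show "z \<in> {a / 2}" by simp
    qed
    \<comment> \<open>With at most one common element the union has at least 2q - 1 elements, so
      fibres of at most two elements leave at least q values.\<close>
    then have "card (F \<inter> T) \<le> card {a / 2}" by (intro card_mono) auto
    then have "2 * q - 1 \<le> card (F \<union> T)"
      using card_Un_Int[of F T] cT card_F by simp
    moreover have "card (F \<union> T) \<le> 2 * card (f ` (F \<union> T))"
    proof (rule card_le_fibres)
      fix y assume "y \<in> f ` (F \<union> T)"
      then obtain z where "y = f z" by auto
      then have "{x \<in> F \<union> T. f x = y} \<subseteq> {z, a - z}" using f_eq by auto
      then have "card {x \<in> F \<union> T. f x = y} \<le> card {z, a - z}" by (intro card_mono) auto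
      also have "\<dots> \<le> 2" by (simp add: card_insert_if)
      finally show "card {x \<in> F \<union> T. f x = y} \<le> 2" .
    qed simp
    ultimately have "card F \<le> card (f ` (F \<union> T))" using card_F by simp
    then show ?thesis using f_F by (intro card_seteq) auto
  qed
  then obtain z where z: "z \<in> F \<union> T" "b = f z" using assms(2) by (metis imageE)
  then have "z \<notin> F" using assms(3) by (auto simp: f_def)
  moreover from this have "z + cj z = a" using z by (auto simp: T_def)
  moreover from this have "z * cj z = b" using z by (auto simp: f_def)
  ultimately show ?thesis by blast
qed

text \<open>These are the coefficients, up to the offset \<open>c\<close> and the factor
  \<open>d\<close>, of the graph with parameter \<open>w\<close> in the spread \<open>SG\<close> of
  a pencil line.\<close>

definition normal_form :: "'a \<Rightarrow> 'a \<Rightarrow> 'a \<Rightarrow> bool" where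
  "normal_form \<mu> \<nu> k \<longleftrightarrow> (\<exists>\<kappa> w. \<kappa> * cj \<kappa> = k \<and>
     \<mu> = (w - k * cj w) / (1 - k) \<and> \<nu> = \<kappa> * (cj w - w) / (1 - k))"

lemma normal_form_ratio:
  assumes j: "j \<in> F" "j \<noteq> 0" "j \<noteq> 1" "1 - j \<noteq> j"
    and N: "\<nu> * cj \<nu> = j * (1 - j) * ((cj \<mu> - \<mu>) * cj (cj \<mu> - \<mu>))" and \<mu>: "cj \<mu> \<noteq> \<mu>"
  shows "normal_form \<mu> \<nu> (j / (1 - j))"
proof -
  define D where "D = cj \<mu> - \<mu>"
  have D: "D \<noteq> 0" "cj D = - D" "cj \<mu> = \<mu> + D" using \<mu> by (auto simp: D_def)
  define k where "k = j / (1 - j)"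
  \<comment> \<open>Both witnesses are forced: the required form of \<open>\<mu>\<close> gives D =
    (1 + k) (cj w - w) / (1 - k), and with 1 + k = 1 / (1 - j) this yields w - \<open>\<mu>\<close>
    = j D and \<open>\<nu>\<close> = \<open>\<kappa>\<close> (1 - j) D.\<close>
  define w where "w = \<mu> + j * D"
  define \<kappa> where "\<kappa> = \<nu> / ((1 - j) * D)"
  have j1: "1 - j \<noteq> 0" "1 - j - j \<noteq> 0" using j by auto
  have kj: "k * (1 - j) = j" using j1 by (simp add: k_def)
  have k1: "1 - k = (1 - j - j) / (1 - j)" using j1 by (simp add: k_def divide_simps)
  then have k1': "1 - k \<noteq> 0" using j1 by simp
  have cjj: "cj j = j" using j(1) by (simp add: in_F)
  have cw: "cj w = \<mu> + (1 - j) * D" by (simp add: w_def D cjj algebra_simps)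
  have "\<kappa> * cj \<kappa> = (\<nu> * cj \<nu>) / ((1 - j) * (1 - j) * (D * cj D))"
    unfolding \<kappa>_def by (simp add: cjj mult_ac)
  also have "\<dots> = (j * (1 - j) * (D * cj D)) / ((1 - j) * (1 - j) * (D * cj D))"
    unfolding N D_def ..
  also have "\<dots> = k" using D(1) j1 by (simp add: k_def)
  finally have "\<kappa> * cj \<kappa> = k" .
  moreover have "w - k * cj w = (1 - k) * \<mu>"
  proof -
    have "w - k * cj w = \<mu> + j * D - k * \<mu> - (k * (1 - j)) * D"
      unfolding cw by (simp add: w_def algebra_simps)
    also have "\<dots> = (1 - k) * \<mu>" unfolding kj by (simp add: algebra_simps)
    finally show ?thesis .
  qed
  then have "\<mu> = (w - k * cj w) / (1 - k)" using k1' by simp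
  moreover have "\<nu> = \<kappa> * (cj w - w) / (1 - k)"
  proof -
    have "cj w - w = (1 - j - j) * D" unfolding cw by (simp add: w_def algebra_simps)
    then show ?thesis unfolding k1 \<kappa>_def using D(1) j1 by simp
  qed
  ultimately show ?thesis unfolding normal_form_def k_def by blast
qed

text \<open>
  With \<open>z \<notin> F\<close> a root of \<open>X\<^sup>2 - (\<mu> + cj \<mu>) X + N \<mu> - N \<nu>\<close>, the ratio \<open>j = (z - \<mu>) / (cj \<mu> - \<mu>)\<close>
  lies in \<open>F\<close>; exchanging \<open>z\<close> and \<open>cj z\<close> replaces \<open>j\<close> by \<open>1 - j\<close> and \<open>k = j / (1 - j)\<close> by its inverse.
\<close>

lemma normal_form_exists:
  assumes \<nu>: "\<nu> \<noteq> 0" and N: "\<And>t. t \<in> F \<Longrightarrow> (\<mu> + t) * cj (\<mu> + t) \<noteq> \<nu> * cj \<nu>"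
  obtains k where "k \<in> F" "k \<noteq> 0" "k \<noteq> 1" "k = - 1 \<Longrightarrow> odd q"
    "normal_form \<mu> \<nu> k" "normal_form \<mu> \<nu> (inverse k)"
proof -
  define a where "a = \<mu> + cj \<mu>"
  define b where "b = \<mu> * cj \<mu> - \<nu> * cj \<nu>"
  have "\<exists>z. z \<notin> F \<and> z + cj z = a \<and> z * cj z = b"
  proof (rule irreducible_quadratic_splits)
    \<comment> \<open>The value of X^2 - a X + b at x is the norm of \<open>\<mu> - x\<close> minus
      the norm of \<open>\<nu>\<close>, so the hypothesis excludes roots in F.\<close>
    fix x assume x: "x \<in> F"
    then have "(\<mu> + (- x)) * cj (\<mu> + (- x)) = \<mu> * cj \<mu> - x * (a - x)"
      by (simp add: a_def in_F algebra_simps)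
    then have "\<mu> * cj \<mu> - x * (a - x) \<noteq> \<nu> * cj \<nu>" using N[of "- x"] x by simp
    then show "x * (a - x) \<noteq> b" by (auto simp: b_def)
  qed (simp_all add: a_def b_def)
  then obtain z where z: "z \<notin> F" "z + cj z = a" "z * cj z = b" by blast
  have cz: "cj z = a - z" "cj \<mu> = a - \<mu>" using z(2) by (simp_all add: a_def eq_diff_eq add.commute)
  \<comment> \<open>\<open>z\<close> and \<open>\<mu>\<close> have the same trace, so
    \<open>e\<close> has trace 0, as has the \<open>D\<close> below; their quotient therefore lies
    in F.\<close>
  define e where "e = z - \<mu>"
  have e: "z = \<mu> + e" "cj e = - e" using cz by (simp_all add: e_def)
  show ?thesis
  proof (cases "cj \<mu> = \<mu>")
    case False
    define D where "D = cj \<mu> - \<mu>"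
    have D: "D \<noteq> 0" "cj D = - D" "cj \<mu> = \<mu> + D" using False by (auto simp: D_def)
    define j where "j = e / D"
    have j: "j \<in> F" unfolding j_def using e(2) D(2) by (rule anti_ratio_in_F)
    then have cjj: "cj j = j" by (simp add: in_F)
    have zj: "z = \<mu> + j * D" using D(1) e(1) by (simp add: j_def)
    have "\<nu> * cj \<nu> = \<mu> * cj \<mu> - z * cj z" using z(3) by (simp add: b_def)
    also have "\<dots> = j * (1 - j) * (D * cj D)"
      unfolding zj by (simp add: D cjj algebra_simps)
    finally have Nj: "\<nu> * cj \<nu> = j * (1 - j) * (D * cj D)" .
    have j01: "j \<noteq> 0" "j \<noteq> 1" using Nj \<nu> by auto
    have j2: "1 - j \<noteq> j"
    proof
      assume "1 - j = j"
      moreover have "cj z = \<mu> + (1 - j) * D" unfolding zj by (simp add: D cjj algebra_simps)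
      ultimately have "cj z = z" using zj by simp
      then show False using z(1) by (simp add: in_F)
    qed
    have "normal_form \<mu> \<nu> (j / (1 - j))"
      using j j01 j2 Nj False unfolding D_def by (intro normal_form_ratio)
    moreover have "normal_form \<mu> \<nu> ((1 - j) / (1 - (1 - j)))"
      using j j01 j2 Nj False unfolding D_def by (intro normal_form_ratio) (auto simp: mult.commute)
    then have "normal_form \<mu> \<nu> (inverse (j / (1 - j)))" by simp
    moreover have "j / (1 - j) \<in> F" "j / (1 - j) \<noteq> 0" "j / (1 - j) \<noteq> 1" "j / (1 - j) \<noteq> - 1"
      using j j01 j2 by (auto simp: divide_eq_eq)
    ultimately show ?thesis using that by blast
  next
    \<comment> \<open>With \<open>\<mu>\<close> in F the ratio j would have denominator 0. Now k =
      -1 works with w = \<open>\<mu>\<close> - e, an element of trace 2 \<open>\<mu>\<close>; here 2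
      is nonzero, since e = -e would put \<open>z\<close> into F.\<close>
    case True
    have "e \<noteq> 0" using e z(1) True by (auto simp: in_F)
    have "cj z = \<mu> - e" using e True by simp
    have ee: "e \<noteq> - e" 
    proof
      assume "e = - e"
      then have "cj z = z" using e True by simp
      then show False using z(1) by (simp add: in_F)
    qed
    then have two: "(2::'a) \<noteq> 0" by (metis add.inverse_unique mult_2 mult_zero_left)
    then have "odd q" using two_eq_0_iff by simp
    have ee2: "e * e = \<nu> * cj \<nu>"
    proof -
      have "(\<mu> + e) * (\<mu> - e) = \<mu> * \<mu> - \<nu> * cj \<nu>"
        using z(3) \<open>cj z = \<mu> - e\<close> e(1) True by (simp add: b_def)
      then show ?thesis by (simp add: algebra_simps)
    qed
    have "normal_form \<mu> \<nu> (- 1)" unfolding normal_form_def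
    proof (intro exI conjI)
      have "(\<nu> / e) * cj (\<nu> / e) = - (\<nu> * cj \<nu>) / (e * e)" by (simp add: e(2))
      also have "\<dots> = - 1" unfolding ee2[symmetric] using \<open>e \<noteq> 0\<close> by simp
      finally show "(\<nu> / e) * cj (\<nu> / e) = - 1" .
      have c: "cj (\<mu> - e) = \<mu> + e" by (simp add: True e(2))
      have "(\<mu> - e - - 1 * cj (\<mu> - e)) = 2 * \<mu>" "cj (\<mu> - e) - (\<mu> - e) = 2 * e" 
        unfolding c by (simp_all add: algebra_simps)
      then show "\<mu> = (\<mu> - e - - 1 * cj (\<mu> - e)) / (1 - - 1)"
        "\<nu> = (\<nu> / e) * (cj (\<mu> - e) - (\<mu> - e)) / (1 - - 1)"
        using two \<open>e \<noteq> 0\<close> by (simp_all only:) simp_all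
    qed
    moreover have "(- 1 :: 'a) \<noteq> 1" using two by (metis add.right_inverse one_add_one)
    ultimately show ?thesis using that[of "- 1"] \<open>odd q\<close> by simp
  qed
qed

end

section \<open>Points and lines in homogeneous coordinates\<close>

lemma vector_4_nth [simp]:
  "(vector [a, b, c, d] :: 'a::zero ^ 4) $ 1 = a"
  "(vector [a, b, c, d] :: 'a ^ 4) $ 2 = b"
  "(vector [a, b, c, d] :: 'a ^ 4) $ 3 = c"
  "(vector [a, b, c, d] :: 'a ^ 4) $ 4 = d"
  by (auto simp: vector_def)

lemma vec4_eq_iff:
  fixes x y :: "'a ^ 4"
  shows "x = y \<longleftrightarrow> x $ 1 = y $ 1 \<and> x $ 2 = y $ 2 \<and> x $ 3 = y $ 3 \<and> x $ 4 = y $ 4"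
  by (simp add: vec_eq_iff forall_4)

lemma mem_pt:
  "x \<in> pt a b c d \<longleftrightarrow> (\<exists>k. x $ 1 = k * a \<and> x $ 2 = k * b \<and> x $ 3 = k * c \<and> x $ 4 = k * d)"
  by (simp add: pt_def vec.span_singleton image_iff vec4_eq_iff)

lemma span_eq_pt: "vec.span {x} = pt (x $ 1) (x $ 2) (x $ 3) (x $ 4)" for x :: "'a::field ^ 4"
proof -
  have "vector [x $ 1, x $ 2, x $ 3, x $ 4] = x" by (simp add: vec4_eq_iff)
  then show ?thesis by (simp add: pt_def)
qed

lemma pt_in_points: "pt a b c d \<in> points \<longleftrightarrow> (a, b, c, d) \<noteq> (0, 0, 0, 0)"
proof
  assume "pt a b c d \<in> points"
  then obtain x where x: "pt a b c d = vec.span {x}" "x \<noteq> 0" by (auto simp: points_def)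
  then have "x \<in> pt a b c d" by (simp add: vec.span_base)
  then show "(a, b, c, d) \<noteq> (0, 0, 0, 0)" using x(2) by (auto simp: mem_pt vec4_eq_iff)
next
  assume "(a, b, c, d) \<noteq> (0, 0, 0, 0)"
  then have "vector [a, b, c, d] \<noteq> (0 :: 'a ^ 4)" by (auto simp: vec4_eq_iff)
  then show "pt a b c d \<in> points" by (auto simp: points_def pt_def)
qed

lemma points_cases:
  assumes "P \<in> points"
  obtains a b c d where "P = pt a b c d" "(a, b, c, d) \<noteq> (0, 0, 0, 0)"
  using assms by (auto simp: points_def span_eq_pt vec4_eq_iff)

lemma pt_eq_iff:
  assumes "(a, b, c, d) \<noteq> (0, 0, 0, 0)"
  shows "pt a b c d = pt a' b' c' d' \<longleftrightarrow>
    (\<exists>k. k \<noteq> 0 \<and> a' = k * a \<and> b' = k * b \<and> c' = k * c \<and> d' = k * d)"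
proof
  assume eq: "pt a b c d = pt a' b' c' d'"
  have "vector [a, b, c, d] \<in> pt a' b' c' d'"
    unfolding eq[symmetric] by (auto simp: mem_pt intro: exI[of _ 1])
  then obtain k where k: "a = k * a'" "b = k * b'" "c = k * c'" "d = k * d'"
    by (auto simp: mem_pt)
  then have "k \<noteq> 0" using assms by auto
  then show "\<exists>k. k \<noteq> 0 \<and> a' = k * a \<and> b' = k * b \<and> c' = k * c \<and> d' = k * d"
    using k by (intro exI[of _ "inverse k"]) simp
next
  assume "\<exists>k. k \<noteq> 0 \<and> a' = k * a \<and> b' = k * b \<and> c' = k * c \<and> d' = k * d"
  then obtain k where k: "k \<noteq> 0" "a' = k * a" "b' = k * b" "c' = k * c" "d' = k * d" by auto
  have scale: "(\<exists>l. P l) \<longleftrightarrow> (\<exists>l. P (l * k))" for P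
    using k(1) by (metis nonzero_divide_eq_eq)
  then show "pt a b c d = pt a' b' c' d'"
    unfolding set_eq_iff mem_pt k mult.assoc[symmetric] by (intro allI) (rule scale)
qed

lemma pt_subset_span_iff:
  "pt a b c d \<subseteq> vec.span (pt a1 b1 c1 d1 \<union> pt a2 b2 c2 d2) \<longleftrightarrow>
    (\<exists>l k. a = l * a1 + k * a2 \<and> b = l * b1 + k * b2 \<and> c = l * c1 + k * c2 \<and> d = l * d1 + k * d2)"
    (is "_ \<subseteq> vec.span (?P \<union> ?Q) \<longleftrightarrow> ?R")
proof -
  let ?v = "vector [a, b, c, d] :: 'a ^ 4"
  have "pt a b c d \<subseteq> vec.span (?P \<union> ?Q) \<longleftrightarrow> ?v \<in> vec.span (?P \<union> ?Q)"
  proof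
    assume "?v \<in> vec.span (?P \<union> ?Q)"
    then show "pt a b c d \<subseteq> vec.span (?P \<union> ?Q)"
      unfolding pt_def by (intro vec.span_minimal) auto
  qed (auto simp: pt_def vec.span_base)
  also have "\<dots> \<longleftrightarrow> (\<exists>x\<in>?P. \<exists>y\<in>?Q. ?v = x + y)"
    unfolding vec.span_Un by (auto simp: pt_def vec.span_span)
  also have "\<dots> \<longleftrightarrow> ?R"
    unfolding pt_def vec.span_singleton by (auto simp: vec4_eq_iff)
  finally show ?thesis .
qed

lemma pt_in_join:
  "pt a b c d \<in> join (pt a1 b1 c1 d1) (pt a2 b2 c2 d2) \<longleftrightarrow> (a, b, c, d) \<noteq> (0, 0, 0, 0) \<and>
    (\<exists>l k. a = l * a1 + k * a2 \<and> b = l * b1 + k * b2 \<and> c = l * c1 + k * c2 \<and> d = l * d1 + k * d2)"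
  unfolding join_def mem_Collect_eq pt_subset_span_iff pt_in_points ..

lemma join_points: "R \<in> join P Q \<Longrightarrow> R \<in> points"
  by (simp add: join_def)

lemma points_in_join: "P \<in> points \<Longrightarrow> P \<in> join P Q" "Q \<in> points \<Longrightarrow> Q \<in> join P Q"
  using vec.span_superset[of "P \<union> Q"] by (auto simp: join_def)

lemma join_subset_join:
  assumes "P \<in> join P' Q'" "Q \<in> join P' Q'"
  shows "join P Q \<subseteq> join P' Q'"
proof -
  have "vec.span (P \<union> Q) \<subseteq> vec.span (P' \<union> Q')"
    using assms by (intro vec.span_minimal) (auto simp: join_def)
  then show ?thesis by (auto simp: join_def)
qed

text \<open>If the coefficients of \<open>P\<close>, \<open>Q\<close> with respect to
  \<open>P'\<close>, \<open>Q'\<close> had determinant \<open>D = 0\<close>, they would be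
  proportional and \<open>P = Q\<close>. Otherwise the 2 by 2 matrix can be inverted, which puts
  \<open>P'\<close> and \<open>Q'\<close> on the line through \<open>P\<close> and
  \<open>Q\<close>.\<close>

lemma join_eq_join:
  assumes "P' \<in> points" "Q' \<in> points" "P \<in> join P' Q'" "Q \<in> join P' Q'" "P \<noteq> Q"
  shows "join P Q = join P' Q'"
proof
  show "join P Q \<subseteq> join P' Q'" using assms by (intro join_subset_join)
  obtain a1 b1 c1 d1 where P': "P' = pt a1 b1 c1 d1" "(a1, b1, c1, d1) \<noteq> (0, 0, 0, 0)"
    using assms(1) by (rule points_cases)
  obtain a2 b2 c2 d2 where Q': "Q' = pt a2 b2 c2 d2" "(a2, b2, c2, d2) \<noteq> (0, 0, 0, 0)"
    using assms(2) by (rule points_cases)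
  obtain a b c d where P: "P = pt a b c d" "(a, b, c, d) \<noteq> (0, 0, 0, 0)"
    using assms(3) join_points points_cases by metis
  obtain a' b' c' d' where Q: "Q = pt a' b' c' d'" "(a', b', c', d') \<noteq> (0, 0, 0, 0)"
    using assms(4) join_points points_cases by metis
  obtain l k where lk: "a = l * a1 + k * a2" "b = l * b1 + k * b2" "c = l * c1 + k * c2" 
    "d = l * d1 + k * d2"
    using assms(3) unfolding P P' Q' pt_in_join by auto
  obtain l' k' where lk': "a' = l' * a1 + k' * a2" "b' = l' * b1 + k' * b2"
    "c' = l' * c1 + k' * c2" "d' = l' * d1 + k' * d2"
    using assms(4) unfolding Q P' Q' pt_in_join by auto
  define D where "D = l * k' - l' * k"
  have "D \<noteq> 0"
  proof
    assume D: "D = 0"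
    have lk0: "l \<noteq> 0 \<or> k \<noteq> 0" using P lk by auto
    have lk0': "l' \<noteq> 0 \<or> k' \<noteq> 0" using Q lk' by auto
    have "\<exists>t. t \<noteq> 0 \<and> l' = t * l \<and> k' = t * k"
    proof (cases "l = 0")
      case True
      then show ?thesis using D lk0 lk0'
        by (intro exI[of _ "k' / k"]) (auto simp: D_def)
    next
      case False
      then have "k' = l' / l * k" using D by (simp add: D_def field_simps)
      then show ?thesis using False lk0' by (intro exI[of _ "l' / l"]) auto
    qed
    then obtain t where "t \<noteq> 0" "l' = t * l" "k' = t * k" by blast
    then have "P = Q" unfolding P Q using P(2) 
      by (subst pt_eq_iff) (auto simp: lk lk' algebra_simps)
    then show False using assms(5) by simp
  qed
  have inv: "(k' / D) * (l * x + k * y) + (- k / D) * (l' * x + k' * y) = x"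
    "(- l' / D) * (l * x + k * y) + (l / D) * (l' * x + k' * y) = y" for x y
  proof -
    have "k' * (l * x + k * y) - k * (l' * x + k' * y) = D * x"
      "l * (l' * x + k' * y) - l' * (l * x + k * y) = D * y" by (simp_all add: D_def algebra_simps)
    then show "(k' / D) * (l * x + k * y) + (- k / D) * (l' * x + k' * y) = x"
      "(- l' / D) * (l * x + k * y) + (l / D) * (l' * x + k' * y) = y"
      using \<open>D \<noteq> 0\<close> by (simp_all add: field_simps)
  qed
  have "P' \<in> join P Q"
    unfolding P Q P' pt_in_join using P'(2)
    by (intro conjI, simp)
      (rule exI[of _ "k' / D"], rule exI[of _ "- k / D"], simp only: lk lk' inv simp_thms)
  moreover have "Q' \<in> join P Q"
    unfolding P Q Q' pt_in_join using Q'(2)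
    by (intro conjI, simp)
      (rule exI[of _ "- l' / D"], rule exI[of _ "l / D"], simp only: lk lk' inv simp_thms)
  ultimately show "join P' Q' \<subseteq> join P Q" by (intro join_subset_join)
qed

section \<open>Lines of the Baer subgeometry\<close>

locale baer_space = quadratic_field q ty for q :: nat and ty :: "'a::{field,finite} itself" +
  fixes \<eta> :: 'a
  assumes eta_in_U: "\<eta> \<in> units1 q"
begin

lemma eta_norm: "\<eta> * cj \<eta> = 1" "cj \<eta> * \<eta> = 1"
  using eta_in_U by (simp_all add: in_U mult.commute)

lemma eta_nz [simp]: "\<eta> \<noteq> 0"
  using eta_norm by auto

abbreviation B :: "'a point set" where "B \<equiv> baer q \<eta>"

text \<open>The pair (0, 0) yields the zero subspace, which is not a point; this is why
  \<open>pp\<close> removes it.\<close>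

definition emb :: "'a \<times> 'a \<Rightarrow> 'a point" where
  "emb v = pt (fst v) (snd v) (\<eta> * cj (fst v)) (\<eta> * cj (snd v))"

definition pp :: "('a \<times> 'a) set \<Rightarrow> 'a point set" where
  "pp V = emb ` (V - {(0, 0)})"

text \<open>A pair represents its point only up to a factor in F; for sets closed under such
  factors, membership does not depend on the representative.\<close>

definition scaled :: "('a \<times> 'a) set \<Rightarrow> bool" where
  "scaled V \<longleftrightarrow> (\<forall>t\<in>F. \<forall>x y. (x, y) \<in> V \<longrightarrow> (t * x, t * y) \<in> V)"

lemma B_eq: "B = pp UNIV"
proof -
  have "B = {emb (x, y) | x y. (x, y) \<noteq> (0, 0)}" by (simp add: baer_def emb_def cj_def)
  also have "\<dots> = pp UNIV" by (force simp: pp_def)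
  finally show ?thesis .
qed

lemma emb_eq_iff:
  assumes "(x, y) \<noteq> (0, 0)"
  shows "emb (x, y) = emb (z, w) \<longleftrightarrow> (\<exists>t\<in>F. t \<noteq> 0 \<and> z = t * x \<and> w = t * y)"
proof -
  have "emb (x, y) = emb (z, w) \<longleftrightarrow>
    (\<exists>k. k \<noteq> 0 \<and> z = k * x \<and> w = k * y \<and> \<eta> * cj z = k * (\<eta> * cj x) \<and> \<eta> * cj w = k * (\<eta> * cj y))"
    unfolding emb_def by (subst pt_eq_iff) (use assms in auto)
  also have "\<dots> \<longleftrightarrow> (\<exists>t\<in>F. t \<noteq> 0 \<and> z = t * x \<and> w = t * y)"
    using assms by (auto simp: in_F)
  finally show ?thesis .
qed

lemma emb_in_pp:
  assumes "scaled V" "(x, y) \<noteq> (0, 0)"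
  shows "emb (x, y) \<in> pp V \<longleftrightarrow> (x, y) \<in> V"
proof
  assume "emb (x, y) \<in> pp V"
  then obtain z w where zw: "(z, w) \<in> V" "(z, w) \<noteq> (0, 0)" "emb (z, w) = emb (x, y)"
    by (auto simp: pp_def)
  then show "(x, y) \<in> V" using assms(1) by (auto simp: emb_eq_iff scaled_def)
next
  assume "(x, y) \<in> V"
  then show "emb (x, y) \<in> pp V" using assms(2) by (auto simp: pp_def)
qed

lemma pp_cases:
  assumes "P \<in> pp V"
  obtains x y where "P = emb (x, y)" "(x, y) \<in> V" "(x, y) \<noteq> (0, 0)"
  using assms by (auto simp: pp_def)

lemma pp_subset_B: "pp V \<subseteq> B"
  by (auto simp: B_eq pp_def)

lemma pp_Int_ne:
  assumes "scaled V" "scaled W"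
  shows "pp V \<inter> pp W \<noteq> {} \<longleftrightarrow> (\<exists>x y. (x, y) \<noteq> (0, 0) \<and> (x, y) \<in> V \<and> (x, y) \<in> W)"
proof
  assume "pp V \<inter> pp W \<noteq> {}"
  then obtain P where P: "P \<in> pp V" "P \<in> pp W" by blast
  from P(1) obtain x y where "P = emb (x, y)" "(x, y) \<in> V" "(x, y) \<noteq> (0, 0)" by (rule pp_cases)
  then show "\<exists>x y. (x, y) \<noteq> (0, 0) \<and> (x, y) \<in> V \<and> (x, y) \<in> W"
    using P(2) assms(2) emb_in_pp by blast
next
  assume "\<exists>x y. (x, y) \<noteq> (0, 0) \<and> (x, y) \<in> V \<and> (x, y) \<in> W"
  then show "pp V \<inter> pp W \<noteq> {}" by (force simp: pp_def)
qed

definition sp :: "'a \<Rightarrow> 'a \<Rightarrow> 'a \<Rightarrow> 'a \<Rightarrow> ('a \<times> 'a) set" where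
  "sp x y z w = {(a * x + b * z, a * y + b * w) | a b. a \<in> F \<and> b \<in> F}"

lemma in_sp:
  "(X, Y) \<in> sp x y z w \<longleftrightarrow> (\<exists>a\<in>F. \<exists>b\<in>F. X = a * x + b * z \<and> Y = a * y + b * w)"
  by (auto simp: sp_def)

lemma scaled_sp: "scaled (sp x y z w)"
  unfolding scaled_def
proof (intro ballI allI impI)
  fix t X Y assume t: "t \<in> F" and "(X, Y) \<in> sp x y z w"
  then obtain a b where "a \<in> F" "b \<in> F" "X = a * x + b * z" "Y = a * y + b * w"
    by (auto simp: in_sp)
  then show "(t * X, t * Y) \<in> sp x y z w"
    unfolding in_sp using t
    by (intro bexI[of _ "t * a"] bexI[of _ "t * b"]) (auto simp: algebra_simps)
qed

lemma sp_commute: "sp x y z w = sp z w x y"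
  unfolding sp_def by (auto simp: add.commute) (metis add.commute)+

text \<open>If a combination with coefficients \<open>l\<close>, \<open>k\<close> is again a
  normalised vector, conjugation shows that \<open>cj l\<close>, \<open>cj k\<close> are
  coefficients of the same vector. The two generators are independent over the whole field, so the
  coefficients agree and lie in F.\<close>

lemma join_Int_B:
  assumes "(x, y) \<noteq> (0, 0)" "(z, w) \<noteq> (0, 0)" "emb (x, y) \<noteq> emb (z, w)"
  shows "join (emb (x, y)) (emb (z, w)) \<inter> B = pp (sp x y z w)"
proof -
  have indep: "l = 0 \<and> k = 0"
    if "l * x + k * z = 0" "l * y + k * w = 0" "l * cj x + k * cj z = 0" "l * cj y + k * cj w = 0"
    for l k
  proof (rule ccontr)
    assume "\<not> (l = 0 \<and> k = 0)"
    have l: "l \<noteq> 0" 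
      using that assms(2) \<open>\<not> (l = 0 \<and> k = 0)\<close> by auto
    have k: "k \<noteq> 0" 
      using that assms(1) \<open>\<not> (l = 0 \<and> k = 0)\<close> by auto
    have e: "z = - l / k * x" "w = - l / k * y" "cj z = - l / k * cj x" "cj w = - l / k * cj y"
      using that k by (auto simp: field_simps eq_neg_iff_add_eq_0)
    then have "emb (x, y) = emb (z, w)"
      unfolding emb_def using assms(1) l k by (subst pt_eq_iff) (auto intro!: exI[of _ "- l / k"])
    then show False using assms(3) by simp
  qed
  have "emb (X, Y) \<in> join (emb (x, y)) (emb (z, w)) \<longleftrightarrow> (X, Y) \<in> sp x y z w"
    if "(X, Y) \<noteq> (0, 0)" for X Y
  proof -
    have "emb (X, Y) \<in> join (emb (x, y)) (emb (z, w)) \<longleftrightarrow>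
      (\<exists>l k. X = l * x + k * z \<and> Y = l * y + k * w \<and> \<eta> * cj X = l * (\<eta> * cj x) + k * (\<eta> * cj z) \<and>
        \<eta> * cj Y = l * (\<eta> * cj y) + k * (\<eta> * cj w))"
      using that by (auto simp: emb_def pt_in_join)
    also have "\<dots> \<longleftrightarrow> (\<exists>l k. X = l * x + k * z \<and> Y = l * y + k * w \<and>
        \<eta> * cj X = \<eta> * (l * cj x + k * cj z) \<and> \<eta> * cj Y = \<eta> * (l * cj y + k * cj w))"
      by (simp add: algebra_simps)
    also have "\<dots> \<longleftrightarrow> (\<exists>l k. X = l * x + k * z \<and> Y = l * y + k * w \<and>
        cj X = l * cj x + k * cj z \<and> cj Y = l * cj y + k * cj w)"
      by simp
    also have "\<dots> \<longleftrightarrow> (X, Y) \<in> sp x y z w"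
    proof
      assume "\<exists>l k. X = l * x + k * z \<and> Y = l * y + k * w \<and>
        cj X = l * cj x + k * cj z \<and> cj Y = l * cj y + k * cj w"
      then obtain l k where lk: "X = l * x + k * z" "Y = l * y + k * w"
        "cj X = l * cj x + k * cj z" "cj Y = l * cj y + k * cj w" by blast
      have c: "X = cj l * x + cj k * z" "Y = cj l * y + cj k * w"
        using arg_cong[OF lk(3), of cj] arg_cong[OF lk(4), of cj] by simp_all
      have "cj X = cj l * cj x + cj k * cj z" "cj Y = cj l * cj y + cj k * cj w"
        using lk(1,2) by simp_all
      then have "l - cj l = 0 \<and> k - cj k = 0"
        using lk c by (intro indep) (simp_all add: left_diff_distrib algebra_simps)
      then have "l \<in> F" "k \<in> F" by (auto simp: in_F)
      then show "(X, Y) \<in> sp x y z w" using lk unfolding in_sp by blast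
    next
      assume "(X, Y) \<in> sp x y z w"
      then show "\<exists>l k. X = l * x + k * z \<and> Y = l * y + k * w \<and>
        cj X = l * cj x + k * cj z \<and> cj Y = l * cj y + k * cj w"
        by (auto simp: in_sp in_F) metis
    qed
    finally show ?thesis .
  qed
  then show ?thesis
    unfolding B_eq pp_def by (auto simp: image_iff)
qed

lemma pp_sp_subline:
  assumes "(x, y) \<noteq> (0, 0)" "(z, w) \<noteq> (0, 0)" "emb (x, y) \<noteq> emb (z, w)"
  shows "pp (sp x y z w) \<in> sublines B"
proof -
  have "emb (x, y) \<in> B" "emb (z, w) \<in> B" using assms by (auto simp: B_eq pp_def)
  then show ?thesis unfolding sublines_def using join_Int_B[OF assms] assms(3) by blast
qed

text \<open>The F-linear maps of the field are the maps y to m y + n cj y, so \<open>G m n\<close>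
  is a graph of such a map. \<open>M x z y\<close> joins the point (x, 0) of \<open>Linf\<close> to
  (z, y).\<close>

definition Linf :: "'a point set" where "Linf = pp {(x, y). y = 0}"
definition G :: "'a \<Rightarrow> 'a \<Rightarrow> 'a point set" where "G m n = pp {(x, y). x = m * y + n * cj y}"
definition M :: "'a \<Rightarrow> 'a \<Rightarrow> 'a \<Rightarrow> 'a point set" where "M x z y = pp (sp x 0 z y)"

lemma scaled_Linf: "scaled {(x, y). y = 0}" by (simp add: scaled_def)
lemma scaled_G: "scaled {(x, y). x = m * y + n * cj y}"
  by (auto simp: scaled_def in_F algebra_simps)

lemma emb_in_Linf: "(x, y) \<noteq> (0, 0) \<Longrightarrow> emb (x, y) \<in> Linf \<longleftrightarrow> y = 0"
  unfolding Linf_def by (subst emb_in_pp) (auto simp: scaled_Linf)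
lemma emb_in_G: "(x, y) \<noteq> (0, 0) \<Longrightarrow> emb (x, y) \<in> G m n \<longleftrightarrow> x = m * y + n * cj y"
  unfolding G_def by (subst emb_in_pp) (auto simp: scaled_G)
lemma emb_in_M: "(x, y) \<noteq> (0, 0) \<Longrightarrow>
    emb (x, y) \<in> M x0 z0 y0 \<longleftrightarrow> (\<exists>a\<in>F. \<exists>b\<in>F. x = a * x0 + b * z0 \<and> y = b * y0)"
  unfolding M_def by (subst emb_in_pp) (auto simp: scaled_sp in_sp)

lemma Linf_subline: "Linf \<in> sublines B"
proof -
  obtain w where w: "w \<notin> F" using ex_not_in_F by blast
  then have "w \<noteq> 0" by auto
  have "sp 1 0 w 0 = {(x, y). y = 0}"
    using coordinates[of 1 w] w by (auto simp: in_sp in_F)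
  moreover have "pp (sp 1 0 w 0) \<in> sublines B"
    by (rule pp_sp_subline) (use w \<open>w \<noteq> 0\<close> in \<open>auto simp: emb_eq_iff\<close>)
  ultimately show ?thesis by (simp add: Linf_def)
qed

lemma sp_eq_graph:
  assumes "y * cj w \<noteq> w * cj y"
  shows "sp (m * y + n * cj y) y (m * w + n * cj w) w = {(X, Y). X = m * Y + n * cj Y}"
proof (intro set_eqI iffI; clarify)
  fix X Y assume "(X, Y) \<in> sp (m * y + n * cj y) y (m * w + n * cj w) w"
  then show "X = m * Y + n * cj Y" by (auto simp: in_sp in_F algebra_simps)
next
  fix Y 
  obtain a b where "a \<in> F" "b \<in> F" "Y = a * y + b * w" using coordinates[OF assms] by blast
  then show "(m * Y + n * cj Y, Y) \<in> sp (m * y + n * cj y) y (m * w + n * cj w) w"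
    unfolding in_sp by (intro bexI[of _ a] bexI[of _ b]) (auto simp: in_F algebra_simps)
qed

text \<open>Cramer's rule for the unknowns \<open>m\<close> and \<open>n\<close>.\<close>

lemma interpolation:
  assumes "y * cj w \<noteq> w * cj y"
  shows "\<exists>m n. x = m * y + n * cj y \<and> z = m * w + n * cj w"
proof (intro exI conjI)
  let ?d = "y * cj w - w * cj y"
  have "?d * x = (x * cj w - z * cj y) * y + (y * z - w * x) * cj y"
    "?d * z = (x * cj w - z * cj y) * w + (y * z - w * x) * cj w"
    by (simp_all add: algebra_simps)
  then have "?d * x / ?d = (x * cj w - z * cj y) / ?d * y + (y * z - w * x) / ?d * cj y"
    "?d * z / ?d = (x * cj w - z * cj y) / ?d * w + (y * z - w * x) / ?d * cj w"
    by (simp_all add: add_divide_distrib)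
  then show "x = (x * cj w - z * cj y) / ?d * y + (y * z - w * x) / ?d * cj y"
    "z = (x * cj w - z * cj y) / ?d * w + (y * z - w * x) / ?d * cj w"
    using assms by simp_all
qed

lemma G_subline: "G m n \<in> sublines B"
proof -
  obtain w where w: "w \<notin> F" using ex_not_in_F by blast
  then have "w \<noteq> 0" by auto
  have "pp (sp (m * 1 + n * cj 1) 1 (m * w + n * cj w) w) \<in> sublines B"
    by (rule pp_sp_subline) (use w \<open>w \<noteq> 0\<close> in \<open>auto simp: emb_eq_iff\<close>)
  then show ?thesis using w by (subst (asm) sp_eq_graph) (auto simp: G_def in_F)
qed

lemma M_subline: "x \<noteq> 0 \<Longrightarrow> y \<noteq> 0 \<Longrightarrow> M x z y \<in> sublines B"
  unfolding M_def by (rule pp_sp_subline) (auto simp: emb_eq_iff)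

lemma subline_dependent:
  assumes "y \<noteq> 0" "t \<in> F" "(z, t * y) \<noteq> (0, 0)" "emb (x, y) \<noteq> emb (z, t * y)"
  shows "pp (sp x y z (t * y)) = M (z - t * x) x y" "z - t * x \<noteq> 0"
proof -
  show "z - t * x \<noteq> 0"
  proof
    assume "z - t * x = 0"
    then have "emb (x, y) = emb (z, t * y)"
      using assms by (subst emb_eq_iff) auto
    then show False using assms(4) by simp
  qed
  have "sp x y z (t * y) = sp (z - t * x) 0 x y"
  proof (intro set_eqI iffI; clarify)
    fix X Y assume "(X, Y) \<in> sp x y z (t * y)"
    then obtain a b where "a \<in> F" "b \<in> F" "X = a * x + b * z" "Y = a * y + b * (t * y)"
      by (auto simp: in_sp)
    then show "(X, Y) \<in> sp (z - t * x) 0 x y"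
      unfolding in_sp using assms(2)
      by (intro bexI[of _ b] bexI[of _ "a + b * t"]) (auto simp: algebra_simps)
  next
    fix X Y assume "(X, Y) \<in> sp (z - t * x) 0 x y"
    then obtain a b where "a \<in> F" "b \<in> F" "X = a * (z - t * x) + b * x" "Y = a * 0 + b * y"
      by (auto simp: in_sp)
    then show "(X, Y) \<in> sp x y z (t * y)"
      unfolding in_sp using assms(2)
      by (intro bexI[of _ "b - a * t"] bexI[of _ a]) (auto simp: algebra_simps)
  qed
  then show "pp (sp x y z (t * y)) = M (z - t * x) x y" by (simp add: M_def)
qed

text \<open>The rank over F of the projection to the second coordinate decides: rank 2 gives a
  graph, rank 0 gives \<open>Linf\<close>, rank 1 a line \<open>M\<close>. Rank 1 takes two cases,
  according to which generator has a nonzero second coordinate to divide by.\<close>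

lemma subline_cases:
  assumes "l \<in> sublines B"
  obtains "l = Linf" | m n where "l = G m n" | x z y where "l = M x z y" "x \<noteq> 0" "y \<noteq> 0"
proof -
  obtain P Q where PQ: "P \<in> B" "Q \<in> B" "P \<noteq> Q" "l = join P Q \<inter> B"
    using assms by (auto simp: sublines_def)
  obtain x y where P: "P = emb (x, y)" "(x, y) \<noteq> (0, 0)" using PQ(1) unfolding B_eq by (rule pp_cases)
  obtain z w where Q: "Q = emb (z, w)" "(z, w) \<noteq> (0, 0)" using PQ(2) unfolding B_eq by (rule pp_cases)
  have ne: "emb (x, y) \<noteq> emb (z, w)" using PQ P Q by simp
  have l: "l = pp (sp x y z w)" using PQ P Q join_Int_B by simp
  consider "y * cj w \<noteq> w * cj y" | "y = 0" "w = 0" | "y \<noteq> 0" "w / y \<in> F" | "y = 0" "w \<noteq> 0"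
    by (metis dependent_imp_ratio mult.commute)
  then show ?thesis
  proof cases
    case 1
    then obtain m n where "x = m * y + n * cj y" "z = m * w + n * cj w"
      using interpolation by blast
    then have "l = G m n" using sp_eq_graph[OF 1] l by (simp add: G_def)
    then show ?thesis using that by blast
  next
    case 2
    have "x * cj z \<noteq> z * cj x"
    proof
      assume "x * cj z = z * cj x"
      then have "z / x \<in> F" using P(2) 2 by (intro dependent_imp_ratio) auto
      then have "emb (x, y) = emb (z, w)"
        using P Q 2 by (subst emb_eq_iff) (auto intro!: bexI[of _ "z / x"])
      then show False using ne by simp
    qed
    then have "sp x y z w = {(x, y). y = 0}" using coordinates[of x z] 2 by (auto simp: in_sp)
    then have "l = Linf" using l by (simp add: Linf_def)
    then show ?thesis using that by blast
  next
    case 3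
    have w: "w = w / y * y" using 3 by simp
    then have "l = M (z - w / y * x) x y" "z - w / y * x \<noteq> 0"
      using subline_dependent[of y "w / y" z x] 3 Q ne l by metis+
    then show ?thesis using that 3 by blast
  next
    case 4
    have "pp (sp z w x (0 * w)) = M (x - 0 * z) z w" "x - 0 * z \<noteq> 0"
      using subline_dependent[of w 0 x z] 4 P ne by auto
    then have "l = M x z w" "x \<noteq> 0" using l 4 by (simp_all add: sp_commute[of x])
    then show ?thesis using that 4 by blast
  qed
qed

section \<open>Incidence of the three kinds of lines\<close>

lemma G_eq_iff: "G m n = G m' n' \<longleftrightarrow> m = m' \<and> n = n'"
proof
  assume eq: "G m n = G m' n'"
  have e: "m * y + n * cj y = m' * y + n' * cj y" if "y \<noteq> 0" for y
    using emb_in_G[of "m * y + n * cj y" y m n] emb_in_G[of "m * y + n * cj y" y m' n'] that eq by auto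
  obtain w where w: "w \<notin> F" using ex_not_in_F by blast
  then have "w \<noteq> 0" by auto
  have e1: "m - m' = n' - n" using e[of 1] by (simp add: algebra_simps)
  have "(m - m') * w = (n' - n) * cj w" using e[OF \<open>w \<noteq> 0\<close>] by (simp add: algebra_simps)
  then have "n' - n = 0" using w e1 by (auto simp: in_F)
  then show "m = m' \<and> n = n'" using e1 by simp
qed simp

lemma G_Int_Linf: "G m n \<inter> Linf = {}"
proof -
  have "\<not> (G m n \<inter> Linf \<noteq> {})"
    unfolding G_def Linf_def by (subst pp_Int_ne) (auto simp: scaled_G scaled_Linf)
  then show ?thesis by simp
qed

lemma emb_pair_in_M: "x \<noteq> 0 \<Longrightarrow> emb (x, 0) \<in> M x z y"
  by (subst emb_in_M) (simp, rule bexI[of _ 1], rule bexI[of _ 0], auto)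

lemma M_Int_Linf: "x \<noteq> 0 \<Longrightarrow> M x z y \<inter> Linf \<noteq> {}"
  using emb_pair_in_M[of x z y] emb_in_Linf[of x 0] by auto

lemma G_ne_Linf: "G m n \<noteq> Linf"
  using G_Int_Linf[of m n] emb_in_Linf[of 1 0] by auto

lemma G_ne_M: "x \<noteq> 0 \<Longrightarrow> G m n \<noteq> M x z y"
  using G_Int_Linf[of m n] M_Int_Linf by metis

lemma M_ne_Linf: "x \<noteq> 0 \<Longrightarrow> y \<noteq> 0 \<Longrightarrow> M x z y \<noteq> Linf"
proof
  assume "x \<noteq> 0" "y \<noteq> 0" "M x z y = Linf"
  moreover have "emb (z, y) \<in> M x z y" using \<open>y \<noteq> 0\<close>
    by (subst emb_in_M) (auto intro!: bexI[of _ 1] bexI[of _ 0])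
  ultimately show False using emb_in_Linf[of z y] by auto
qed

lemma G_Int_G: "G m n \<inter> G m' n' \<noteq> {} \<longleftrightarrow> (\<exists>y. y \<noteq> 0 \<and> m * y + n * cj y = m' * y + n' * cj y)"
proof -
  have "G m n \<inter> G m' n' \<noteq> {} \<longleftrightarrow> (\<exists>y. (m * y + n * cj y, y) \<noteq> (0, 0) \<and> m * y + n * cj y = m' * y + n' * cj y)"
    unfolding G_def by (subst pp_Int_ne) (simp_all add: scaled_G)
  also have "\<dots> \<longleftrightarrow> (\<exists>y. y \<noteq> 0 \<and> m * y + n * cj y = m' * y + n' * cj y)"
    by (metis Pair_inject add_0 cj_0 mult_zero_right)
  finally show ?thesis .
qed

lemma G_Int_M:
  assumes "x \<noteq> 0" "y \<noteq> 0"
  shows "G m n \<inter> M x z y \<noteq> {} \<longleftrightarrow> (\<exists>t\<in>F. m * y + n * cj y = z + t * x)"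
proof
  assume "G m n \<inter> M x z y \<noteq> {}"
  then obtain X Y where XY: "X = m * Y + n * cj Y" "(X, Y) \<noteq> (0, 0)" "(X, Y) \<in> sp x 0 z y"
    unfolding G_def M_def by (subst (asm) pp_Int_ne) (auto simp: scaled_G scaled_sp)
  then obtain a b where ab: "a \<in> F" "b \<in> F" "X = a * x + b * z" "Y = b * y" by (auto simp: in_sp)
  have "b \<noteq> 0" using XY ab by auto
  have "b * (m * y + n * cj y) = b * (z + a / b * x)"
    using XY(1) ab \<open>b \<noteq> 0\<close> by (simp add: in_F algebra_simps)
  then show "\<exists>t\<in>F. m * y + n * cj y = z + t * x"
    using \<open>b \<noteq> 0\<close> ab by (intro bexI[of _ "a / b"]) auto
next
  assume "\<exists>t\<in>F. m * y + n * cj y = z + t * x"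
  then obtain t where t: "t \<in> F" "m * y + n * cj y = z + t * x" by blast
  have "emb (z + t * x, y) \<in> M x z y" using assms t(1)
    by (subst emb_in_M) (simp, rule bexI[of _ t], rule bexI[of _ 1], auto)
  moreover have "emb (z + t * x, y) \<in> G m n"
    using assms t(2) by (subst emb_in_G) auto
  ultimately show "G m n \<inter> M x z y \<noteq> {}" by blast
qed

section \<open>Spreads carried by the lines of a pencil\<close>

lemma baer_eq: "baer q \<alpha> = {pt x y (\<alpha> * cj x) (\<alpha> * cj y) | x y. (x, y) \<noteq> (0, 0)}"
  by (simp add: baer_def cj_def)

lemma tau_pt: "tau q \<eta> (pt a b c d) = pt (cj c) (cj d) (cj a) (cj b)"
proof -
  have N: "\<eta> ^ (q + 1) = 1" by (simp only: norm_conv eta_norm)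
  have "x \<in> tau q \<eta> (pt a b c d) \<longleftrightarrow> x \<in> pt (cj c) (cj d) (cj a) (cj b)" for x
  proof
    assume "x \<in> tau q \<eta> (pt a b c d)"
    then obtain y where y: "y \<in> pt a b c d"
      "x = vector [cj (y $ 3), cj (y $ 4), cj (y $ 1), cj (y $ 2)]"
      unfolding tau_def N by (auto simp: cj_def)
    then show "x \<in> pt (cj c) (cj d) (cj a) (cj b)" by (auto simp: mem_pt)
  next
    assume "x \<in> pt (cj c) (cj d) (cj a) (cj b)"
    then obtain k where k: "x $ 1 = k * cj c" "x $ 2 = k * cj d" "x $ 3 = k * cj a" "x $ 4 = k * cj b"
      by (auto simp: mem_pt)
    let ?y = "vector [cj k * a, cj k * b, cj k * c, cj k * d] :: 'a ^ 4"
    have y: "?y \<in> pt a b c d" by (auto simp: mem_pt)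
    have x: "x = vector [cj (?y $ 3), cj (?y $ 4), cj (?y $ 1), cj (?y $ 2)]"
      by (simp add: vec4_eq_iff k)
    show "x \<in> tau q \<eta> (pt a b c d)"
      unfolding tau_def N cj_def[symmetric] mult_1_left by (rule image_eqI, rule x, rule y)
  qed
  then show ?thesis by blast
qed

text \<open>
  A vector of the span of \<open>p\<close> and its semilinear image \<open>T p\<close> represents a point of \<open>B\<close> in
  normalised form iff \<open>\<eta> T\<close> fixes it, which forces the second coefficient to be \<open>\<eta> cj l\<close>.
\<close>

lemma join_tau_Int_B:
  assumes indep: "\<And>l k. \<lbrakk>l * a + k * cj c = 0; l * b + k * cj d = 0;
    l * c + k * cj a = 0; l * d + k * cj b = 0\<rbrakk> \<Longrightarrow> l = 0 \<and> k = 0"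
  shows "join (pt a b c d) (tau q \<eta> (pt a b c d)) \<inter> B =
    pp {(l * a + \<eta> * cj l * cj c, l * b + \<eta> * cj l * cj d) | l. True}" (is "_ = pp ?V")
proof -
  have *: "emb (X, Y) \<in> join (pt a b c d) (tau q \<eta> (pt a b c d)) \<longleftrightarrow> (X, Y) \<in> ?V"
    if "(X, Y) \<noteq> (0, 0)" for X Y
  proof -
    have "emb (X, Y) \<in> join (pt a b c d) (tau q \<eta> (pt a b c d)) \<longleftrightarrow>
      (\<exists>l k. X = l * a + k * cj c \<and> Y = l * b + k * cj d \<and>
        \<eta> * cj X = l * c + k * cj a \<and> \<eta> * cj Y = l * d + k * cj b)"
      using that by (auto simp: emb_def tau_pt pt_in_join)
    also have "\<dots> \<longleftrightarrow> (X, Y) \<in> ?V"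
    proof
      assume "\<exists>l k. X = l * a + k * cj c \<and> Y = l * b + k * cj d \<and>
        \<eta> * cj X = l * c + k * cj a \<and> \<eta> * cj Y = l * d + k * cj b"
      then obtain l k where lk: "X = l * a + k * cj c" "Y = l * b + k * cj d"
        "\<eta> * cj X = l * c + k * cj a" "\<eta> * cj Y = l * d + k * cj b" by blast
      have e1: "\<eta> * cj X = \<eta> * cj k * c + \<eta> * cj l * cj a" "\<eta> * cj Y = \<eta> * cj k * d + \<eta> * cj l * cj b"
        unfolding lk(1,2) by (simp_all add: algebra_simps)
      have "X = \<eta> * cj (\<eta> * cj X)" "Y = \<eta> * cj (\<eta> * cj Y)"
        using eta_norm by (simp_all flip: mult.assoc)
      then have e2: "X = \<eta> * cj k * a + \<eta> * cj l * cj c" "Y = \<eta> * cj k * b + \<eta> * cj l * cj d"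
        unfolding lk(3,4) by (simp_all add: algebra_simps)
      have "l - \<eta> * cj k = 0 \<and> k - \<eta> * cj l = 0"
        using lk e1 e2 by (intro indep) (simp_all add: left_diff_distrib algebra_simps)
      then have "k - \<eta> * cj l = 0" ..
      then have "k = \<eta> * cj l" by (simp only: right_minus_eq)
      then show "(X, Y) \<in> ?V" using lk(1,2) by auto
    next
      assume "(X, Y) \<in> ?V"
      then obtain l where "X = l * a + \<eta> * cj l * cj c" "Y = l * b + \<eta> * cj l * cj d" by auto
      moreover from this have "\<eta> * cj X = l * c + \<eta> * cj l * cj a" "\<eta> * cj Y = l * d + \<eta> * cj l * cj b"
        using eta_norm by (simp_all add: distrib_left flip: mult.assoc)
      ultimately show "\<exists>l k. X = l * a + k * cj c \<and> Y = l * b + k * cj d \<and>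
        \<eta> * cj X = l * c + k * cj a \<and> \<eta> * cj Y = l * d + k * cj b" by blast
    qed
    finally show ?thesis .
  qed
  have "P \<in> join (pt a b c d) (tau q \<eta> (pt a b c d)) \<inter> B \<longleftrightarrow> P \<in> pp ?V" for P
  proof
    assume P: "P \<in> join (pt a b c d) (tau q \<eta> (pt a b c d)) \<inter> B"
    then have "P \<in> pp UNIV" by (simp add: B_eq)
    then obtain X Y where XY: "P = emb (X, Y)" "(X, Y) \<noteq> (0, 0)" by (rule pp_cases)
    then have "(X, Y) \<in> ?V" using P *[OF XY(2)] by simp
    then show "P \<in> pp ?V" using XY unfolding pp_def by blast
  next
    assume P: "P \<in> pp ?V"
    then obtain X Y where XY: "P = emb (X, Y)" "(X, Y) \<in> ?V" "(X, Y) \<noteq> (0, 0)" by (rule pp_cases)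
    then show "P \<in> join (pt a b c d) (tau q \<eta> (pt a b c d)) \<inter> B"
      using P *[OF XY(3)] pp_subset_B by blast
  qed
  then show ?thesis by blast
qed

lemma pt_in_t1: "P \<in> t1 \<longleftrightarrow> (\<exists>a b. (a, b) \<noteq> (0, 0) \<and> P = pt a b 0 0)"
proof
  assume "P \<in> t1"
  moreover from this obtain a b c d where "P = pt a b c d" "(a, b, c, d) \<noteq> (0, 0, 0, 0)"
    unfolding t1_def using join_points points_cases by metis
  ultimately show "\<exists>a b. (a, b) \<noteq> (0, 0) \<and> P = pt a b 0 0"
    by (auto simp: t1_def U1_def U2_def pt_in_join)
qed (auto simp: t1_def U1_def U2_def pt_in_join)

lemma pt_in_rU1: "pt a b c d \<in> rU1 \<longleftrightarrow> (a, c) \<noteq> (0, 0) \<and> b = 0 \<and> d = 0"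
  by (auto simp: rU1_def U1_def U3_def pt_in_join)

lemma rU1_Int_B: "rU1 \<inter> B = Linf"
proof -
  have "emb (x, y) \<in> rU1 \<longleftrightarrow> y = 0" if "(x, y) \<noteq> (0, 0)" for x y
    using that by (auto simp: emb_def pt_in_rU1)
  then show ?thesis unfolding B_eq Linf_def pp_def by auto
qed

lemma D_spread_eq: "D_spread q \<eta> = insert Linf {G c 0 | c. True}"
proof -
  have *: "join (pt a b 0 0) (tau q \<eta> (pt a b 0 0)) \<inter> B = (if b = 0 then Linf else G (a / b) 0)"
    if ab: "(a, b) \<noteq> (0, 0)" for a b
  proof -
    have "join (pt a b 0 0) (tau q \<eta> (pt a b 0 0)) \<inter> B =
      pp {(l * a + \<eta> * cj l * cj 0, l * b + \<eta> * cj l * cj 0) | l. True}"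
      by (rule join_tau_Int_B) (use ab in auto)
    also have "\<dots> = pp {(l * a, l * b) | l. True}" by simp
    also have "\<dots> = (if b = 0 then Linf else G (a / b) 0)"
    proof (cases "b = 0")
      case True
      then have "a \<noteq> 0" using ab by simp
      then have "\<exists>l. x = l * a" for x by (intro exI[of _ "x / a"]) simp
      then have "{(l * a, l * b) | l. True} = {(x, y). y = 0}" using True by auto
      then show ?thesis using True by (simp add: Linf_def)
    next
      case False
      have "{(l * a, l * b) | l. True} = {(x, y). x = a / b * y + 0 * cj y}"
      proof (intro set_eqI iffI; clarify)
        fix y show "\<exists>l. (a / b * y + 0 * cj y, y) = (l * a, l * b) \<and> True"
          using False by (intro exI[of _ "y / b"]) simp
      qed (use False in simp)
      then show ?thesis using False by (simp add: G_def)
    qed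
    finally show ?thesis .
  qed
  show ?thesis unfolding D_spread_def line_spread_of_def
  proof (intro set_eqI iffI)
    fix l assume "l \<in> {join P (tau q \<eta> P) \<inter> B | P. P \<in> t1}"
    then obtain a b where "(a, b) \<noteq> (0, 0)" "l = join (pt a b 0 0) (tau q \<eta> (pt a b 0 0)) \<inter> B"
      by (auto simp: pt_in_t1)
    then show "l \<in> insert Linf {G c 0 | c. True}" using *[of a b] by auto
  next
    fix l assume "l \<in> insert Linf {G c 0 | c. True}"
    then consider "l = Linf" | c where "l = G c 0" by blast
    then show "l \<in> {join P (tau q \<eta> P) \<inter> B | P. P \<in> t1}"
    proof cases
      case 1
      then have "l = join (pt 1 0 0 0) (tau q \<eta> (pt 1 0 0 0)) \<inter> B" using *[of 1 0] by simp
      moreover have "pt 1 0 0 0 \<in> t1" unfolding pt_in_t1 by (rule exI[of _ 1], rule exI[of _ 0]) simp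
      ultimately show ?thesis by blast
    next
      case 2
      then have "l = join (pt c 1 0 0) (tau q \<eta> (pt c 1 0 0)) \<inter> B" using *[of c 1] by simp
      moreover have "pt c 1 0 0 \<in> t1" unfolding pt_in_t1 by (rule exI[of _ c], rule exI[of _ 1]) simp
      ultimately show ?thesis by blast
    qed
  qed
qed

text \<open>The equation and its conjugate are linear in \<open>l\<close> and \<open>cj l\<close>
  with determinant \<open>1 - \<theta> * cj \<theta>\<close>; Cramer's rule supplies the
  witness.\<close>

lemma semilinear_surj:
  assumes "\<theta> * cj \<theta> \<noteq> 1"
  shows "\<exists>l. l + \<theta> * cj l = z"
proof -
  let ?k = "1 - \<theta> * cj \<theta>"
  have k: "?k \<noteq> 0" using assms by simp
  have ck: "cj ?k = ?k" by (simp add: mult.commute)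
  have "cj ((z - \<theta> * cj z) / ?k) = (cj z - cj \<theta> * z) / ?k" unfolding cj_divide ck by simp
  then have "(z - \<theta> * cj z) / ?k + \<theta> * cj ((z - \<theta> * cj z) / ?k)
      = ((z - \<theta> * cj z) + \<theta> * (cj z - cj \<theta> * z)) / ?k"
    by (simp add: add_divide_distrib)
  also have "(z - \<theta> * cj z) + \<theta> * (cj z - cj \<theta> * z) = z * ?k" by (simp add: algebra_simps)
  also have "z * ?k / ?k = z" using k by simp
  finally show ?thesis by blast
qed

text \<open>The spread carried by a pencil line: \<open>w\<close> runs over the points of the line
  other than its vertex \<open>Ppt\<close>, which itself yields \<open>Linf\<close>.\<close>

definition SG :: "'a \<Rightarrow> 'a \<Rightarrow> 'a \<Rightarrow> 'a \<Rightarrow> 'a point set set" where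
  "SG c d k \<kappa> = insert Linf
    {G (c + d * ((w - k * cj w) / (1 - k))) (d * (\<kappa> * (cj w - w) / (1 - k))) | w. True}"

text \<open>For \<open>cj e = v * e\<close> this point of \<open>baer q \<alpha>\<close> lies in
  \<open>plane (\<alpha> * v)\<close>. With \<open>e\<close> fixed, \<open>x\<close> runs over the
  lines of the pencil.\<close>

definition Lpt :: "'a \<Rightarrow> 'a \<Rightarrow> 'a \<Rightarrow> 'a point" where
  "Lpt \<alpha> x e = pt x e (\<alpha> * cj x) (\<alpha> * cj e)"

lemma points_of_pencil_line:
  "P \<in> join (Ppt y) (Lpt \<alpha> x e) \<longleftrightarrow>
    P = Ppt y \<or> (\<exists>a. P = pt (a + x) e (a * y + \<alpha> * cj x) (\<alpha> * cj e))" (is "_ \<longleftrightarrow> ?R")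
  if "e \<noteq> 0"
proof
  assume P: "P \<in> join (Ppt y) (Lpt \<alpha> x e)"
  then obtain a b c d where abcd: "P = pt a b c d" "(a, b, c, d) \<noteq> (0, 0, 0, 0)"
    using join_points points_cases by metis
  then obtain l k where lk: "a = l + k * x" "b = k * e" "c = l * y + k * (\<alpha> * cj x)" "d = k * (\<alpha> * cj e)"
    using P by (auto simp: Ppt_def Lpt_def pt_in_join)
  show ?R
  proof (cases "k = 0")
    case True
    then have "P = Ppt y" unfolding abcd Ppt_def using abcd(2) lk
      by (subst eq_commute, subst pt_eq_iff) (auto intro!: exI[of _ l])
    then show ?thesis ..
  next
    case False
    have "P = pt (l / k + x) e (l / k * y + \<alpha> * cj x) (\<alpha> * cj e)"
      unfolding abcd(1) using that False lk
      by (subst eq_commute, subst pt_eq_iff) (auto intro!: exI[of _ k] simp: distrib_left)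
    then show ?thesis by blast
  qed
next
  assume ?R
  then show "P \<in> join (Ppt y) (Lpt \<alpha> x e)"
  proof
    assume "P = Ppt y"
    then show ?thesis by (auto simp: Ppt_def pt_in_points intro: points_in_join)
  next
    assume "\<exists>a. P = pt (a + x) e (a * y + \<alpha> * cj x) (\<alpha> * cj e)"
    then obtain a where "P = pt (a + x) e (a * y + \<alpha> * cj x) (\<alpha> * cj e)" by blast
    moreover have "\<exists>l k. a + x = l * 1 + k * x \<and> e = l * 0 + k * e \<and>
      a * y + \<alpha> * cj x = l * y + k * (\<alpha> * cj x) \<and> \<alpha> * cj e = l * 0 + k * (\<alpha> * cj e)"
      by (rule exI[of _ a], rule exI[of _ 1]) simp
    ultimately show ?thesis using that by (simp add: Ppt_def Lpt_def pt_in_join)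
  qed
qed

text \<open>The scalings \<open>x0\<close> and \<open>e\<close> absorb \<open>u\<close> and
  \<open>v\<close>. With \<open>\<theta> = \<eta> * cj \<alpha>\<close> and s = l +
  \<open>\<theta>\<close> cj l, the line joining the point of parameter \<open>w\<close> to its
  image consists of the vectors X = x1 s + x0 (w l + \<open>\<theta>\<close> cj w cj l), Y = e s.
  Eliminating l and cj l in favour of s and cj s gives the coefficients (w - k cj w) / (1 - k) and
  \<open>\<theta>\<close> (cj w - w) / (1 - k). The factor \<open>cj v\<close> enters through cj Y =
  v e cj s.\<close>

lemma line_spread_of_pencil_line:
  assumes u: "u \<in> U" and v: "v \<in> U" and N: "\<alpha> * cj \<alpha> \<noteq> 1"
    and x0: "x0 \<noteq> 0" "cj x0 = u * x0" and e: "e \<noteq> 0" "cj e = v * e"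
  shows "line_spread_of q \<eta> (join (Ppt (\<alpha> * u)) (Lpt \<alpha> x1 e)) =
    SG (x1 / e) (x0 / e) (\<alpha> * cj \<alpha>) (\<eta> * cj \<alpha> * cj v)"
proof -
  have uu: "u * cj u = 1" "v * cj v = 1" using u v by (simp_all add: in_U)
  have N': "1 - \<alpha> * cj \<alpha> \<noteq> 0" using N by simp
  define \<theta> where "\<theta> = \<eta> * cj \<alpha>"
  have "\<theta> * cj \<theta> = (\<eta> * cj \<eta>) * (\<alpha> * cj \<alpha>)" by (simp add: \<theta>_def mult_ac)
  then have \<theta>: "\<theta> * cj \<theta> = \<alpha> * cj \<alpha>" by (simp add: eta_norm)
  have 1: "join (Ppt (\<alpha> * u)) (tau q \<eta> (Ppt (\<alpha> * u))) \<inter> B = Linf"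
  proof -
    have "join (pt 1 0 (\<alpha> * u) 0) (tau q \<eta> (pt 1 0 (\<alpha> * u) 0)) \<inter> B =
      pp {(l * 1 + \<eta> * cj l * cj (\<alpha> * u), l * 0 + \<eta> * cj l * cj 0) | l. True}"
    proof (rule join_tau_Int_B)
      fix l k assume "l * 1 + k * cj (\<alpha> * u) = 0" "l * (\<alpha> * u) + k * cj 1 = 0"
      then have k: "k = - (l * (\<alpha> * u))" and l: "l = - (k * cj (\<alpha> * u))"
        by (simp_all add: eq_neg_iff_add_eq_0 add.commute)
      have "- (k * cj (\<alpha> * u)) = l * (\<alpha> * cj \<alpha>) * (u * cj u)"
        unfolding k by (simp add: mult_ac)
      then have "l = l * (\<alpha> * cj \<alpha>) * (u * cj u)" unfolding l[symmetric] .
      then have "l * (1 - \<alpha> * cj \<alpha>) = 0" using uu by (simp add: right_diff_distrib)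
      then show "l = 0 \<and> k = 0" using N' k by simp
    qed
    also have "{(l * 1 + \<eta> * cj l * cj (\<alpha> * u), l * 0 + \<eta> * cj l * cj 0) | l. True} = {(x, y). y = 0}"
    proof -
      have "\<eta> * cj (\<alpha> * u) * cj (\<eta> * cj (\<alpha> * u)) = (\<theta> * cj \<theta>) * (u * cj u)"
        by (simp add: \<theta>_def mult_ac)
      also have "\<dots> \<noteq> 1" using \<theta> N uu by simp
      finally have "\<exists>l. l + \<eta> * cj (\<alpha> * u) * cj l = z" for z by (rule semilinear_surj)
      moreover have "l + \<eta> * cj (\<alpha> * u) * cj l = l * 1 + \<eta> * cj l * cj (\<alpha> * u)" for l by (simp add: mult_ac)
      ultimately have "\<exists>l. z = l * 1 + \<eta> * cj l * cj (\<alpha> * u)" for z by metis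
      then show ?thesis by auto
    qed
    finally show ?thesis by (simp add: Ppt_def Linf_def)
  qed
  define m where "m w = x1 / e + x0 / e * ((w - \<alpha> * cj \<alpha> * cj w) / (1 - \<alpha> * cj \<alpha>))" for w
  define n where "n w = x0 / e * (\<theta> * cj v * (cj w - w) / (1 - \<alpha> * cj \<alpha>))" for w
  define P where "P w = pt (x0 * w + x1) e (x0 * w * (\<alpha> * u) + \<alpha> * cj x1) (\<alpha> * cj e)" for w
  have 2: "join (P w) (tau q \<eta> (P w)) \<inter> B = G (m w) (n w)" for w
  proof -
    let ?X = "\<lambda>l. l * (x0 * w + x1) + \<eta> * cj l * cj (x0 * w * (\<alpha> * u) + \<alpha> * cj x1)"
    let ?Y = "\<lambda>l. l * e + \<eta> * cj l * cj (\<alpha> * cj e)"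
    have "join (P w) (tau q \<eta> (P w)) \<inter> B = pp {(?X l, ?Y l) | l. True}"
      unfolding P_def
    proof (rule join_tau_Int_B)
      fix l k assume "l * e + k * cj (\<alpha> * cj e) = 0" "l * (\<alpha> * cj e) + k * cj e = 0"
      then have "(l + k * cj \<alpha>) * e = 0" "(l * \<alpha> + k) * cj e = 0" by (simp_all add: algebra_simps)
      then have "l + k * cj \<alpha> = 0" "l * \<alpha> + k = 0" using e(1) by simp_all
      then have k: "k = - (l * \<alpha>)" and l: "l = - (k * cj \<alpha>)" by (simp_all add: eq_neg_iff_add_eq_0 add.commute)
      have "- (k * cj \<alpha>) = l * (\<alpha> * cj \<alpha>)" unfolding k by (simp add: mult_ac)
      then have "l * (1 - \<alpha> * cj \<alpha>) = 0" unfolding l[symmetric] by (simp add: right_diff_distrib)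
      then show "l = 0 \<and> k = 0" using N' k by simp
    qed
    also have "{(?X l, ?Y l) | l. True} = {(x, y). x = m w * y + n w * cj y}"
    proof -
      have Y: "?Y l = e * (l + \<theta> * cj l)" for l by (simp add: \<theta>_def algebra_simps)
      have X: "?X l = m w * ?Y l + n w * cj (?Y l)" for l
      proof -
        have c: "cj (x0 * w * (\<alpha> * u) + \<alpha> * cj x1) = x0 * (u * cj u) * cj w * cj \<alpha> + cj \<alpha> * x1"
          by (simp add: x0(2) mult_ac)
        have "?X l = x1 * (l + \<theta> * cj l) + x0 * (w * l + \<theta> * cj w * cj l)"
          unfolding c uu by (simp add: \<theta>_def algebra_simps)
        moreover have "m w * ?Y l = x1 * (l + \<theta> * cj l) +
            x0 * ((w - \<alpha> * cj \<alpha> * cj w) * (l + \<theta> * cj l)) / (1 - \<alpha> * cj \<alpha>)"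
        proof -
          have "x1 / e * (e * z) = x1 * z" "x0 / e * (A / K) * (e * z) = x0 * (A * z) / K" for z A K
            using e(1) by simp_all
          then show ?thesis unfolding Y m_def distrib_right by (simp only:)
        qed
        moreover have "n w * cj (?Y l) =
            x0 * ((v * cj v) * \<theta> * (cj w - w) * (cj l + cj \<theta> * l)) / (1 - \<alpha> * cj \<alpha>)"
        proof -
          have aux: "x0 / e * (A / K) * (v * e * z) = x0 * (v * A * z) / K" for z A K
            using e(1) by simp
          have cY: "cj (?Y l) = v * e * (cj l + cj \<theta> * l)" unfolding Y by (simp add: e(2))
          show ?thesis unfolding cY n_def aux by (simp only: mult_ac)
        qed
        moreover have "(w - \<alpha> * cj \<alpha> * cj w) * (l + \<theta> * cj l) + \<theta> * (cj w - w) * (cj l + cj \<theta> * l)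
            = (w * l + \<theta> * cj w * cj l) * (1 - \<alpha> * cj \<alpha>)"
          unfolding \<theta>[symmetric] by (simp add: algebra_simps)
        ultimately have "m w * ?Y l + n w * cj (?Y l) = x1 * (l + \<theta> * cj l) +
            x0 * ((w * l + \<theta> * cj w * cj l) * (1 - \<alpha> * cj \<alpha>)) / (1 - \<alpha> * cj \<alpha>)"
          using uu by (simp flip: add_divide_distrib distrib_left)
        with \<open>?X l = _\<close> show ?thesis using N' by simp
      qed
      have "\<exists>l. y = ?Y l" for y
      proof -
        obtain l where "l + \<theta> * cj l = y / e" using semilinear_surj \<theta> N by metis
        then show ?thesis unfolding Y using e(1) by (intro exI[of _ l]) simp
      qed
      then have surj: "\<exists>l. y = ?Y l" for y .
      show ?thesis
      proof (intro set_eqI iffI)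
        fix p assume "p \<in> {(?X l, ?Y l) | l. True}"
        then obtain l where "p = (?X l, ?Y l)" by blast
        then show "p \<in> {(x, y). x = m w * y + n w * cj y}" unfolding X by blast
      next
        fix p assume "p \<in> {(x, y). x = m w * y + n w * cj y}"
        then obtain y where p: "p = (m w * y + n w * cj y, y)" by blast
        obtain l where "y = ?Y l" using surj by blast
        then have "p = (?X l, ?Y l)" unfolding p X by simp
        then show "p \<in> {(?X l, ?Y l) | l. True}" by blast
      qed
    qed
    finally show ?thesis by (simp add: G_def)
  qed
  have 3: "(\<exists>a. Q = pt (a + x1) e (a * (\<alpha> * u) + \<alpha> * cj x1) (\<alpha> * cj e)) \<longleftrightarrow> (\<exists>w. Q = P w)" for Q
  proof
    assume "\<exists>a. Q = pt (a + x1) e (a * (\<alpha> * u) + \<alpha> * cj x1) (\<alpha> * cj e)"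
    then obtain a where "Q = pt (a + x1) e (a * (\<alpha> * u) + \<alpha> * cj x1) (\<alpha> * cj e)" ..
    moreover have "a = x0 * (a / x0)" using x0(1) by simp
    ultimately show "\<exists>w. Q = P w" unfolding P_def by metis
  qed (auto simp: P_def)
  have "line_spread_of q \<eta> (join (Ppt (\<alpha> * u)) (Lpt \<alpha> x1 e)) =
      insert (join (Ppt (\<alpha> * u)) (tau q \<eta> (Ppt (\<alpha> * u))) \<inter> B)
        {join (P w) (tau q \<eta> (P w)) \<inter> B | w. True}"
    unfolding line_spread_of_def points_of_pencil_line[OF e(1)] 3 by blast
  then have "line_spread_of q \<eta> (join (Ppt (\<alpha> * u)) (Lpt \<alpha> x1 e)) = insert Linf {G (m w) (n w) | w. True}"
    unfolding 1 2 .
  then show ?thesis by (simp add: SG_def m_def n_def \<theta>_def)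
qed

lemma pt_in_plane: "pt a b c d \<in> plane y \<longleftrightarrow> (a, b, c, d) \<noteq> (0, 0, 0, 0) \<and> d = y * b"
proof -
  have "(\<forall>x\<in>pt a b c d. x $ 4 = y * x $ 2) \<longleftrightarrow> d = y * b"
  proof
    have "vector [a, b, c, d] \<in> pt a b c d" by (auto simp: mem_pt intro!: exI[of _ 1])
    moreover assume "\<forall>x\<in>pt a b c d. x $ 4 = y * x $ 2"
    ultimately show "d = y * b" by fastforce
  qed (auto simp: mem_pt)
  then show ?thesis by (simp add: plane_def pt_in_points)
qed

lemma plane_eq_iff: "plane y = plane z \<longleftrightarrow> y = z"
  using pt_in_plane[of 0 1 0 y y] pt_in_plane[of 0 1 0 y z] by auto

lemma Ppt_eq_iff: "Ppt y = Ppt z \<longleftrightarrow> y = z"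
  unfolding Ppt_def by (subst pt_eq_iff) auto

text \<open>A subline contains a point \<open>R\<close> other than the vertex. The plane forces its
  second coordinate to satisfy cj y = v y, so y is an F-multiple of \<open>e\<close> and
  \<open>R\<close> can be rescaled to an \<open>Lpt\<close>; only \<open>rU1\<close> has y = 0.
  Conversely, Hilbert 90 for \<open>u\<close> shows that the vertex itself belongs to
  \<open>baer q \<alpha>\<close>.\<close>

lemma pencil_line_iff:
  assumes u: "u \<in> U" and v: "v \<in> U" and \<alpha>: "\<alpha> \<noteq> 0" and e: "e \<noteq> 0" "cj e = v * e"
  shows "l \<in> pencil q \<alpha> u v \<and> l \<noteq> rU1 \<longleftrightarrow> (\<exists>x. l = join (Ppt (\<alpha> * u)) (Lpt \<alpha> x e))"
proof
  assume l: "l \<in> pencil q \<alpha> u v \<and> l \<noteq> rU1"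
  let ?B = "plane (\<alpha> * v) \<inter> baer q \<alpha>"
  from l obtain A C where AC: "l = join A C" "A \<in> points" "C \<in> points" "A \<noteq> C"
    and Pl: "Ppt (\<alpha> * u) \<in> l"
    and sub: "l \<inter> ?B \<in> sublines ?B" by (auto simp: pencil_def lines_def)
  from sub obtain P Q where PQ: "P \<in> ?B" "Q \<in> ?B" "P \<noteq> Q" "l \<inter> ?B = join P Q \<inter> ?B"
    by (auto simp: sublines_def)
  have pts: "P \<in> points" "Q \<in> points" using PQ by (auto simp: plane_def)
  then have "P \<in> l" "Q \<in> l" using PQ points_in_join by blast+
  then obtain R where R: "R \<in> l" "R \<in> ?B" "R \<noteq> Ppt (\<alpha> * u)" using PQ by metis
  have eq: "l = join (Ppt (\<alpha> * u)) R"
    unfolding AC(1) by (rule join_eq_join[symmetric]) (use AC Pl R in auto)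
  obtain x y where xy: "R = pt x y (\<alpha> * cj x) (\<alpha> * cj y)" "(x, y) \<noteq> (0, 0)"
    using R(2) unfolding baer_eq by blast
  have "\<alpha> * cj y = \<alpha> * v * y" using R(2) unfolding xy by (auto simp: pt_in_plane)
  then have cy: "cj y = v * y" using \<alpha> by simp
  have "y \<noteq> 0"
  proof
    assume "y = 0"
    then have "Ppt (\<alpha> * u) \<in> rU1" "R \<in> rU1"
      using xy(2) unfolding xy(1) Ppt_def by (auto simp: pt_in_rU1)
    then have "l = rU1" unfolding eq rU1_def using R(3)
      by (intro join_eq_join) (auto simp: U1_def U3_def pt_in_points)
    then show False using l by simp
  qed
  have "cj (y / e) = y / e" using cy e v by (auto simp: in_U)
  moreover have "cj y = y / e * cj e" using cy e by simp
  ultimately have t: "cj y = y / e * cj e" "cj (y / e) = y / e" by simp_all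
  have "x = y / e * (x / (y / e))" using \<open>y \<noteq> 0\<close> e(1) by simp
  moreover from this have "cj x = y / e * cj (x / (y / e))" by (metis cj_mult t(2))
  ultimately have "Lpt \<alpha> (x / (y / e)) e = R" unfolding Lpt_def xy(1)
    using \<open>y \<noteq> 0\<close> e(1) t(1) 
    by (subst pt_eq_iff) (auto intro!: exI[of _ "y / e"])
  then show "\<exists>x. l = join (Ppt (\<alpha> * u)) (Lpt \<alpha> x e)" using eq by blast
next
  assume "\<exists>x. l = join (Ppt (\<alpha> * u)) (Lpt \<alpha> x e)"
  then obtain x where l: "l = join (Ppt (\<alpha> * u)) (Lpt \<alpha> x e)" by blast
  let ?P = "Ppt (\<alpha> * u)" and ?Q = "Lpt \<alpha> x e" and ?B = "plane (\<alpha> * v) \<inter> baer q \<alpha>"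
  have pts: "?P \<in> points" "?Q \<in> points" using e by (auto simp: Ppt_def Lpt_def pt_in_points)
  have ne: "?P \<noteq> ?Q" unfolding Ppt_def Lpt_def using e by (subst pt_eq_iff) auto
  have "?Q \<in> baer q \<alpha>" using e(1) unfolding Lpt_def baer_eq by blast
  then have "?Q \<in> ?B" using e by (auto simp: Lpt_def pt_in_plane)
  moreover have "?P \<in> ?B"
  proof -
    obtain x0 where x0: "x0 \<noteq> 0" "cj x0 = u * x0" using hilbert90[OF u] by blast
    have "?P = pt x0 0 (\<alpha> * cj x0) (\<alpha> * cj 0)" unfolding Ppt_def x0(2)
      by (subst pt_eq_iff) (use x0(1) in \<open>auto intro!: exI[of _ x0]\<close>)
    then have "?P \<in> baer q \<alpha>" unfolding baer_eq using x0(1) by blast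
    then show ?thesis by (auto simp: Ppt_def pt_in_plane)
  qed
  ultimately have "l \<inter> ?B \<in> sublines ?B" using ne unfolding l sublines_def by blast
  moreover have "l \<subseteq> plane (\<alpha> * v)"
    unfolding l subset_iff points_of_pencil_line[OF e(1)] using e
    by (auto simp: Ppt_def pt_in_plane)
  moreover have "?P \<in> l" "?Q \<in> l" unfolding l using pts by (auto intro: points_in_join)
  moreover have "l \<in> lines" unfolding l lines_def using pts ne by blast
  moreover have "?Q \<notin> rU1" unfolding Lpt_def pt_in_rU1 using e by auto
  ultimately show "l \<in> pencil q \<alpha> u v \<and> l \<noteq> rU1" by (auto simp: pencil_def)
qed

section \<open>Reguli and regular spreads through the special line\<close>

lemma dep_trans:
  assumes "x * cj y = y * cj x" "x * cj z = z * cj x" "x \<noteq> 0"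
  shows "y * cj z = z * cj y"
proof -
  have "(x * cj x) * (y * cj z) = (x * cj z) * (y * cj x)" by (simp add: mult_ac)
  also have "\<dots> = (z * cj x) * (x * cj y)" using assms(1,2) by simp
  finally have "(x * cj x) * (y * cj z) = (x * cj x) * (z * cj y)" by (simp add: mult_ac)
  then show ?thesis using assms(3) by simp
qed

lemma M_Int_M:
  assumes "x * cj x' \<noteq> x' * cj x" "y * cj y' \<noteq> y' * cj y"
  shows "M x z y \<inter> M x' z' y' = {}"
proof (rule ccontr)
  assume "M x z y \<inter> M x' z' y' \<noteq> {}"
  then obtain X Y where XY: "(X, Y) \<noteq> (0, 0)" "(X, Y) \<in> sp x 0 z y" "(X, Y) \<in> sp x' 0 z' y'"
    unfolding M_def by (subst (asm) pp_Int_ne) (auto simp: scaled_sp)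
  obtain a b where ab: "a \<in> F" "b \<in> F" "X = a * x + b * z" "Y = b * y"
    using XY(2) by (auto simp: in_sp)
  obtain a' b' where ab': "a' \<in> F" "b' \<in> F" "X = a' * x' + b' * z'" "Y = b' * y'"
    using XY(3) by (auto simp: in_sp)
  have "b * y + 0 * y' = 0 * y + b' * y'" using ab ab' by simp
  then have "b = 0" "0 = b'" using unique_coordinates[OF assms(2)] ab(2) ab'(2) by (metis F_closed(1))+
  moreover from this have "a * x + 0 * x' = 0 * x + a' * x'" using ab ab' by simp
  then have "a = 0" using unique_coordinates[OF assms(1)] ab(1) ab'(1) by (metis F_closed(1))
  ultimately show False using XY(1) ab by simp
qed

definition RG :: "'a \<Rightarrow> 'a \<Rightarrow> 'a \<Rightarrow> 'a \<Rightarrow> 'a point set set" where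
  "RG m n m' n' = insert Linf {G (m + t * m') (n + t * n') | t. t \<in> F}"

text \<open>
  The opposite lines used are those through \<open>(f y, y)\<close> and \<open>(g y, 0)\<close> for \<open>y = 1, w, 1 + w\<close>: a
  graph of \<open>h\<close> meets them all iff these three \<open>y\<close> are eigenvectors of \<open>g\<^sup>-\<^sup>1 (h - f)\<close>, that
  is, iff \<open>g\<^sup>-\<^sup>1 (h - f)\<close> is a scalar.
\<close>

lemma regulus_RG:
  assumes ns: "\<And>y. y \<noteq> 0 \<Longrightarrow> m' * y + n' * cj y \<noteq> 0"
  shows "regulus B (RG m n m' n')"
proof -
  obtain w where "w \<notin> F" using ex_not_in_F by blast
  then have w: "cj w \<noteq> w" "w \<noteq> 0" "1 + w \<noteq> 0" by (auto simp: in_F add_eq_0_iff)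
  define f where "f y = m * y + n * cj y" for y
  define g where "g y = m' * y + n' * cj y" for y
  define l where "l y = M (g y) (f y) y" for y
  have g: "g y \<noteq> 0" if "y \<noteq> 0" for y using ns[OF that] by (simp add: g_def)
  \<comment> \<open>\<open>g\<close> is F-linear with trivial kernel and hence preserves
    independence.\<close>
  have g_indep: "g y * cj (g z) \<noteq> g z * cj (g y)" if "y * cj z \<noteq> z * cj y" for y z
  proof
    assume eq: "g y * cj (g z) = g z * cj (g y)"
    have "z \<noteq> 0" using that by auto
    then have t: "g y / g z \<in> F" using eq g by (intro dependent_imp_ratio) auto
    have "g (y - g y / g z * z) = g y - g y / g z * g z"
    proof -
      have "g (y - t * z) = g y - t * g z" if "t \<in> F" for t
        using that by (simp add: g_def in_F algebra_simps)
      then show ?thesis using t by blast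
    qed
    also have "\<dots> = 0" using g \<open>z \<noteq> 0\<close> by simp
    finally have "y - g y / g z * z = 0" using g by metis
    then show False using that ratio_imp_dependent[OF t, of z] by (simp add: mult_ac)
  qed
  have ind: "1 * cj w \<noteq> w * cj 1" "1 * cj (1 + w) \<noteq> (1 + w) * cj 1" "w * cj (1 + w) \<noteq> (1 + w) * cj w"
    using w by (simp_all add: algebra_simps)
  have skew: "l y \<inter> l z = {}" if "y * cj z \<noteq> z * cj y" for y z
    unfolding l_def by (rule M_Int_M) (use that g_indep in auto)
  have sub: "l y \<in> sublines B" if "y \<noteq> 0" for y
    unfolding l_def using g that by (intro M_subline)
  note sub = sub[OF one_neq_zero] sub[OF w(2)] sub[OF w(3)]
  have G_l: "G M' N' \<inter> l y \<noteq> {} \<longleftrightarrow> (\<exists>t\<in>F. M' * y + N' * cj y = f y + t * g y)" if "y \<noteq> 0" for M' N' y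
    unfolding l_def by (rule G_Int_M[OF g[OF that] that])
  have "RG m n m' n' = transversals B {l 1, l w, l (1 + w)}"
  proof (intro set_eqI iffI)
    fix r assume "r \<in> RG m n m' n'"
    then consider "r = Linf" | t where "t \<in> F" "r = G (m + t * m') (n + t * n')"
      by (auto simp: RG_def)
    then show "r \<in> transversals B {l 1, l w, l (1 + w)}"
    proof cases
      case 1
      have "Linf \<inter> l y \<noteq> {}" if "y \<noteq> 0" for y
        using M_Int_Linf[OF g[OF that]] unfolding l_def by (simp add: Int_commute)
      then show ?thesis using 1 w Linf_subline by (simp add: transversals_def)
    next
      case 2
      have "r \<inter> l y \<noteq> {}" if "y \<noteq> 0" for y
        unfolding 2 using 2(1) that
        by (subst G_l) (auto intro!: bexI[of _ t] simp: f_def g_def algebra_simps)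
      then show ?thesis using 2 w G_subline by (simp add: transversals_def)
    qed
  next
    fix r assume "r \<in> transversals B {l 1, l w, l (1 + w)}"
    then have r: "r \<in> sublines B" "r \<inter> l 1 \<noteq> {}" "r \<inter> l w \<noteq> {}" "r \<inter> l (1 + w) \<noteq> {}"
      by (auto simp: transversals_def)
    from r(1) show "r \<in> RG m n m' n'"
    proof (cases rule: subline_cases)
      case 1
      then show ?thesis by (simp add: RG_def)
    next
      case (2 M' N')
      define h where "h y = M' * y + N' * cj y" for y
      obtain t1 t2 t3 where t: "t1 \<in> F" "t2 \<in> F" "t3 \<in> F"
        "h 1 = f 1 + t1 * g 1" "h w = f w + t2 * g w" "h (1 + w) = f (1 + w) + t3 * g (1 + w)"
        using r(2-4) unfolding 2 G_l[OF one_neq_zero] G_l[OF w(2)] G_l[OF w(3)] h_def by blast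
      \<comment> \<open>Additivity compares the three eigenvalues: as g 1 and g w are independent,
        both \<open>t1\<close> and \<open>t2\<close> equal \<open>t3\<close>.\<close>
      have "h (1 + w) = h 1 + h w" "f (1 + w) = f 1 + f w" "g (1 + w) = g 1 + g w"
        by (simp_all add: h_def f_def g_def algebra_simps)
      then have "t1 * g 1 + t2 * g w = t3 * g 1 + t3 * g w" using t(4-6) by (simp add: algebra_simps)
      then have "t1 = t3" "t2 = t3"
        using unique_coordinates[OF g_indep[OF ind(1)]] t(1-3) by blast+
      then have h: "h 1 = f 1 + t3 * g 1" "h w = f w + t3 * g w" using t by auto
      define a where "a = M' - (m + t3 * m')"
      define b where "b = N' - (n + t3 * n')"
      have "a + b = 0" using h(1) by (simp add: a_def b_def h_def f_def g_def algebra_simps)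
      then have b: "b = - a" by (simp add: eq_neg_iff_add_eq_0 add.commute)
      have "a * w + b * cj w = 0" using h(2) by (simp add: a_def b_def h_def f_def g_def algebra_simps)
      then have "a * (w - cj w) = 0" unfolding b by (simp add: algebra_simps)
      then have "a = 0" using w by simp
      then have "r = G (m + t3 * m') (n + t3 * n')" using b 2 by (simp add: a_def b_def)
      then show ?thesis using t(3) by (auto simp: RG_def)
    next
      case (3 x z y0)
      \<comment> \<open>Each alternative can hold for at most one of three pairwise independent y,
        so a line \<open>M\<close> cannot meet all three opposite lines.\<close>
      have dep: "x * cj (g y) = g y * cj x \<or> y0 * cj y = y * cj y0" if "r \<inter> l y \<noteq> {}" for y
        using that M_Int_M unfolding 3 l_def by blast
      have no2: "\<not> (x * cj (g y) = g y * cj x \<and> x * cj (g z) = g z * cj x)"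
        "\<not> (y0 * cj y = y * cj y0 \<and> y0 * cj z = z * cj y0)" if "y * cj z \<noteq> z * cj y" for y z
        using dep_trans g_indep that 3(2,3) by blast+
      show ?thesis using dep[OF r(2)] dep[OF r(3)] dep[OF r(4)] no2[OF ind(1)] no2[OF ind(2)] no2[OF ind(3)]
        by blast
    qed
  qed
  then show ?thesis unfolding regulus_def using sub skew[OF ind(1)] skew[OF ind(2)] skew[OF ind(3)] by blast
qed

lemma D_cases:
  assumes "l \<in> D_spread q \<eta>"
  obtains "l = Linf" | c where "l = G c 0"
  using assms by (auto simp: D_spread_eq)

lemma subline_meeting_Linf:
  assumes "l \<in> sublines B" "Linf \<inter> l \<noteq> {}" "l \<noteq> Linf"
  obtains x z y where "l = M x z y" "x \<noteq> 0" "y \<noteq> 0"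
  using assms(1) by (rule subline_cases) (use assms G_Int_Linf in \<open>auto simp: Int_commute\<close>)

text \<open>
  Through each point of one opposite line passes a transversal of the other two, and if it lies
  in the spread then it is the spread line through that point.
\<close>

lemma regulus_in_D:
  assumes R: "regulus B R" "R \<subseteq> D_spread q \<eta>" "Linf \<in> R"
  obtains c d where "d \<noteq> 0" "R = RG c 0 d 0"
proof -
  obtain l1 l2 l3 where l: "l1 \<in> sublines B" "l2 \<in> sublines B" "l3 \<in> sublines B"
    "l1 \<inter> l2 = {}" "l1 \<inter> l3 = {}" "l2 \<inter> l3 = {}" "R = transversals B {l1, l2, l3}"
    using R(1) by (auto simp: regulus_def)
  have inR: "r \<in> R \<longleftrightarrow> r \<in> sublines B \<and> r \<inter> l1 \<noteq> {} \<and> r \<inter> l2 \<noteq> {} \<and> r \<inter> l3 \<noteq> {}" for r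
    by (auto simp: l(7) transversals_def)
  have meet: "Linf \<inter> l1 \<noteq> {}" "Linf \<inter> l2 \<noteq> {}" "Linf \<inter> l3 \<noteq> {}" using R(3) inR by auto
  then have ne: "l1 \<noteq> Linf" "l2 \<noteq> Linf" "l3 \<noteq> Linf" using l(4-6) by auto
  obtain x1 z1 y1 where l1: "l1 = M x1 z1 y1" "x1 \<noteq> 0" "y1 \<noteq> 0"
    by (rule subline_meeting_Linf[OF l(1) meet(1) ne(1)])
  obtain x2 z2 y2 where l2: "l2 = M x2 z2 y2" "x2 \<noteq> 0" "y2 \<noteq> 0"
    by (rule subline_meeting_Linf[OF l(2) meet(2) ne(2)])
  obtain x3 z3 y3 where l3: "l3 = M x3 z3 y3" "x3 \<noteq> 0" "y3 \<noteq> 0"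
    by (rule subline_meeting_Linf[OF l(3) meet(3) ne(3)])
  \<comment> \<open>Skewness of \<open>l2\<close> and \<open>l3\<close> makes \<open>x2\<close>,
    \<open>x3\<close> a basis over F, and likewise \<open>y2\<close>, \<open>y3\<close>: if the
    latter were dependent, the first basis could be used to adjust the x-coordinates to a common
    point.\<close>
  have x23: "x2 * cj x3 \<noteq> x3 * cj x2"
  proof
    assume "x2 * cj x3 = x3 * cj x2"
    then have "x2 / x3 \<in> F" using l3 by (intro dependent_imp_ratio)
    then have "emb (x2, 0) \<in> l3" unfolding l3(1) using l2(2) l3(2)
      by (subst emb_in_M) (simp, rule bexI[of _ "x2 / x3"], rule bexI[of _ 0], auto)
    then show False using l(6) emb_pair_in_M[OF l2(2)] l2(1) by blast
  qed
  have y23: "y2 * cj y3 \<noteq> y3 * cj y2"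
  proof
    assume "y2 * cj y3 = y3 * cj y2"
    then have t: "y2 / y3 \<in> F" using l3 by (intro dependent_imp_ratio)
    obtain a b where ab: "a \<in> F" "b \<in> F" "y2 / y3 * z3 - z2 = a * x2 + b * x3"
      using coordinates[OF x23] by blast
    have "emb (a * x2 + z2, y2) \<in> l2" unfolding l2(1) using l2(3) ab
      by (subst emb_in_M) (simp, rule bexI[of _ a], rule bexI[of _ 1], auto)
    moreover have "a * x2 + z2 = - b * x3 + y2 / y3 * z3" using ab(3) by (simp add: algebra_simps)
    then have "emb (a * x2 + z2, y2) \<in> l3" unfolding l3(1) using l2(3) l3(3) ab t
      by (subst emb_in_M) (simp, rule bexI[of _ "- b"], rule bexI[of _ "y2 / y3"], auto)
    ultimately show False using l(6) by blast
  qed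
  have "G (z1 / y1 + t * (x1 / y1)) 0 \<in> R" if "t \<in> F" for t
  proof -
    \<comment> \<open>The vector (?p, y1) of \<open>l1\<close> is the sum of a vector of
      \<open>l2\<close> and one of \<open>l3\<close>; the line through the two summands is the
      transversal sought.\<close>
    let ?p = "z1 + t * x1"
    obtain b2 b3 where b: "b2 \<in> F" "b3 \<in> F" "y1 = b2 * y2 + b3 * y3"
      using coordinates[OF y23] by blast
    obtain a2 a3 where a: "a2 \<in> F" "a3 \<in> F" "?p - b2 * z2 - b3 * z3 = a2 * x2 + a3 * x3"
      using coordinates[OF x23] by blast
    define p2 where "p2 = a2 * x2 + b2 * z2"
    define p3 where "p3 = a3 * x3 + b3 * z3"
    have p: "?p = p2 + p3" using a(3) by (simp add: p2_def p3_def algebra_simps)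
    have P1: "emb (?p, y1) \<in> l1" unfolding l1(1) using l1(3) that
      by (subst emb_in_M) (simp, rule bexI[of _ t], rule bexI[of _ 1], auto)
    have P2: "emb (p2, b2 * y2) \<in> l2" if "(p2, b2 * y2) \<noteq> (0, 0)"
      unfolding l2(1) using a b by (subst emb_in_M[OF that]) (auto simp: p2_def)
    have P3: "emb (p3, b3 * y3) \<in> l3" if "(p3, b3 * y3) \<noteq> (0, 0)"
      unfolding l3(1) using a b by (subst emb_in_M[OF that]) (auto simp: p3_def)
    have nz2: "(p2, b2 * y2) \<noteq> (0, 0)"
    proof
      assume z: "(p2, b2 * y2) = (0, 0)"
      then have "emb (?p, y1) \<in> l3" using P3 p b(3) l1(3) by auto
      then show False using P1 l(5) by blast
    qed
    have nz3: "(p3, b3 * y3) \<noteq> (0, 0)"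
    proof
      assume z: "(p3, b3 * y3) = (0, 0)"
      then have "emb (?p, y1) \<in> l2" using P2 p b(3) l1(3) by auto
      then show False using P1 l(4) by blast
    qed
    have "emb (p2, b2 * y2) \<noteq> emb (p3, b3 * y3)" using P2[OF nz2] P3[OF nz3] l(6) by auto
    note sub = pp_sp_subline[OF nz2 nz3 this]
    let ?m = "pp (sp p2 (b2 * y2) p3 (b3 * y3))"
    have in_m: "emb (s * p2 + t * p3, s * (b2 * y2) + t * (b3 * y3)) \<in> ?m"
      if "s \<in> F" "t \<in> F" "(s * p2 + t * p3, s * (b2 * y2) + t * (b3 * y3)) \<noteq> (0, 0)" for s t
      unfolding emb_in_pp[OF scaled_sp that(3)] in_sp using that(1,2) by blast
    have m1: "emb (?p, y1) \<in> ?m" using in_m[of 1 1] p b(3) l1(3) by simp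
    have m2: "emb (p2, b2 * y2) \<in> ?m" using in_m[of 1 0] nz2 by simp
    have m3: "emb (p3, b3 * y3) \<in> ?m" using in_m[of 0 1] nz3 by simp
    have "?m \<in> R" unfolding inR using sub m1 m2 m3 P1 P2[OF nz2] P3[OF nz3] by blast
    then have "?m \<in> D_spread q \<eta>" using R(2) by blast
    then have "?m = G (?p / y1) 0"
    proof (cases rule: D_cases)
      case 1
      then show ?thesis using m1 emb_in_Linf[of ?p y1] l1(3) by simp
    next
      case (2 c)
      then have "?p = c * y1" using m1 emb_in_G[of ?p y1 c 0] l1(3) by simp
      then show ?thesis using 2 l1(3) by simp
    qed
    moreover have "?p / y1 = z1 / y1 + t * (x1 / y1)" by (simp add: add_divide_distrib)
    ultimately show ?thesis using \<open>?m \<in> R\<close> by simp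
  qed
  then have "RG (z1 / y1) 0 (x1 / y1) 0 \<subseteq> R" using R(3) by (auto simp: RG_def)
  moreover have "R \<subseteq> RG (z1 / y1) 0 (x1 / y1) 0"
  proof
    fix r assume r: "r \<in> R"
    then have "r \<in> D_spread q \<eta>" using R(2) by blast
    then show "r \<in> RG (z1 / y1) 0 (x1 / y1) 0"
    proof (cases rule: D_cases)
      case 1
      then show ?thesis by (simp add: RG_def)
    next
      case (2 c)
      have "G c 0 \<inter> M x1 z1 y1 \<noteq> {}" using r inR 2 l1(1) by blast
      then obtain t where "t \<in> F" "c * y1 + 0 * cj y1 = z1 + t * x1"
        using G_Int_M l1(2,3) by blast
      moreover from this have "c = z1 / y1 + t * (x1 / y1)" using l1(3) by (simp add: field_simps)
      ultimately show ?thesis using 2 by (auto simp: RG_def)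
    qed
  qed
  ultimately have "R = RG (z1 / y1) 0 (x1 / y1) 0" by blast
  then show ?thesis using that[of "x1 / y1" "z1 / y1"] l1 by simp
qed

lemma regulus_RG_D: "d \<noteq> 0 \<Longrightarrow> regulus B (RG c 0 d 0)"
  by (rule regulus_RG) auto

lemma RG_subset_D: "RG c 0 d 0 \<subseteq> D_spread q \<eta>"
  by (auto simp: RG_def D_spread_eq)

lemma Linf_in_RG: "Linf \<in> RG m n m' n'"
  by (simp add: RG_def)

lemma G_in_RG: "G a b \<in> RG c 0 d 0 \<longleftrightarrow> b = 0 \<and> (\<exists>t\<in>F. a = c + t * d)"
  by (auto simp: RG_def G_eq_iff G_ne_Linf)

text \<open>This line serves as a marker: two members of the parallelism that both contain it are
  equal.\<close>

lemma M_in_transversals: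
  assumes "d \<noteq> 0"
  shows "M d c 1 \<in> transversals B (RG c 0 d 0)"
proof -
  have "M d c 1 \<inter> G (c + t * d) 0 \<noteq> {}" if "t \<in> F" for t
    using G_Int_M[of d 1 "c + t * d" 0 c] assms that by (auto simp: Int_commute)
  moreover have "M d c 1 \<inter> Linf \<noteq> {}" using assms by (intro M_Int_Linf)
  ultimately show ?thesis using M_subline[of d 1 c] assms by (auto simp: transversals_def RG_def)
qed

text \<open>Meeting the graphs of slopes c' and c' + d' puts both slopes into c + F d, and hence
  their difference into F d.\<close>

lemma direction_of_transversal:
  assumes "d \<noteq> 0" "M d c 1 \<in> transversals B (RG c' 0 d' 0)"
  shows "d' / d \<in> F"
proof -
  have ex: "\<exists>t\<in>F. c' + s * d' = c + t * d" if "s \<in> F" for s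
  proof -
    have "G (c' + s * d') 0 \<inter> M d c 1 \<noteq> {}"
      using assms(2) that by (auto simp: transversals_def RG_def Int_commute)
    then show ?thesis using G_Int_M[of d 1 "c' + s * d'" 0 c] assms(1) by auto
  qed
  obtain t0 where t0: "t0 \<in> F" "c' = c + t0 * d" using ex[of 0] by auto
  obtain t1 where t1: "t1 \<in> F" "c' + d' = c + t1 * d" using ex[of 1] by auto
  have "d' = (t1 - t0) * d" using t0 t1 by (simp add: algebra_simps)
  then show ?thesis using assms(1) t0 t1 by simp
qed

section \<open>Regular spreads containing a regulus of the given spread, and their Hall
  spreads\<close>

lemma spread_disjoint:
  assumes "line_spread B S" "l \<in> S" "l' \<in> S" "l \<inter> l' \<noteq> {}"
  shows "l = l'"
  using assms unfolding line_spread_def partition_on_def disjoint_def by blast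

lemma parallelism_disjoint:
  assumes "line_parallelism B \<Omega>" "H \<in> \<Omega>" "H' \<in> \<Omega>" "l \<in> H" "l \<in> H'"
  shows "H = H'"
  using assms unfolding line_parallelism_def partition_on_def disjoint_def by blast

text \<open>The lines that survive the switching; \<open>s = 0\<close> would give the members of
  \<open>RG c 0 d 0\<close> other than \<open>Linf\<close>.\<close>

definition HG :: "'a \<Rightarrow> 'a \<Rightarrow> 'a \<Rightarrow> 'a \<Rightarrow> 'a point set set" where
  "HG c d \<mu> \<nu> = {G (c + d * (t + s * \<mu>)) (d * (s * \<nu>)) | s t. s \<in> F \<and> t \<in> F \<and> s \<noteq> 0}"

text \<open>The quotient \<open>- x / y\<close> has norm 1, so Hilbert 90 makes it
  \<open>cj z / z\<close>.\<close>

lemma same_norm: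
  assumes "x * cj x = y * cj y" "y \<noteq> 0"
  obtains z where "z \<noteq> 0" "x * z + y * cj z = 0"
proof -
  have "(- x / y) * cj (- x / y) = 1" using assms by simp
  then have "- x / y \<in> U" by (simp add: in_U)
  then obtain z where "z \<noteq> 0" "cj z = - x / y * z" using hilbert90 by blast
  then show ?thesis using that assms(2) by simp
qed

text \<open>
  Among the lines \<open>x = f y\<close> of a regular spread, closure under reguli through \<open>Linf\<close> is closure
  of the set of all \<open>f\<close> under affine combinations over \<open>F\<close>; as \<open>F\<close> has a third element, that set
  is an affine subspace, and it has dimension two because \<open>f \<mapsto> f 1\<close> is a bijection onto the field.
\<close>

lemma desarguesian_structure:
  assumes S: "desarguesian B S" "RG c 0 d 0 \<subseteq> S" and d: "d \<noteq> 0"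
  obtains \<mu> \<nu> where "\<mu> + \<nu> \<notin> F" "\<And>t. t \<in> F \<Longrightarrow> (\<mu> + t) * cj (\<mu> + t) \<noteq> \<nu> * cj \<nu>"
    "S = insert Linf {G (c + d * (t + s * \<mu>)) (d * (s * \<nu>)) | s t. s \<in> F \<and> t \<in> F}"
proof -
  have ls: "line_spread B S" using S(1) by (simp add: desarguesian_def)
  have LS: "Linf \<in> S" using S(2) Linf_in_RG by blast
  have S_cases: "l = Linf \<or> (\<exists>a b. l = G a b)" if "l \<in> S" for l
  proof -
    have "l \<in> sublines B" using that ls by (auto simp: line_spread_def)
    then show ?thesis
    proof (cases rule: subline_cases)
      case (3 x z y)
      then have "l = Linf" using spread_disjoint[OF ls that LS] M_Int_Linf by blast
      then show ?thesis by simp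
    qed auto
  qed
  define P where "P x y \<longleftrightarrow> G (c + x) y \<in> S" for x y
  have affine: "P (x + t * (x' - x)) (y + t * (y' - y))" if "P x y" "P x' y'" "t \<in> F" for x y x' y' t
  proof (cases "G (c + x) y = G (c + x') y'")
    case True
    then show ?thesis using that by (simp add: G_eq_iff)
  next
    case False
    let ?R = "RG (c + x) y (x' - x) (y' - y)"
    have "regulus B ?R"
    proof (rule regulus_RG)
      fix z :: 'a assume "z \<noteq> 0"
      have "G (c + x) y \<inter> G (c + x') y' = {}" using False spread_disjoint[OF ls] that by (auto simp: P_def)
      then have "(c + x) * z + y * cj z \<noteq> (c + x') * z + y' * cj z"
        using G_Int_G \<open>z \<noteq> 0\<close> by blast
      then show "(x' - x) * z + (y' - y) * cj z \<noteq> 0" by (simp add: algebra_simps)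
    qed
    moreover have "G (c + x + t * (x' - x)) (y + t * (y' - y)) \<in> ?R" if "t \<in> F" for t
      using that by (auto simp: RG_def)
    note inR = this
    have "{Linf, G (c + x) y, G (c + x') y'} \<subseteq> ?R"
      using inR[of 0] inR[of 1] Linf_in_RG by simp
    ultimately have "?R \<subseteq> S"
      using S(1) LS that(1,2) False G_ne_Linf unfolding desarguesian_def P_def by metis
    then show ?thesis using inR[OF that(3)] by (auto simp: P_def add.assoc)
  qed
  have P0: "P 0 0" and Pd: "P d 0"
    using S(2) G_in_RG[of "c + 0" 0 c d] G_in_RG[of "c + d" 0 c d]
    by (auto simp: P_def intro: bexI[of _ 0] bexI[of _ 1])
  have scale: "P (t * x) (t * y)" if "P x y" "t \<in> F" for t x y
    using affine[OF P0 that] by simp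
  \<comment> \<open>A sum x + x' is the affine combination of x / (1 - t0) and x' / t0 with weights
    1 - t0 and t0; this needs an element of F other than 0 and 1.\<close>
  obtain t0 where t0: "t0 \<in> F" "t0 \<noteq> 0" "t0 \<noteq> 1" using ex_F_not_01 by blast
  have add: "P (x + x') (y + y')" if "P x y" "P x' y'" for x y x' y'
  proof -
    have "P (inverse (1 - t0) * x) (inverse (1 - t0) * y)" "P (inverse t0 * x') (inverse t0 * y')"
      using that t0 by (auto intro!: scale)
    from affine[OF this t0(1)]
    have "P (inverse (1 - t0) * x + t0 * (inverse t0 * x' - inverse (1 - t0) * x))
      (inverse (1 - t0) * y + t0 * (inverse t0 * y' - inverse (1 - t0) * y))" .
    moreover have "inverse (1 - t0) * x + t0 * (inverse t0 * x' - inverse (1 - t0) * x) = x + x'" for x x'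
    proof -
      have "inverse (1 - t0) * x + t0 * (inverse t0 * x' - inverse (1 - t0) * x) =
        (1 - t0) * inverse (1 - t0) * x + t0 * inverse t0 * x'" by (simp add: algebra_simps)
      then show ?thesis using t0 by simp
    qed
    ultimately show ?thesis by simp
  qed
  \<comment> \<open>The second basis vector comes from the spread line through (c + d w, 1), a point
    that no line of the regulus contains because \<open>w\<close> is not in F.\<close>
  obtain w where w: "w \<notin> F" using ex_not_in_F by blast
  have "emb (c + d * w, 1) \<in> \<Union>S"
    using ls by (simp add: line_spread_def partition_on_def) (simp add: B_eq pp_def)
  then obtain l where l: "l \<in> S" "emb (c + d * w, 1) \<in> l" by blast
  moreover have "emb (c + d * w, 1) \<notin> Linf" by (subst emb_in_Linf) auto
  ultimately obtain a b where "l = G a b" using S_cases by blast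
  then have ab: "G a b \<in> S" "a + b = c + d * w"
    using l emb_in_G[of "c + d * w" 1 a b] by auto
  define \<mu> where "\<mu> = (a - c) / d"
  define \<nu> where "\<nu> = b / d"
  have \<mu>\<nu>: "a = c + d * \<mu>" "b = d * \<nu>" using d by (simp_all add: \<mu>_def \<nu>_def)
  have sum: "\<mu> + \<nu> = w" using ab(2) d unfolding \<mu>\<nu> by (simp add: add.assoc flip: distrib_left)
  have Pm: "P (d * \<mu>) (d * \<nu>)" using ab by (simp add: P_def \<mu>\<nu>)
  have Pst: "P (d * (t + s * \<mu>)) (d * (s * \<nu>))" if "s \<in> F" "t \<in> F" for s t
    using add[OF scale[OF Pd that(2)] scale[OF Pm that(1)]] by (simp add: algebra_simps)
  \<comment> \<open>Disjoint graphs differ at y = 1, and the graphs already found take every value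
    there.\<close>
  have conv: "\<exists>s\<in>F. \<exists>t\<in>F. x = d * (t + s * \<mu>) \<and> y = d * (s * \<nu>)" if "P x y" for x y
  proof -
    obtain t s where ts: "t \<in> F" "s \<in> F" "(x + y) / d = t * 1 + s * w"
      using coordinates[of 1 w "(x + y) / d"] w by (auto simp: in_F)
    then have "x + y = d * (t + s * w)" using d by (simp add: field_simps)
    then have "(c + x) * 1 + y * cj 1 = (c + d * (t + s * \<mu>)) * 1 + d * (s * \<nu>) * cj 1"
      unfolding sum[symmetric] by (simp add: algebra_simps)
    then have "G (c + x) y \<inter> G (c + d * (t + s * \<mu>)) (d * (s * \<nu>)) \<noteq> {}"
      using G_Int_G one_neq_zero by blast
    then have "G (c + x) y = G (c + d * (t + s * \<mu>)) (d * (s * \<nu>))"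
      using spread_disjoint[OF ls] that Pst[OF ts(2,1)] by (auto simp: P_def)
    then show ?thesis using ts by (auto simp: G_eq_iff)
  qed
  have "S = insert Linf {G (c + d * (t + s * \<mu>)) (d * (s * \<nu>)) | s t. s \<in> F \<and> t \<in> F}"
  proof (intro set_eqI iffI)
    fix l assume l: "l \<in> S"
    show "l \<in> insert Linf {G (c + d * (t + s * \<mu>)) (d * (s * \<nu>)) | s t. s \<in> F \<and> t \<in> F}"
    proof (cases "l = Linf")
      case False
      then obtain x y where xy: "l = G x y" using S_cases l by blast
      then have "P (x - c) y" using l by (simp add: P_def)
      then obtain s t where "s \<in> F" "t \<in> F" "x - c = d * (t + s * \<mu>)" "y = d * (s * \<nu>)"
        using conv by blast
      moreover from this have "x = c + d * (t + s * \<mu>)" by (simp add: diff_eq_eq add.commute)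
      ultimately show ?thesis using xy by blast
    qed simp
  qed (use LS Pst in \<open>auto simp: P_def\<close>)
  \<comment> \<open>Equal norms with \<open>\<nu>\<close> nonzero would make the graph with s = 1
    meet the line of slope \<open>c\<close> in the regulus, so they would coincide.\<close>
  moreover have "(\<mu> + t) * cj (\<mu> + t) \<noteq> \<nu> * cj \<nu>" if t: "t \<in> F" for t
  proof
    assume eq: "(\<mu> + t) * cj (\<mu> + t) = \<nu> * cj \<nu>"
    show False
    proof (cases "\<nu> = 0")
      case True
      then have "\<mu> + t = 0" using eq by (simp flip: cj_add)
      then have "w = - t" using sum True by (simp add: eq_neg_iff_add_eq_0)
      then show False using w t by simp
    next
      case False
      obtain z where z: "z \<noteq> 0" "(\<mu> + t) * z + \<nu> * cj z = 0"
        using eq False by (rule same_norm)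
      have "(c + d * (t + 1 * \<mu>)) * z + d * (1 * \<nu>) * cj z = (c + 0) * z + 0 * cj z + d * ((\<mu> + t) * z + \<nu> * cj z)"
        by (simp add: algebra_simps)
      then have "G (c + d * (t + 1 * \<mu>)) (d * (1 * \<nu>)) \<inter> G (c + 0) 0 \<noteq> {}"
        unfolding z(2) using G_Int_G z(1) by auto
      then have "G (c + d * (t + 1 * \<mu>)) (d * (1 * \<nu>)) = G (c + 0) 0"
        using spread_disjoint[OF ls] P0 Pst[OF _ t, of 1] by (auto simp: P_def)
      then show False using False d by (simp add: G_eq_iff)
    qed
  qed
  moreover have "\<mu> + \<nu> \<notin> F" using sum w by simp
  ultimately show ?thesis using that by blast
qed

lemma spread_Int_D_spread:
  fixes c \<mu> :: 'a
  assumes "\<nu> \<noteq> 0" "d \<noteq> 0"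
  defines "S \<equiv> insert Linf {G (c + d * (t + s * \<mu>)) (d * (s * \<nu>)) | s t. s \<in> F \<and> t \<in> F}"
  shows "D_spread q \<eta> \<inter> S = RG c 0 d 0" "S - RG c 0 d 0 = HG c d \<mu> \<nu>"
proof -
  have G_D: "G a b \<in> D_spread q \<eta> \<longleftrightarrow> b = 0" for a b
    by (auto simp: D_spread_eq G_eq_iff G_ne_Linf)
  show 1: "D_spread q \<eta> \<inter> S = RG c 0 d 0"
  proof (intro set_eqI iffI)
    fix l assume l: "l \<in> D_spread q \<eta> \<inter> S"
    then consider "l = Linf" | s t where "s \<in> F" "t \<in> F" "l = G (c + d * (t + s * \<mu>)) (d * (s * \<nu>))"
      unfolding S_def by blast
    then show "l \<in> RG c 0 d 0"
    proof cases
      case 1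
      then show ?thesis by (simp add: Linf_in_RG)
    next
      case (2 s t)
      then have "s = 0" using l G_D assms by auto
      then show ?thesis using 2 by (auto simp: G_in_RG mult.commute)
    qed
  next
    fix l assume "l \<in> RG c 0 d 0"
    then consider "l = Linf" | t where "t \<in> F" "l = G (c + t * d) 0" by (auto simp: RG_def)
    then show "l \<in> D_spread q \<eta> \<inter> S"
    proof cases
      case 1
      then show ?thesis by (simp add: S_def D_spread_eq)
    next
      case (2 t)
      then have "l = G (c + d * (t + 0 * \<mu>)) (d * (0 * \<nu>))" by (simp add: mult.commute)
      then have "l \<in> S" unfolding S_def using 2(1) F_closed(1) by blast
      then show ?thesis using 2(2) G_D by simp
    qed
  qed
  show "S - RG c 0 d 0 = HG c d \<mu> \<nu>"
  proof (intro set_eqI iffI)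
    fix l assume l: "l \<in> S - RG c 0 d 0"
    then have "l \<noteq> Linf" using Linf_in_RG by blast
    then obtain s t where st: "s \<in> F" "t \<in> F" "l = G (c + d * (t + s * \<mu>)) (d * (s * \<nu>))"
      using l S_def by blast
    moreover have "s \<noteq> 0"
    proof
      assume "s = 0"
      then have "l \<in> D_spread q \<eta>" unfolding st(3) G_D by simp
      then show False using l 1 by blast
    qed
    ultimately show "l \<in> HG c d \<mu> \<nu>" unfolding HG_def by blast
  next
    fix l assume "l \<in> HG c d \<mu> \<nu>"
    then obtain s t where st: "s \<in> F" "t \<in> F" "s \<noteq> 0" "l = G (c + d * (t + s * \<mu>)) (d * (s * \<nu>))"
      unfolding HG_def by blast
    then have "l \<in> S" unfolding S_def by blast
    moreover have "l \<notin> RG c 0 d 0" unfolding st(4) G_in_RG using st(3) assms(1,2) by simp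
    ultimately show "l \<in> S - RG c 0 d 0" by blast
  qed
qed

lemma hall_structure:
  assumes \<Omega>: "line_parallelism B \<Omega>" "D_spread q \<eta> \<in> \<Omega>" "H \<in> \<Omega>" and d: "d \<noteq> 0"
    and hall: "hall_by_switching B (RG c 0 d 0) H"
  obtains \<mu> \<nu> where "\<nu> \<noteq> 0" "\<And>t. t \<in> F \<Longrightarrow> (\<mu> + t) * cj (\<mu> + t) \<noteq> \<nu> * cj \<nu>"
    "H = HG c d \<mu> \<nu> \<union> transversals B (RG c 0 d 0)"
proof -
  let ?R = "RG c 0 d 0"
  obtain S where S: "desarguesian B S" "?R \<subseteq> S" "H = (S - ?R) \<union> transversals B ?R"
    using hall by (auto simp: hall_by_switching_def switch_def)
  obtain \<mu> \<nu> where m: "\<mu> + \<nu> \<notin> F" "\<And>t. t \<in> F \<Longrightarrow> (\<mu> + t) * cj (\<mu> + t) \<noteq> \<nu> * cj \<nu>"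
    and S_eq: "S = insert Linf {G (c + d * (t + s * \<mu>)) (d * (s * \<nu>)) | s t. s \<in> F \<and> t \<in> F}"
    using desarguesian_structure[OF S(1,2) d] by blast
  \<comment> \<open>Otherwise the unswitched lines include a line of
    \<open>D_spread q \<eta>\<close>, which forces \<open>H\<close> to equal that spread, although
    \<open>H\<close> contains the line \<open>M d c 1\<close>.\<close>
  have "\<nu> \<noteq> 0"
  proof
    assume "\<nu> = 0"
    have "G (c + d * (0 + 1 * \<mu>)) (d * (1 * \<nu>)) \<in> S" unfolding S_eq using F_closed(1,2) by blast
    then have "G (c + d * \<mu>) 0 \<in> S" using \<open>\<nu> = 0\<close> by simp
    moreover have "G (c + d * \<mu>) 0 \<notin> ?R"
      using m(1) \<open>\<nu> = 0\<close> d by (auto simp: G_in_RG mult.commute)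
    ultimately have "G (c + d * \<mu>) 0 \<in> H" using S(3) by blast
    moreover have "G (c + d * \<mu>) 0 \<in> D_spread q \<eta>" by (auto simp: D_spread_eq)
    ultimately have "H = D_spread q \<eta>" using parallelism_disjoint[OF \<Omega>(1,3,2)] by blast
    moreover have "M d c 1 \<in> H" using M_in_transversals[OF d] S(3) by blast
    ultimately have "M d c 1 \<in> D_spread q \<eta>" by simp
    then show False using M_ne_Linf[of d 1 c] G_ne_M[of d _ 0 c 1] d by (auto simp: D_spread_eq)
  qed
  have "S - ?R = HG c d \<mu> \<nu>"
    unfolding S_eq using \<open>\<nu> \<noteq> 0\<close> d by (rule spread_Int_D_spread(2))
  then show ?thesis using that[OF \<open>\<nu> \<noteq> 0\<close> m(2)] S(3) by simp
qed

text \<open>The parametrisation in \<open>SG\<close> is F-linear up to the offset; it sends 1 to (1,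
  0) and the \<open>w\<close> of the normal form to \<open>(\<mu>, \<nu>)\<close>, in units of
  \<open>d\<close>. As \<open>\<nu>\<close> is nonzero, 1 and \<open>w\<close> are a basis over
  F.\<close>

lemma normal_form_SG:
  assumes "normal_form \<mu> \<nu> k" and \<nu>: "\<nu> \<noteq> 0" and d: "d \<noteq> 0" and k: "k \<in> F" "k \<noteq> 1"
  obtains \<kappa> where "\<kappa> * cj \<kappa> = k" 
    "\<And>c. SG c d k \<kappa> = insert Linf {G (c + d * (t + s * \<mu>)) (d * (s * \<nu>)) | s t. s \<in> F \<and> t \<in> F}"
proof -
  obtain \<kappa> w where w: "\<kappa> * cj \<kappa> = k" "\<mu> = (w - k * cj w) / (1 - k)" "\<nu> = \<kappa> * (cj w - w) / (1 - k)"
    using assms(1) by (auto simp: normal_form_def)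
  have w1: "1 * cj w \<noteq> w * cj 1" using w(3) \<nu> by auto
  have k': "1 - k \<noteq> 0" "cj k = k" using k by (auto simp: in_F)
  have lin: "((t + s * w) - k * cj (t + s * w)) / (1 - k) = t + s * \<mu>"
    "\<kappa> * (cj (t + s * w) - (t + s * w)) / (1 - k) = s * \<nu>" if "s \<in> F" "t \<in> F" for s t
  proof -
    have "(t + s * w) - k * cj (t + s * w) = (1 - k) * t + s * (w - k * cj w)"
      "\<kappa> * (cj (t + s * w) - (t + s * w)) = s * (\<kappa> * (cj w - w))"
      using that by (simp_all add: in_F algebra_simps)
    then show "((t + s * w) - k * cj (t + s * w)) / (1 - k) = t + s * \<mu>"
      "\<kappa> * (cj (t + s * w) - (t + s * w)) / (1 - k) = s * \<nu>"
      using k' by (simp_all only: add_divide_distrib w(2,3)) simp_all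
  qed
  have "{G (c + d * ((w - k * cj w) / (1 - k))) (d * (\<kappa> * (cj w - w) / (1 - k))) | w. True} =
    {G (c + d * (t + s * \<mu>)) (d * (s * \<nu>)) | s t. s \<in> F \<and> t \<in> F}" (is "?A = ?B") for c
  proof (intro set_eqI iffI)
    fix l assume "l \<in> ?A"
    then obtain x where l: "l = G (c + d * ((x - k * cj x) / (1 - k))) (d * (\<kappa> * (cj x - x) / (1 - k)))"
      by blast
    obtain t s where st: "t \<in> F" "s \<in> F" "x = t + s * w" using coordinates[OF w1, of x] by auto
    show "l \<in> ?B" unfolding l st(3) lin[OF st(2,1)] using st(1,2) by blast
  next
    fix l assume "l \<in> ?B"
    then obtain s t where st: "s \<in> F" "t \<in> F" "l = G (c + d * (t + s * \<mu>)) (d * (s * \<nu>))" by blast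
    show "l \<in> ?A" unfolding st(3) lin[OF st(1,2), symmetric] by blast
  qed
  then show ?thesis using that[OF w(1)] unfolding SG_def by simp
qed

section \<open>Parallelisms invariant under \<open>E\<close>\<close>

definition shift :: "'a \<Rightarrow> 'a point \<Rightarrow> 'a point" where
  "shift b P = (\<lambda>x. (vector
       [vector [1, b, 0, 0],
        vector [0, 1, 0, 0],
        vector [0, 0, 1, b ^ q],
        vector [0, 0, 0, 1]] :: 'a ^ 4 ^ 4) *v x) ` P"

lemma shift_in_E: "shift b \<in> E_group q"
  unfolding E_group_def shift_def by blast

lemma shift_emb: "shift b (emb (x, y)) = emb (x + b * y, y)"
proof -
  have mv: "(vector [vector [1, b, 0, 0], vector [0, 1, 0, 0], vector [0, 0, 1, b ^ q],
      vector [0, 0, 0, 1]] :: 'a ^ 4 ^ 4) *v v =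
      vector [v $ 1 + b * v $ 2, v $ 2, v $ 3 + cj b * v $ 4, v $ 4]" for v
    by (simp add: vec4_eq_iff matrix_vector_mult_def sum_4 cj_def)
  have "shift b (emb (x, y)) = range (\<lambda>k. vector [k * x + b * (k * y), k * y,
      k * (\<eta> * cj x) + cj b * (k * (\<eta> * cj y)), k * (\<eta> * cj y)])"
    unfolding shift_def emb_def pt_def vec.span_singleton mv image_image by simp
  also have "\<dots> = emb (x + b * y, y)"
    unfolding emb_def pt_def vec.span_singleton
    by (intro image_cong) (simp_all add: vec4_eq_iff algebra_simps)
  finally show ?thesis .
qed

lemma shift_pp: "shift b ` pp V = pp ((\<lambda>(x, y). (x + b * y, y)) ` V)"
proof (intro set_eqI iffI)
  fix P assume "P \<in> shift b ` pp V"
  then obtain Q where "Q \<in> pp V" "P = shift b Q" by blast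
  moreover from this(1) obtain x y where xy: "Q = emb (x, y)" "(x, y) \<in> V" "(x, y) \<noteq> (0, 0)"
    by (rule pp_cases)
  ultimately have "P = emb (x + b * y, y)" using shift_emb by simp
  moreover have "(x + b * y, y) \<noteq> (0, 0)" using xy(3) by auto
  moreover have "(x + b * y, y) \<in> (\<lambda>(x, y). (x + b * y, y)) ` V" using xy(2) by force
  ultimately show "P \<in> pp ((\<lambda>(x, y). (x + b * y, y)) ` V)"
    unfolding pp_def by (intro image_eqI[of _ emb "(x + b * y, y)"]) auto
next
  fix P assume "P \<in> pp ((\<lambda>(x, y). (x + b * y, y)) ` V)"
  then obtain a y where a: "P = emb (a, y)" "(a, y) \<in> (\<lambda>(x, y). (x + b * y, y)) ` V" "(a, y) \<noteq> (0, 0)"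
    by (rule pp_cases)
  then obtain x where xy: "a = x + b * y" "(x, y) \<in> V" by auto
  then have "P = shift b (emb (x, y))" "(x, y) \<noteq> (0, 0)" using a by (auto simp: shift_emb)
  moreover from this(2) have "emb (x, y) \<in> pp V"
    using xy(2) unfolding pp_def by (intro image_eqI[of _ emb "(x, y)"]) auto
  ultimately show "P \<in> shift b ` pp V" by blast
qed

lemma shift_Linf: "shift b ` Linf = Linf"
proof -
  have "(\<lambda>(x, y). (x + b * y, y)) ` {(x, y). y = 0} = {(x, y). y = 0}" by force
  then show ?thesis by (simp add: Linf_def shift_pp)
qed

lemma shift_G: "shift b ` G m n = G (m + b) n"
proof -
  have "(\<lambda>(x, y). (x + b * y, y)) ` {(x, y). x = m * y + n * cj y} = {(x, y). x = (m + b) * y + n * cj y}"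
    by (auto simp: algebra_simps image_iff)
  then show ?thesis by (simp add: G_def shift_pp)
qed

lemma shift_M: "shift b ` M x z y = M x (z + b * y) y"
proof -
  have "(\<lambda>(x, y). (x + b * y, y)) ` sp x 0 z y = sp x 0 (z + b * y) y"
    by (auto simp: sp_def image_iff algebra_simps) blast+
  then show ?thesis by (simp add: M_def shift_pp)
qed

lemma shift_HG: "(\<lambda>l. shift b ` l) ` HG c d \<mu> \<nu> = HG (c + b) d \<mu> \<nu>"
proof -
  have "(\<lambda>l. shift b ` l) ` HG c d \<mu> \<nu> =
      {shift b ` G (c + d * (t + s * \<mu>)) (d * (s * \<nu>)) | s t. s \<in> F \<and> t \<in> F \<and> s \<noteq> 0}"
    unfolding HG_def by blast
  also have "\<dots> = HG (c + b) d \<mu> \<nu>" unfolding HG_def shift_G by (simp add: add_ac)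
  finally show ?thesis .
qed

text \<open>Together with \<open>HG_skew_Linf\<close> this tells the two parts of a Hall spread
  apart by incidence with \<open>Linf\<close>, which every \<open>shift\<close> fixes.\<close>

lemma transversals_RG_meet_Linf:
  "l \<in> transversals B (RG m n m' n') \<Longrightarrow> l \<inter> Linf \<noteq> {}"
  using Linf_in_RG[of m n m' n'] by (simp add: transversals_def)

lemma HG_skew_Linf: "l \<in> HG c d \<mu> \<nu> \<Longrightarrow> l \<inter> Linf = {}"
  using G_Int_Linf by (auto simp: HG_def)

lemma RG_scale:
  assumes "r \<in> F" "r \<noteq> 0"
  shows "RG c 0 (r * d) 0 = RG c 0 d 0"
proof -
  have "{G (c + t * (r * d)) (0 + t * 0) | t. t \<in> F} = {G (c + t * d) (0 + t * 0) | t. t \<in> F}"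
  proof (intro set_eqI iffI; clarify)
    fix t assume "t \<in> F"
    then show "\<exists>s. G (c + t * (r * d)) (0 + t * 0) = G (c + s * d) (0 + s * 0) \<and> s \<in> F"
      using assms by (intro exI[of _ "t * r"]) (simp add: mult.assoc)
    show "\<exists>s. G (c + t * d) (0 + t * 0) = G (c + s * (r * d)) (0 + s * 0) \<and> s \<in> F"
      using assms \<open>t \<in> F\<close> by (intro exI[of _ "t / r"]) simp
  qed
  then show ?thesis by (simp add: RG_def)
qed

end

locale invariant_parallelism = baer_space q ty \<eta>
  for q :: nat and ty :: "'a::{field,finite} itself" and \<eta> :: 'a +
  fixes \<Lambda> A :: "'a set" and \<Omega> :: "'a point set set set"
  assumes norm_transversal: "norm_transversal q \<Lambda>"
    and half_system: "half_system q A"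
    and parallelism: "line_parallelism B \<Omega>"
    and D_in: "D_spread q \<eta> \<in> \<Omega>"
    and Hall: "\<And>H. H \<in> \<Omega> - {D_spread q \<eta>} \<Longrightarrow>
      \<exists>R. regulus B R \<and> R \<subseteq> D_spread q \<eta> \<and> rU1 \<inter> B \<in> R \<and> hall_by_switching B R H"
    and unique: "\<And>R. \<lbrakk>regulus B R; R \<subseteq> D_spread q \<eta>; rU1 \<inter> B \<in> R\<rbrakk> \<Longrightarrow>
      \<exists>!H. H \<in> \<Omega> \<and> hall_by_switching B R H"
    and E_invariant: "\<And>g. g \<in> E_group q \<Longrightarrow> (\<lambda>S. (\<lambda>l. g ` l) ` S) ` \<Omega> = \<Omega>"
begin

abbreviation "I \<equiv> index_set q \<Lambda> A"

text \<open>The q - 1 distinct norms of \<open>\<Lambda>\<close> must exhaust the q - 1 nonzero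
  elements of F.\<close>

lemma Lambda_norms: "(\<lambda>\<alpha>. \<alpha> * cj \<alpha>) ` \<Lambda> = F - {0}" "inj_on (\<lambda>\<alpha>. \<alpha> * cj \<alpha>) \<Lambda>"
proof -
  show inj: "inj_on (\<lambda>\<alpha>. \<alpha> * cj \<alpha>) \<Lambda>"
    using norm_transversal unfolding norm_transversal_def norm_conv by blast
  show "(\<lambda>\<alpha>. \<alpha> * cj \<alpha>) ` \<Lambda> = F - {0}"
  proof (rule card_seteq)
    show "(\<lambda>\<alpha>. \<alpha> * cj \<alpha>) ` \<Lambda> \<subseteq> F - {0}"
      using norm_transversal by (auto simp: norm_transversal_def)
    show "card (F - {0}) \<le> card ((\<lambda>\<alpha>. \<alpha> * cj \<alpha>) ` \<Lambda>)"
      using norm_transversal card_image[OF inj] by (simp add: norm_transversal_def card_F)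
  qed simp
qed

lemma Fq_star_eq: "Fq_star q = F - {0}"
  by (auto simp: Fq_star_def F_def cj_def)

lemma in_I: "\<alpha> \<in> I \<longleftrightarrow> \<alpha> \<in> \<Lambda> \<and> (\<alpha> * cj \<alpha> \<in> A \<or> odd q \<and> \<alpha> * cj \<alpha> = - 1)"
  unfolding index_set_def norm_conv by auto

lemma I_norm:
  assumes "\<alpha> \<in> I"
  shows "\<alpha> \<noteq> 0" "\<alpha> * cj \<alpha> \<noteq> 1"
proof -
  show "\<alpha> \<noteq> 0" using assms norm_transversal by (auto simp: in_I norm_transversal_def)
  have "(- 1 :: 'a) \<noteq> 1" if "odd q"
  proof
    assume "(- 1 :: 'a) = 1"
    then have "(2::'a) = 0" by (metis add.right_inverse one_add_one)
    then show False using that two_eq_0_iff by simp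
  qed
  then show "\<alpha> * cj \<alpha> \<noteq> 1" using assms half_system by (auto simp: in_I half_system_def split: if_splits)
qed

lemma ex_I:
  assumes "k \<in> F" "k \<noteq> 0" "k \<noteq> 1" "k = - 1 \<Longrightarrow> odd q"
  obtains \<alpha> where "\<alpha> \<in> I" "\<alpha> * cj \<alpha> = k \<or> \<alpha> * cj \<alpha> = inverse k"
proof -
  have "k \<in> Fq_star q" using assms by (simp add: Fq_star_eq)
  then have "k \<in> A \<or> k \<in> inverse ` A \<or> odd q \<and> k = - 1"
    using half_system assms(3) unfolding half_system_def by (auto split: if_splits)
  then obtain k' where k': "k' = k \<or> k' = inverse k" "k' \<in> A \<or> odd q \<and> k' = - 1"
    by (metis imageE inverse_inverse_eq)
  have "k' \<in> F - {0}" using k'(1) assms by auto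
  then obtain \<alpha> where "\<alpha> \<in> \<Lambda>" "\<alpha> * cj \<alpha> = k'" unfolding Lambda_norms(1)[symmetric] by blast
  then show ?thesis using that k' by (auto simp: in_I)
qed

lemma hall_spread_exists:
  assumes "d \<noteq> 0"
  obtains H where "H \<in> \<Omega>" "hall_by_switching B (RG c 0 d 0) H"
proof -
  have "rU1 \<inter> B \<in> RG c 0 d 0" by (simp add: rU1_Int_B Linf_in_RG)
  with unique[OF regulus_RG_D[OF assms] RG_subset_D] show ?thesis using that by blast
qed

text \<open>
  Both the Hall spread at offset \<open>c\<close> and the translate by \<open>c\<close> of the one at offset \<open>0\<close> contain the
  line \<open>M d c 1\<close>, so they coincide.
\<close>

lemma hall_spread_family:
  assumes d: "d \<noteq> 0"
  obtains \<mu> \<nu> where "\<nu> \<noteq> 0" "\<And>t. t \<in> F \<Longrightarrow> (\<mu> + t) * cj (\<mu> + t) \<noteq> \<nu> * cj \<nu>"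
    "\<And>c. HG c d \<mu> \<nu> \<union> transversals B (RG c 0 d 0) \<in> \<Omega>"
proof -
  obtain H0 where H0: "H0 \<in> \<Omega>" "hall_by_switching B (RG 0 0 d 0) H0"
    using hall_spread_exists[OF d] by blast
  obtain \<mu> \<nu> where m: "\<nu> \<noteq> 0" "\<And>t. t \<in> F \<Longrightarrow> (\<mu> + t) * cj (\<mu> + t) \<noteq> \<nu> * cj \<nu>"
    and H0_eq: "H0 = HG 0 d \<mu> \<nu> \<union> transversals B (RG 0 0 d 0)"
    by (rule hall_structure[OF parallelism D_in H0(1) d H0(2)]) (rule that)
  have "HG c d \<mu> \<nu> \<union> transversals B (RG c 0 d 0) \<in> \<Omega>" for c
  proof -
    obtain H where H: "H \<in> \<Omega>" "hall_by_switching B (RG c 0 d 0) H"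
      using hall_spread_exists[OF d] by blast
    obtain \<mu>' \<nu>' where "\<nu>' \<noteq> 0" "\<And>t. t \<in> F \<Longrightarrow> (\<mu>' + t) * cj (\<mu>' + t) \<noteq> \<nu>' * cj \<nu>'"
      and H_eq: "H = HG c d \<mu>' \<nu>' \<union> transversals B (RG c 0 d 0)"
      by (rule hall_structure[OF parallelism D_in H(1) d H(2)]) (rule that)
    let ?gH = "(\<lambda>l. shift c ` l) ` H0"
    have gH_in: "?gH \<in> \<Omega>" using E_invariant[OF shift_in_E, of c] H0(1) by blast
    have "M d 0 1 \<in> H0" using M_in_transversals[OF d] H0_eq by blast
    then have "shift c ` M d 0 1 \<in> ?gH" by blast
    then have M_gH: "M d c 1 \<in> ?gH" by (simp add: shift_M)
    have "M d c 1 \<in> H" using M_in_transversals[OF d] H_eq by blast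
    with M_gH have gH: "?gH = H" by (rule parallelism_disjoint[OF parallelism gH_in H(1)])
    have HG: "HG c d \<mu> \<nu> = (\<lambda>l. shift c ` l) ` HG 0 d \<mu> \<nu>"
      using shift_HG[of c 0 d \<mu> \<nu>] by simp
    \<comment> \<open>Both sides are the lines skew to \<open>Linf\<close> in one and the same
      spread.\<close>
    have "HG c d \<mu> \<nu> = HG c d \<mu>' \<nu>'"
    proof (intro set_eqI iffI)
      fix l assume l: "l \<in> HG c d \<mu> \<nu>"
      then have "l \<in> H" using HG H0_eq gH by blast
      then show "l \<in> HG c d \<mu>' \<nu>'" using H_eq HG_skew_Linf[OF l] transversals_RG_meet_Linf by blast
    next
      fix l assume l: "l \<in> HG c d \<mu>' \<nu>'"
      then have "l \<in> ?gH" using H_eq gH by blast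
      then obtain l' where l': "l' \<in> H0" "l = shift c ` l'" by blast
      have "l' \<notin> transversals B (RG 0 0 d 0)"
      proof
        assume "l' \<in> transversals B (RG 0 0 d 0)"
        then have "l' \<inter> Linf \<noteq> {}" by (rule transversals_RG_meet_Linf)
        then have "l \<inter> shift c ` Linf \<noteq> {}" using l'(2) by blast
        then show False using HG_skew_Linf[OF l] by (simp add: shift_Linf)
      qed
      then show "l \<in> HG c d \<mu> \<nu>" using l' H0_eq HG by blast
    qed
    then show ?thesis using H_eq H(1) by simp
  qed
  then show ?thesis using that m by blast
qed

definition hall :: "'a \<Rightarrow> 'a \<Rightarrow> 'a \<Rightarrow> 'a \<Rightarrow> 'a point set set" where
  "hall c d \<alpha> v = (SG c d (\<alpha> * cj \<alpha>) (\<eta> * cj \<alpha> * cj v) - RG c 0 d 0) \<union> transversals B (RG c 0 d 0)"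

text \<open>One triple accounts for the Hall spreads of all offsets \<open>c\<close> in the
  direction \<open>d\<close>. The equation \<open>cj d * v = u * d\<close> ties the ratio of
  \<open>u\<close> and \<open>v\<close> to that direction.\<close>

definition family :: "'a \<Rightarrow> 'a \<Rightarrow> 'a \<Rightarrow> 'a \<Rightarrow> bool" where
  "family d \<alpha> u v \<longleftrightarrow> d \<noteq> 0 \<and> \<alpha> \<in> I \<and> u \<in> U \<and> v \<in> U \<and> cj d * v = u * d \<and>
     (\<forall>c. D_spread q \<eta> \<inter> SG c d (\<alpha> * cj \<alpha>) (\<eta> * cj \<alpha> * cj v) = RG c 0 d 0 \<and> hall c d \<alpha> v \<in> \<Omega>)"

lemma familyD:
  assumes "family d \<alpha> u v"
  shows "d \<noteq> 0" "\<alpha> \<in> I" "u \<in> U" "v \<in> U" "cj d * v = u * d"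
    "D_spread q \<eta> \<inter> SG c d (\<alpha> * cj \<alpha>) (\<eta> * cj \<alpha> * cj v) = RG c 0 d 0" "hall c d \<alpha> v \<in> \<Omega>"
  using assms by (simp_all add: family_def)

lemma family_exists:
  assumes z: "z \<in> U"
  shows "\<exists>d \<alpha> v. family d \<alpha> (z * v) v"
proof -
  obtain d where d: "d \<noteq> 0" "cj d = z * d" using hilbert90[OF z] by blast
  obtain \<mu> \<nu> where m: "\<nu> \<noteq> 0" "\<And>t. t \<in> F \<Longrightarrow> (\<mu> + t) * cj (\<mu> + t) \<noteq> \<nu> * cj \<nu>"
    and in_\<Omega>: "\<And>c. HG c d \<mu> \<nu> \<union> transversals B (RG c 0 d 0) \<in> \<Omega>"
    by (rule hall_spread_family[OF d(1)]) (rule that)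
  obtain k0 where k0: "k0 \<in> F" "k0 \<noteq> 0" "k0 \<noteq> 1" "k0 = - 1 \<Longrightarrow> odd q"
    "normal_form \<mu> \<nu> k0" "normal_form \<mu> \<nu> (inverse k0)"
    by (rule normal_form_exists[OF m]) (assumption, rule that)
  \<comment> \<open>The index set need not contain an element of norm \<open>k0\<close>, but then it
    has one of the inverse norm, which also is a normal form for the same coefficients.\<close>
  obtain \<alpha> where \<alpha>: "\<alpha> \<in> I" "\<alpha> * cj \<alpha> = k0 \<or> \<alpha> * cj \<alpha> = inverse k0"
    by (rule ex_I[OF k0(1-4)]) (assumption, rule that)
  define k where "k = \<alpha> * cj \<alpha>"
  have k: "k \<in> F" "k \<noteq> 0" "k \<noteq> 1" using I_norm[OF \<alpha>(1)] by (simp_all add: k_def)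
  have "normal_form \<mu> \<nu> k" using \<alpha>(2) k0(5,6) by (auto simp: k_def)
  from this m(1) d(1) k(1,3) obtain \<kappa> where \<kappa>: "\<kappa> * cj \<kappa> = k"
    "\<And>c. SG c d k \<kappa> = insert Linf {G (c + d * (t + s * \<mu>)) (d * (s * \<nu>)) | s t. s \<in> F \<and> t \<in> F}"
    by (rule normal_form_SG) (rule that)
  define \<theta> where "\<theta> = \<eta> * cj \<alpha>"
  \<comment> \<open>Chosen to make \<open>\<eta> * cj \<alpha> * cj v = \<kappa>\<close>; it has
    norm 1 because \<open>\<theta>\<close> and \<open>\<kappa>\<close> both have norm
    \<open>k\<close>.\<close>
  define v where "v = \<theta> / \<kappa>"
  have \<kappa>0: "\<kappa> \<noteq> 0" using \<kappa>(1) k(2) by auto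
  have "\<theta> * cj \<theta> = (\<eta> * cj \<eta>) * k" by (simp add: \<theta>_def k_def mult_ac)
  then have "v * cj v = 1" using eta_norm \<kappa>(1) k(2) by (simp add: v_def)
  then have v: "v \<in> U" "v \<noteq> 0" by (auto simp: in_U)
  have "(z * v) * cj (z * v) = (z * cj z) * (v * cj v)" by (simp add: mult_ac)
  then have "z * v \<in> U" using z v(1) by (simp only: in_U mult_1_left)
  have "\<kappa> * v = \<theta>" using \<kappa>0 by (simp add: v_def)
  then have "\<kappa> * (v * cj v) = \<theta> * cj v" by (simp only: mult.assoc[symmetric])
  then have \<kappa>_eq: "\<eta> * cj \<alpha> * cj v = \<kappa>" using \<open>v * cj v = 1\<close> by (simp add: \<theta>_def)
  have "D_spread q \<eta> \<inter> SG c d k \<kappa> = RG c 0 d 0" "hall c d \<alpha> v = HG c d \<mu> \<nu> \<union> transversals B (RG c 0 d 0)" for c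
    unfolding hall_def \<kappa>_eq k_def[symmetric] \<kappa>(2)
    using spread_Int_D_spread[OF m(1) d(1), where c = c and \<mu> = \<mu>] by simp_all
  moreover have "cj d * v = z * v * d" unfolding d(2) by (simp add: mult_ac)
  ultimately have "family d \<alpha> (z * v) v"
    unfolding family_def \<kappa>_eq k_def[symmetric] using d(1) \<alpha>(1) v(1) \<open>z * v \<in> U\<close> in_\<Omega> by simp
  then show ?thesis by blast
qed

text \<open>The marker \<open>M d c 1\<close> is neither \<open>Linf\<close> nor a graph, so in the
  second spread it is one of the switched lines. Hence d' is an F-multiple of d, and the quotients
  cj d / d = u / v and cj d' / d' = w / z agree.\<close>

lemma hall_eqD:
  assumes "family d \<alpha> u v" "family d' \<beta> w z" "hall c d \<alpha> v = hall c' d' \<beta> z"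
  shows "u * z = v * w"
proof -
  note f = familyD[OF assms(1)] and f' = familyD[OF assms(2)]
  have "M d c 1 \<in> hall c d \<alpha> v" unfolding hall_def using M_in_transversals[OF f(1)] by blast
  then have "M d c 1 \<in> hall c' d' \<beta> z" using assms(3) by simp
  moreover have "M d c 1 \<notin> SG c' d' k \<kappa>" for k \<kappa>
  proof
    assume "M d c 1 \<in> SG c' d' k \<kappa>"
    then obtain m n where "M d c 1 = Linf \<or> M d c 1 = G m n" unfolding SG_def by blast
    then show False using M_ne_Linf[OF f(1), of 1 c] G_ne_M[OF f(1), of m n c 1] by simp
  qed
  ultimately have "M d c 1 \<in> transversals B (RG c' 0 d' 0)" unfolding hall_def by blast
  then have "d' / d \<in> F" using f(1) direction_of_transversal by blast
  then have e: "cj d' * d = d' * cj d" using f(1) f'(1) by (simp add: in_F field_simps)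
  have "(u * z) * (d * d') = (u * d) * (z * d')" by (simp add: mult_ac)
  also have "\<dots> = (cj d * d') * (v * z)" unfolding f(5)[symmetric] by (simp add: mult_ac)
  also have "\<dots> = (cj d' * d) * (v * z)" using e by (simp add: mult_ac)
  also have "\<dots> = (cj d' * z) * (v * d)" by (simp add: mult_ac)
  also have "\<dots> = (v * w) * (d * d')" unfolding f'(5) by (simp add: mult_ac)
  finally show ?thesis using f(1) f'(1) by simp
qed

text \<open>
  If the second condition for good sets failed, the coefficients of \<open>cj y\<close> in the two families would
  be proportional over \<open>F\<close>, and suitable members of the two families would share a line.
\<close>

lemma family_good:
  assumes "family d \<alpha> u v" "family d' \<beta> w z" "\<alpha> * u * cj (\<beta> * z) = cj (\<alpha> * v) * (\<beta> * w)"
  shows "u * z = v * w"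
proof -
  note f = familyD[OF assms(1)] and f' = familyD[OF assms(2)]
  obtain x where x: "x \<notin> F" using ex_not_in_F by blast
  define D where "D = cj x - x"
  have D: "D \<noteq> 0" "cj D = - D" using x by (auto simp: D_def in_F)
  define n where "n = d * (\<eta> * cj \<alpha> * cj v * D / (1 - \<alpha> * cj \<alpha>))"
  define n' where "n' = d' * (\<eta> * cj \<beta> * cj z * D / (1 - \<beta> * cj \<beta>))"
  have K: "1 - \<alpha> * cj \<alpha> \<noteq> 0" "1 - \<beta> * cj \<beta> \<noteq> 0" using I_norm f(2) f'(2) by auto
  have cK: "cj (1 - \<alpha> * cj \<alpha>) = 1 - \<alpha> * cj \<alpha>" "cj (1 - \<beta> * cj \<beta>) = 1 - \<beta> * cj \<beta>"
    by (simp_all add: mult.commute)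
  have vz: "v * cj v = 1" "z * cj z = 1" using f(4) f'(4) by (simp_all add: in_U)
  have cd: "cj d = u * cj v * d" "cj d' = w * cj z * d'"
  proof -
    have "cj d * (v * cj v) = u * d * cj v" using f(5) by (simp flip: mult.assoc)
    then show "cj d = u * cj v * d" using vz by (simp add: mult_ac)
    have "cj d' * (z * cj z) = w * d' * cj z" using f'(5) by (simp flip: mult.assoc)
    then show "cj d' = w * cj z * d'" using vz by (simp add: mult_ac)
  qed
  have nz: "n \<noteq> 0" "n' \<noteq> 0"
    using f(1) f'(1) I_norm(1)[OF f(2)] I_norm(1)[OF f'(2)] D K vz by (auto simp: n_def n'_def)
  \<comment> \<open>\<open>C\<close> is the common factor of \<open>n * cj n'\<close> and
    \<open>n' * cj n\<close>; what remains are the two sides of the assumed equation, so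
    \<open>n / n'\<close> lies in F.\<close>
  define C where "C = - (d * d' * (\<eta> * cj \<eta>) * (D * D) / ((1 - \<alpha> * cj \<alpha>) * (1 - \<beta> * cj \<beta>)))"
  have "n * cj n' = C * (cj (\<alpha> * v) * (\<beta> * w)) * (z * cj z)"
    unfolding n_def n'_def C_def cj_mult cj_divide cK cd(2) D(2) by (simp add: mult_ac)
  moreover have "n' * cj n = C * (\<alpha> * u * cj (\<beta> * z)) * (v * cj v)"
    unfolding n_def n'_def C_def cj_mult cj_divide cK cd(1) D(2) by (simp add: mult_ac)
  ultimately have "n * cj n' = n' * cj n" using assms(3) vz by simp
  then have r: "n / n' \<in> F" using nz by (intro dependent_imp_ratio)
  define r where "r = n / n'"
  have cr: "cj r = r" using r by (simp add: in_F r_def)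
  define m where "m = d * ((x - \<alpha> * cj \<alpha> * cj x) / (1 - \<alpha> * cj \<alpha>))"
  \<comment> \<open>Scaling the parameter of the second family by \<open>r\<close> turns its
    coefficient \<open>n'\<close> into \<open>n\<close>. The offsets \<open>- m\<close> and
    \<open>- m'\<close> then cancel the other coefficients, so that both spreads contain
    \<open>G 0 n\<close>.\<close>
  define m' where "m' = d' * ((r * x - \<beta> * cj \<beta> * cj (r * x)) / (1 - \<beta> * cj \<beta>))"
  have "n = r * n'" using nz by (simp add: r_def)
  also have "\<dots> = d' * (\<eta> * cj \<beta> * cj z * (cj (r * x) - r * x) / (1 - \<beta> * cj \<beta>))"
    by (simp add: n'_def D_def cr right_diff_distrib mult_ac)
  finally have n': "n = d' * (\<eta> * cj \<beta> * cj z * (cj (r * x) - r * x) / (1 - \<beta> * cj \<beta>))" .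
  have "G (- m + m) n \<in> SG (- m) d (\<alpha> * cj \<alpha>) (\<eta> * cj \<alpha> * cj v)"
    unfolding SG_def m_def n_def D_def by blast
  moreover have "G (- m' + m') n \<in> SG (- m') d' (\<beta> * cj \<beta>) (\<eta> * cj \<beta> * cj z)"
    unfolding SG_def m'_def n' by blast
  ultimately have "G 0 n \<in> hall (- m) d \<alpha> v" "G 0 n \<in> hall (- m') d' \<beta> z"
    using nz by (simp_all add: hall_def G_in_RG)
  then have "hall (- m) d \<alpha> v = hall (- m') d' \<beta> z"
    using parallelism_disjoint[OF parallelism f(7) f'(7)] by blast
  then show ?thesis using hall_eqD assms(1,2) by blast
qed

lemma family_pencil:
  assumes f: "family d \<alpha> u v"
  shows "l \<in> pencil q \<alpha> u v \<Longrightarrow> l \<noteq> rU1 \<Longrightarrow>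
      \<exists>c. switch B (line_spread_of q \<eta> l) (R_reg q \<eta> l) = hall c d \<alpha> v"
    and "\<exists>l. l \<in> pencil q \<alpha> u v \<and> l \<noteq> rU1 \<and>
      switch B (line_spread_of q \<eta> l) (R_reg q \<eta> l) = hall c d \<alpha> v"
proof -
  note fD = familyD[OF f]
  obtain e where e: "e \<noteq> 0" "cj e = v * e" using hilbert90[OF fD(4)] by blast
  \<comment> \<open>The link between \<open>d\<close>, \<open>u\<close> and \<open>v\<close> makes
    \<open>d * e\<close> a Hilbert 90 solution for \<open>u\<close>, so the spreads of this pencil
    have direction \<open>d * e / e = d\<close>.\<close>
  have x0: "d * e \<noteq> 0" "cj (d * e) = u * (d * e)"
    using e fD(1,5) by (simp_all flip: mult.assoc)
  have N: "\<alpha> * cj \<alpha> \<noteq> 1" "\<alpha> \<noteq> 0" using I_norm fD(2) by blast+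
  have sw: "switch B (line_spread_of q \<eta> (join (Ppt (\<alpha> * u)) (Lpt \<alpha> x e)))
      (R_reg q \<eta> (join (Ppt (\<alpha> * u)) (Lpt \<alpha> x e))) = hall (x / e) d \<alpha> v" for x
  proof -
    have "line_spread_of q \<eta> (join (Ppt (\<alpha> * u)) (Lpt \<alpha> x e)) =
        SG (x / e) d (\<alpha> * cj \<alpha>) (\<eta> * cj \<alpha> * cj v)"
      using line_spread_of_pencil_line[OF fD(3,4) N(1) x0 e] e(1) by simp
    then show ?thesis using fD(6) by (simp add: switch_def R_reg_def hall_def)
  qed
  show "\<exists>c. switch B (line_spread_of q \<eta> l) (R_reg q \<eta> l) = hall c d \<alpha> v"
    if l: "l \<in> pencil q \<alpha> u v" "l \<noteq> rU1"
  proof -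
    obtain x where x: "l = join (Ppt (\<alpha> * u)) (Lpt \<alpha> x e)"
      using l pencil_line_iff[OF fD(3,4) N(2) e, of l] by blast
    show ?thesis unfolding x sw by blast
  qed
  show "\<exists>l. l \<in> pencil q \<alpha> u v \<and> l \<noteq> rU1 \<and>
      switch B (line_spread_of q \<eta> l) (R_reg q \<eta> l) = hall c d \<alpha> v"
  proof -
    let ?l = "join (Ppt (\<alpha> * u)) (Lpt \<alpha> (c * e) e)"
    have "?l \<in> pencil q \<alpha> u v \<and> ?l \<noteq> rU1"
      unfolding pencil_line_iff[OF fD(3,4) N(2) e] by blast
    then show ?thesis using sw[of "c * e"] e(1) by (intro exI[of _ ?l]) simp
  qed
qed

lemma parallelism_eq_Pi_family: "\<exists>\<P>. good_set q \<Lambda> A \<P> \<and> \<Omega> = Pi_family q \<Lambda> A \<eta> \<P>"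
proof -
  obtain d \<alpha> v where fam: "\<And>z. z \<in> U \<Longrightarrow> family (d z) (\<alpha> z) (z * v z) (v z)"
    using family_exists by metis
  \<comment> \<open>One triple for each direction class; the class \<open>z\<close> is recovered as
    the ratio of the second and third entries.\<close>
  define T where "T = (\<lambda>z. (\<alpha> z, z * v z, v z)) ` U"
  define \<P> where "\<P> = (\<lambda>(\<alpha>, u, v). (Ppt (\<alpha> * u), plane (\<alpha> * v))) ` T"
  have v0: "v z \<noteq> 0" if "z \<in> U" for z
    using familyD(4)[OF fam[OF that]] by (auto simp: in_U)
  have \<alpha>0: "\<alpha> z \<noteq> 0" if "z \<in> U" for z
    using familyD(2)[OF fam[OF that]] I_norm(1) by blast
  have "inj_on (\<lambda>z. (Ppt (\<alpha> z * (z * v z)), plane (\<alpha> z * v z))) U"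
  proof (rule inj_onI)
    fix y z assume yz: "y \<in> U" "z \<in> U"
      "(Ppt (\<alpha> y * (y * v y)), plane (\<alpha> y * v y)) = (Ppt (\<alpha> z * (z * v z)), plane (\<alpha> z * v z))"
    then have e: "\<alpha> y * (y * v y) = \<alpha> z * (z * v z)" "\<alpha> y * v y = \<alpha> z * v z"
      by (simp_all only: prod.inject Ppt_eq_iff plane_eq_iff)
    have "y * (\<alpha> y * v y) = z * (\<alpha> y * v y)" using e by (simp add: mult_ac)
    then show "y = z" using v0 \<alpha>0 yz(1) by simp
  qed
  moreover have \<P>_eq: "\<P> = (\<lambda>z. (Ppt (\<alpha> z * (z * v z)), plane (\<alpha> z * v z))) ` U"
    by (simp add: \<P>_def T_def image_image)
  ultimately have "card \<P> = q + 1" by (simp add: card_image card_U)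
  moreover have "T \<subseteq> I \<times> U \<times> U" using familyD(2,3,4)[OF fam] by (auto simp: T_def)
  moreover have "\<forall>(\<alpha>, u, v)\<in>T. \<forall>(\<beta>, w, z)\<in>T. (\<alpha>, u, v) \<noteq> (\<beta>, w, z) \<longrightarrow>
      u * z - v * w \<noteq> 0 \<and> \<alpha> * u * (\<beta> * z) ^ q - (\<alpha> * v) ^ q * (\<beta> * w) \<noteq> 0"
  proof -
    have "(y * v y) * v z - v y * (z * v z) \<noteq> 0 \<and>
      \<alpha> y * (y * v y) * (\<alpha> z * v z) ^ q - (\<alpha> y * v y) ^ q * (\<alpha> z * (z * v z)) \<noteq> 0"
      if "y \<in> U" "z \<in> U" "y \<noteq> z" for y z
    proof -
      have "(y * v y) * v z \<noteq> v y * (z * v z)" using v0 that by (simp add: mult_ac)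
      moreover from this have "\<alpha> y * (y * v y) * cj (\<alpha> z * v z) \<noteq> cj (\<alpha> y * v y) * (\<alpha> z * (z * v z))"
        using family_good[OF fam[OF that(1)] fam[OF that(2)]] by blast
      ultimately show ?thesis by (simp add: cj_def)
    qed
    then show ?thesis unfolding T_def by auto
  qed
  ultimately have good: "good_set q \<Lambda> A \<P>" unfolding good_set_def \<P>_def by blast
  \<comment> \<open>A pair of \<open>\<P>\<close> determines its triple: the norm of
    \<open>\<beta> * w\<close> is that of \<open>\<beta>\<close>, norms are injective on
    \<open>\<Lambda>\<close>, and then the two units follow.\<close>
  have L: "l \<in> L_lines q \<Lambda> A \<P> \<longleftrightarrow> l \<noteq> rU1 \<and> (\<exists>z\<in>U. l \<in> pencil q (\<alpha> z) (z * v z) (v z))" for l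
  proof
    assume "l \<in> L_lines q \<Lambda> A \<P>"
    then obtain \<beta> u w where l: "l \<noteq> rU1" "\<beta> \<in> I" "u \<in> U" "w \<in> U"
      "(Ppt (\<beta> * u), plane (\<beta> * w)) \<in> \<P>" "l \<in> pencil q \<beta> u w"
      unfolding L_lines_def by blast
    from l(5) obtain z where "z \<in> U"
      "(Ppt (\<beta> * u), plane (\<beta> * w)) = (Ppt (\<alpha> z * (z * v z)), plane (\<alpha> z * v z))"
      unfolding \<P>_eq by (rule imageE)
    then have z: "z \<in> U" "\<beta> * u = \<alpha> z * (z * v z)" "\<beta> * w = \<alpha> z * v z"
      by (simp_all only: prod.inject Ppt_eq_iff plane_eq_iff)
    have "w * cj w = 1" "v z * cj (v z) = 1" using l(4) familyD(4)[OF fam[OF z(1)]] by (simp_all add: in_U)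
    moreover have "(\<beta> * w) * cj (\<beta> * w) = (\<beta> * cj \<beta>) * (w * cj w)"
      "(\<alpha> z * v z) * cj (\<alpha> z * v z) = (\<alpha> z * cj (\<alpha> z)) * (v z * cj (v z))" by (simp_all add: mult_ac)
    ultimately have "\<beta> * cj \<beta> = \<alpha> z * cj (\<alpha> z)" using z(3) by simp
    then have "\<beta> = \<alpha> z"
      using Lambda_norms(2) l(2) familyD(2)[OF fam[OF z(1)]] by (auto simp: inj_on_def in_I)
    then show "l \<noteq> rU1 \<and> (\<exists>z\<in>U. l \<in> pencil q (\<alpha> z) (z * v z) (v z))"
      using l(1,6) z \<alpha>0 by auto
  next
    assume "l \<noteq> rU1 \<and> (\<exists>z\<in>U. l \<in> pencil q (\<alpha> z) (z * v z) (v z))"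
    then obtain z where z: "l \<noteq> rU1" "z \<in> U" "l \<in> pencil q (\<alpha> z) (z * v z) (v z)" by blast
    then have "(Ppt (\<alpha> z * (z * v z)), plane (\<alpha> z * v z)) \<in> \<P>" unfolding \<P>_eq by blast
    then show "l \<in> L_lines q \<Lambda> A \<P>"
      unfolding L_lines_def using z familyD(2,3,4)[OF fam[OF z(2)]] by blast
  qed
  have "H \<in> Pi_family q \<Lambda> A \<eta> \<P> \<longleftrightarrow> H = D_spread q \<eta> \<or> (\<exists>z\<in>U. \<exists>c. H = hall c (d z) (\<alpha> z) (v z))" for H
  proof
    assume "H \<in> Pi_family q \<Lambda> A \<eta> \<P>"
    then consider "H = D_spread q \<eta>" | l where "l \<in> L_lines q \<Lambda> A \<P>"
      "H = switch B (line_spread_of q \<eta> l) (R_reg q \<eta> l)"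
      unfolding Pi_family_def by blast
    then show "H = D_spread q \<eta> \<or> (\<exists>z\<in>U. \<exists>c. H = hall c (d z) (\<alpha> z) (v z))"
    proof cases
      case (2 l)
      then obtain z where z: "l \<noteq> rU1" "z \<in> U" "l \<in> pencil q (\<alpha> z) (z * v z) (v z)" using L by blast
      then show ?thesis unfolding 2(2) using family_pencil(1)[OF fam[OF z(2)] z(3,1)] by blast
    qed simp
  next
    assume "H = D_spread q \<eta> \<or> (\<exists>z\<in>U. \<exists>c. H = hall c (d z) (\<alpha> z) (v z))"
    then consider "H = D_spread q \<eta>" | z c where "z \<in> U" "H = hall c (d z) (\<alpha> z) (v z)" by blast
    then show "H \<in> Pi_family q \<Lambda> A \<eta> \<P>"
    proof cases
      case (2 z c)
      obtain l where l: "l \<in> pencil q (\<alpha> z) (z * v z) (v z)" "l \<noteq> rU1"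
        "switch B (line_spread_of q \<eta> l) (R_reg q \<eta> l) = H"
        unfolding 2(2) using family_pencil(2)[OF fam[OF 2(1)], of c] by blast
      then have "l \<in> L_lines q \<Lambda> A \<P>" using L 2(1) by blast
      then show ?thesis unfolding Pi_family_def l(3)[symmetric] by blast
    qed (simp add: Pi_family_def)
  qed
  moreover have "H \<in> \<Omega> \<longleftrightarrow> H = D_spread q \<eta> \<or> (\<exists>z\<in>U. \<exists>c. H = hall c (d z) (\<alpha> z) (v z))" for H
  proof
    assume H: "H \<in> \<Omega>"
    show "H = D_spread q \<eta> \<or> (\<exists>z\<in>U. \<exists>c. H = hall c (d z) (\<alpha> z) (v z))"
    proof (cases "H = D_spread q \<eta>")
      case False
      then obtain R where R: "regulus B R" "R \<subseteq> D_spread q \<eta>" "Linf \<in> R" "hall_by_switching B R H"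
        using Hall[of H] H unfolding rU1_Int_B by blast
      obtain c d0 where d0: "d0 \<noteq> 0" "R = RG c 0 d0 0"
        by (rule regulus_in_D[OF R(1-3)]) (rule that)
      \<comment> \<open>The representative \<open>d z\<close> chosen for this class is an F-multiple
        of \<open>d0\<close>, so it defines the same regulus, and the marker line in its opposite
        identifies the two Hall spreads.\<close>
      define z where "z = cj d0 / d0"
      have z: "z \<in> U" using d0(1) by (simp add: z_def in_U)
      note f = familyD[OF fam[OF z]]
      have "cj (d z) * v z = (z * d z) * v z" using f(5) by (simp add: mult_ac)
      then have "cj (d z) = z * d z" using v0[OF z] by simp
      then have "d z / d0 \<in> F" "d z / d0 \<noteq> 0" using d0(1) f(1) by (simp_all add: z_def in_F)
      then have "RG c 0 (d z / d0 * d0) 0 = R" unfolding d0(2) by (rule RG_scale)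
      then have "R = RG c 0 (d z) 0" using d0(1) by simp
      then have "transversals B (RG c 0 (d z) 0) \<subseteq> H"
        using R(4) by (auto simp: hall_by_switching_def switch_def)
      moreover have "M (d z) c 1 \<in> transversals B (RG c 0 (d z) 0)" by (rule M_in_transversals[OF f(1)])
      ultimately have "H = hall c (d z) (\<alpha> z) (v z)"
        using parallelism_disjoint[OF parallelism H f(7)] unfolding hall_def by blast
      then show ?thesis using z by blast
    qed simp
  next
    assume "H = D_spread q \<eta> \<or> (\<exists>z\<in>U. \<exists>c. H = hall c (d z) (\<alpha> z) (v z))"
    then show "H \<in> \<Omega>" using D_in familyD(7)[OF fam] by blast
  qed
  ultimately have "\<Omega> = Pi_family q \<Lambda> A \<eta> \<P>" by (intro set_eqI) (simp only:)
  then show ?thesis using good by blast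
qed

end

theorem theorem3p6:
  fixes q :: nat
    and \<Lambda> A :: "'a::{field, finite} set"
    and \<eta> :: 'a
    and \<Omega> :: "'a point set set set"
  assumes q: "primepow q" "q \<ge> 3"
    and field: "CARD('a) = q ^ 2"
    and Lambda: "norm_transversal q \<Lambda>"
    and eta: "units1 q \<inter> \<Lambda> = {\<eta>}"
    and A: "half_system q A"
    and parallelism: "line_parallelism (baer q \<eta>) \<Omega>"
    and D_in: "D_spread q \<eta> \<in> \<Omega>"
    and number: "card (\<Omega> - {D_spread q \<eta>}) = q ^ 2 + q"
    and Hall: "\<And>H. H \<in> \<Omega> - {D_spread q \<eta>} \<Longrightarrow>
      \<exists>R. regulus (baer q \<eta>) R \<and> R \<subseteq> D_spread q \<eta> \<and> rU1 \<inter> baer q \<eta> \<in> R \<and>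
          hall_by_switching (baer q \<eta>) R H"
    and unique: "\<And>R. \<lbrakk>regulus (baer q \<eta>) R; R \<subseteq> D_spread q \<eta>; rU1 \<inter> baer q \<eta> \<in> R\<rbrakk> \<Longrightarrow>
      \<exists>!H. H \<in> \<Omega> \<and> hall_by_switching (baer q \<eta>) R H"
    and E_invariant: "\<And>g. g \<in> E_group q \<Longrightarrow> (\<lambda>S. (\<lambda>l. g ` l) ` S) ` \<Omega> = \<Omega>"
  shows "\<exists>\<P>. good_set q \<Lambda> A \<P> \<and> \<Omega> = Pi_family q \<Lambda> A \<eta> \<P>"
proof -
  interpret invariant_parallelism q "TYPE('a)" \<eta> \<Lambda> A \<Omega>
  proof unfold_locales
    show "\<eta> \<in> units1 q" using eta by blast
  qed (fact q field Lambda A parallelism D_in Hall unique E_invariant)+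
  show ?thesis by (rule parallelism_eq_Pi_family)
qed

end
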